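(* For all integers $k \geq 3$, $g \geq 3$, and $r \geq 2$, let $R = R(K_k;r)$ denote the least integer $m$ such that every $r$-colouring of the edges of the complete graph $K_m$ yields a monochromatic copy of $K_k$. Then there exists a graph $H$ such that $$\chi\binom{H}{K_k} > r, \qquad \operatorname{girth}\binom{H}{K_k} \geq g, \qquad\text{and}\qquad |V(H)| \leq k^{40gk^4}\, R^{40gk^2}.$$
   Context: All graphs are finite and simple. For a graph $H$, $\binom{H}{K_k}$ denotes the $\binom{k}{2}$-uniform hypergraph whose vertex set is the edge set $E(H)$ and whose hyperedges are the edge sets of the copies of $K_k$ in $H$. The chromatic number $\chi$ of a hypergraph is the least number of colours in a vertex colouring with no monochromatic hyperedge; thus $\chi\binom{H}{K_k} > r$ means that every $r$-colouring of $E(H)$ yields a monochromatic $K_k$. An $\ell$-uniform hypergraph has girth at least $g$ if, for every integer $h$ with $2 \leq h < g$, any set of $h$ (distinct) hyperedges spans at least $(\ell-1)h+1$ vertices, i.e. their union has at least $(\ell-1)h+1$ elements (here $\ell = \binom{k}{2}$). *)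

theory Defs
  imports "HOL-Library.Ramsey"
begin

definition simple_graph :: "'a set \<Rightarrow> 'a set set \<Rightarrow> bool" where
  "simple_graph V E \<longleftrightarrow> finite V \<and> E \<subseteq> nsets V 2"

text \<open>A hypergraph is a pair of its vertex set and its set of hyperedges.\<close>

type_synonym 'a hypergraph = "'a set \<times> 'a set set"

definition clique_hypergraph :: "'a set \<Rightarrow> 'a set set \<Rightarrow> nat \<Rightarrow> 'a set hypergraph" where
  "clique_hypergraph V E k = (E, {nsets K 2 | K. K \<in> nsets V k \<and> clique K E})"

definition proper_colouring :: "'a hypergraph \<Rightarrow> nat \<Rightarrow> ('a \<Rightarrow> nat) \<Rightarrow> bool" where
  "proper_colouring X c f \<longleftrightarrow>
     f \<in> fst X \<rightarrow> {..<c} \<and> (\<forall>e\<in>snd X. \<not> (\<exists>i. f ` e \<subseteq> {i}))"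

text \<open>The least number below exists if there are finitely many vertices and every hyperedge
  contains at least two of them. For the hypergraph of \<open>k\<close>-cliques in a finite graph
  this means \<open>k \<ge> 3\<close>: see \<open>chromatic_number_clique_hypergraph\<close>.\<close>

definition chromatic_number :: "'a hypergraph \<Rightarrow> nat" where
  "chromatic_number X = (LEAST c. \<exists>f. proper_colouring X c f)"

text \<open>The girth of \<open>X\<close>, regarded as an \<open>l\<close>-uniform hypergraph, is at least \<open>g\<close>.
  The subtraction is meant for \<open>l \<ge> 1\<close>.\<close>

definition girth_at_least :: "nat \<Rightarrow> 'a hypergraph \<Rightarrow> nat \<Rightarrow> bool" where
  "girth_at_least l X g \<longleftrightarrow>
     (\<forall>h. 2 \<le> h \<and> h < g \<longrightarrow>
        (\<forall>S. S \<subseteq> snd X \<and> card S = h \<longrightarrow> (l - 1) * h + 1 \<le> card (\<Union>S)))"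

definition ramsey_number :: "nat \<Rightarrow> nat \<Rightarrow> nat" where
  "ramsey_number k r = (LEAST m. partn {..<m} k 2 {..<r})"

lemma ramsey_number_partn: "partn {..<ramsey_number k r} k 2 {..<r}"
proof -
  obtain N :: nat where "partn_lst {..<N} (replicate r k) 2"
    using ramsey_full by blast
  then have "partn {..<N} k 2 {..<r}"
    unfolding partn_lst_def partn_def length_replicate by (metis lessThan_iff nth_replicate)
  then show ?thesis
    unfolding ramsey_number_def by (rule LeastI)
qed

lemma clique_hypergraph_uniform:
  assumes "e \<in> snd (clique_hypergraph V E k)"
  shows "e \<subseteq> E" "finite e" "card e = k choose 2"
proof -
  obtain K where K: "e = nsets K 2" "K \<in> nsets V k" "clique K E"
    using assms by (auto simp: clique_hypergraph_def)
  show "e \<subseteq> E"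
    using K by (auto simp: clique_def elim!: nsets2_E)
  show "finite e" "card e = k choose 2"
    using K by (simp_all add: nsets_def[of V] finite_imp_finite_nsets)
qed

lemma chromatic_number_clique_hypergraph:
  fixes V :: "'a set"
  assumes "simple_graph V E" "k \<ge> 3"
  shows "chromatic_number (clique_hypergraph V E k) > r \<longleftrightarrow>
    (\<forall>f \<in> E \<rightarrow> {..<r}. \<exists>K \<in> nsets V k. clique K E \<and> (\<exists>i. f ` nsets K 2 \<subseteq> {i}))"
proof -
  let ?X = "clique_hypergraph V E k"
  have mono: "proper_colouring ?X d f" if "proper_colouring ?X c f" "c \<le> d" for c d f
    using that unfolding proper_colouring_def by (auto simp: Pi_iff)
  have "finite E"
    using assms(1) by (meson finite_imp_finite_nsets finite_subset simple_graph_def)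
  then obtain f :: "'a set \<Rightarrow> nat" and n where f: "f ` E = {i. i < n}" "inj_on f E"
    using finite_imp_inj_to_nat_seg by metis
  have "\<not> f ` e \<subseteq> {i}" if e: "e \<in> snd ?X" for e i
  proof
    assume "f ` e \<subseteq> {i}"
    then have "card (f ` e) \<le> 1"
      using card_mono[of "{i}" "f ` e"] by simp
    moreover have "card (f ` e) = k choose 2"
      using f(2) clique_hypergraph_uniform[OF e] by (metis card_image inj_on_subset)
    moreover have "3 choose 2 \<le> k choose 2"
      using assms(2) by (rule binomial_right_mono)
    ultimately show False by (simp add: choose_two)
  qed
  then have "proper_colouring ?X n f"
    using f(1) by (auto simp: proper_colouring_def clique_hypergraph_def)
  then have "\<exists>f. proper_colouring ?X n f" by blast
  then have ex: "\<exists>f. proper_colouring ?X (chromatic_number ?X) f"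
    unfolding chromatic_number_def by (rule LeastI)
  have least: "chromatic_number ?X \<le> c" if "proper_colouring ?X c f" for c f
    unfolding chromatic_number_def by (rule Least_le) (use that in blast)
  have "chromatic_number ?X \<le> r \<longleftrightarrow> (\<exists>f. proper_colouring ?X r f)"
    using ex mono least by blast
  moreover have "(\<exists>f. proper_colouring ?X r f) \<longleftrightarrow>
    (\<exists>f \<in> E \<rightarrow> {..<r}. \<forall>K \<in> nsets V k. clique K E \<longrightarrow> \<not> (\<exists>i. f ` nsets K 2 \<subseteq> {i}))"
    unfolding proper_colouring_def clique_hypergraph_def fst_conv snd_conv Bex_def Ball_def
      mem_Collect_eq by metis
  ultimately show ?thesis
    unfolding not_le[symmetric] by blast
qed

end

theory Submission
  imports Defs Complex_Main
begin

text \<open>The graph is found at random: each edge of the complete graph on $n = b^{k+1}$ vertices is kept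
  with probability $q = M^{10} b^{-2}$, where $M = kR$ and $b = M^{30gk}$, so that $q$ is
  $M^{10} n^{-2/(k+1)}$.
  A decreasing event can be compared with a union bound: by Harris' inequality the graph has no short
  cycle of cliques with probability at least $\exp(-2\Sigma)$, where $\Sigma$ is the expected number of
  minimal such cycles, whereas the probability of having a good $r$-colouring is at most
  $\exp(-q N/(4R^2))$ with $N = {n \choose 2}$. For the above choice of $q$ a clique glued to a path of
  cliques along a single edge contributes the factor $M^{O(k^2)}$ to $\Sigma$, but the clique closing a
  cycle contributes a negative power of $b$, so that the second bound is the smaller one.

  The bound on colourings comes from hypergraph containers. The state of the container algorithm is a
  family $D$ of sets closed under subsets, initially all clique-free edge sets; its potential is the
  probability that a $p$-random set lies in $D$. As long as some small $T \in D$ is such that adding $T$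
  throws a random member of $D$ out of $D$ with noticeable probability, one asks whether $T$ is a
  subset of the given independent set. A positive answer lowers the potential, which never falls below
  $(1-p)^N$, so there are few of them. If no such $T$ is left, a second moment argument shows that
  there are few minimal non-members of $D$, and every clique inside the container contains one of them.\<close>

section \<open>Binomial coefficients and elementary inequalities\<close>

text \<open>The exponent 2/(k+1) comes from (k choose 2) - 1 = (k+1)(k-2)/2: at q = n^(-2/(k+1)) the
  n^(k-2) choices for a clique glued along an edge are exactly cancelled by its new edges, so paths
  of any length stay balanced up to powers of M. Containers for k-cliques work down to the same
  threshold, and a fixed power of M between p and q pays for the number of fingerprints. A closing
  clique that meets the path in v vertices, 3 <= v < k, is worth b^(-(k-v)(v-2)) up to powers of M,
  hence at most b^(-(k-3)). The obstacle is v = k: no vertex is new, and the saving has to come from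
  edges that the path does not supply. Paths are therefore required to be glued along single edges:
  such a union has no k-cliques besides its own, and any other k-set misses at least max(1, k-3)
  edges, each worth a factor q. The expected number of short cycles is only shown to be small
  against q n^2, not below 1. So the graph without short cycles is not obtained by deletion; its
  tiny probability is compared with the still smaller one of a good colouring.\<close>

lemma two_choose_two: "2 * (v choose 2) = v * (v - 1)"
proof -
  have "even (v * (v - 1))" by (cases v) auto
  then show ?thesis unfolding choose_two by simp
qed

text \<open>The identity behind the edge probability: a \<open>v\<close>-clique glued along an edge
  has \<open>v - 2\<close> new vertices and (v+1)/2 times as many new edges.\<close>

lemma choose_two_diff: "2 \<le> v \<Longrightarrow> 2 * ((v choose 2) - 1) = (v + 1) * (v - 2)"
proof -
  assume "2 \<le> v"
  then obtain u where u: "v = u + 2" by (metis le_add_diff_inverse2)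
  show ?thesis using two_choose_two [of v] unfolding u by (simp add: algebra_simps)
qed

lemma binomial_le_power: "(m choose j) \<le> m ^ j"
  by (cases "j \<le> m") (auto simp: binomial_le_pow binomial_eq_0)

lemma Union_nsets_2:
  assumes "card K \<ge> 2"
  shows "\<Union> (nsets K 2) = K"
proof
  show "\<Union> (nsets K 2) \<subseteq> K" unfolding nsets_def by blast
  show "K \<subseteq> \<Union> (nsets K 2)"
  proof
    fix x assume x: "x \<in> K"
    have fK: "finite K" using assms by (metis card.infinite not_numeral_le_zero)
    have "card (K - {x}) \<ge> 1" using assms x fK by simp
    then have "K - {x} \<noteq> {}" by (metis card.empty not_one_le_zero)
    then obtain y where "y \<in> K" "y \<noteq> x" by blast
    then have "{x, y} \<in> nsets K 2" using x by simp
    then show "x \<in> \<Union> (nsets K 2)" by blast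
  qed
qed

lemma sum_Pow_power_card:
  assumes "finite A"
  shows "(\<Sum>X\<in>Pow A. x ^ card X) = (1 + x :: real) ^ card A"
  using assms
proof (induction A rule: finite_induct)
  case (insert v A)
  have inj: "inj_on (insert v) (Pow A)"
    using insert(2) by (intro inj_onI) (metis Diff_insert_absorb PowD subsetD)
  have "(\<Sum>X\<in>Pow (insert v A). x ^ card X) =
      (\<Sum>X\<in>Pow A. x ^ card X) + (\<Sum>X\<in>insert v ` Pow A. x ^ card X)"
    unfolding Pow_insert using insert by (intro sum.union_disjoint) auto
  also have "(\<Sum>X\<in>insert v ` Pow A. x ^ card X) = (\<Sum>X\<in>Pow A. x * x ^ card X)"
    unfolding sum.reindex [OF inj] comp_def
  proof (rule sum.cong [OF refl])
    fix X assume "X \<in> Pow A"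
    then have "finite X" "v \<notin> X" using insert finite_subset by auto
    then show "x ^ card (insert v X) = x * x ^ card X" by simp
  qed
  finally show ?case using insert by (simp add: sum_distrib_left [symmetric] algebra_simps)
qed simp

lemma exp_le_one_minus:
  assumes "0 \<le> x" "x \<le> (1/2 :: real)"
  shows "exp (- 2 * x) \<le> 1 - x"
proof -
  have "1 + 2 * x \<le> exp (2 * x)" by (rule exp_ge_add_one_self)
  moreover have "1 \<le> (1 + 2 * x) * (1 - x)"
    using assms mult_nonneg_nonneg[of x "1 - 2 * x"] by (simp add: algebra_simps)
  moreover have "(1 + 2 * x) * (1 - x) \<le> exp (2 * x) * (1 - x)"
    using assms by (intro mult_right_mono exp_ge_add_one_self) auto
  ultimately have "1 \<le> exp (2 * x) * (1 - x)" by linarith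
  then show ?thesis by (simp add: exp_minus field_simps)
qed

section \<open>Random subsets\<close>

text \<open>The expectation of \<open>f\<close> at a random subset of \<open>V\<close> that contains
  each point independently with probability \<open>p\<close>. As a finite sum it can be handled by
  induction on \<open>V\<close> through \<open>bexp_insert\<close>.\<close>

definition bexp :: "real \<Rightarrow> 'a set \<Rightarrow> ('a set \<Rightarrow> real) \<Rightarrow> real" where
  "bexp p V f = (\<Sum>X\<in>Pow V. p ^ card X * (1 - p) ^ card (V - X) * f X)"

lemma bexp_empty [simp]: "bexp p {} f = f {}"
  by (simp add: bexp_def)

lemma bexp_insert:
  assumes "finite V" "v \<notin> V"
  shows "bexp p (insert v V) f = (1 - p) * bexp p V f + p * bexp p V (\<lambda>X. f (insert v X))"
proof -
  have inj_on_insert_Pow: "inj_on (insert v) (Pow V)"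
    using assms(2) by (intro inj_onI) (metis Diff_insert_absorb PowD subsetD)
  have "bexp p (insert v V) f =
      (\<Sum>X\<in>Pow V. p ^ card X * (1 - p) ^ card (insert v V - X) * f X) +
      (\<Sum>X\<in>insert v ` Pow V. p ^ card X * (1 - p) ^ card (insert v V - X) * f X)"
    unfolding bexp_def Pow_insert using assms by (intro sum.union_disjoint) auto
  also have "(\<Sum>X\<in>Pow V. p ^ card X * (1 - p) ^ card (insert v V - X) * f X) = (1 - p) * bexp p V f"
    unfolding bexp_def sum_distrib_left
  proof (rule sum.cong [OF refl])
    fix X assume "X \<in> Pow V"
    then have "v \<notin> X" "insert v V - X = insert v (V - X)" using assms by auto
    then show "p ^ card X * (1 - p) ^ card (insert v V - X) * f X =
        (1 - p) * (p ^ card X * (1 - p) ^ card (V - X) * f X)"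
      using assms by simp
  qed
  also have "(\<Sum>X\<in>insert v ` Pow V. p ^ card X * (1 - p) ^ card (insert v V - X) * f X) =
      (\<Sum>X\<in>Pow V. p ^ card (insert v X) * (1 - p) ^ card (insert v V - insert v X) * f (insert v X))"
    using inj_on_insert_Pow by (subst sum.reindex) auto
  also have "\<dots> = p * bexp p V (\<lambda>X. f (insert v X))"
    unfolding bexp_def sum_distrib_left
  proof (rule sum.cong [OF refl])
    fix X assume X: "X \<in> Pow V"
    then have "v \<notin> X" "insert v V - insert v X = V - X" "finite X"
      using assms finite_subset by auto
    then show "p ^ card (insert v X) * (1 - p) ^ card (insert v V - insert v X) * f (insert v X) =
        p * (p ^ card X * (1 - p) ^ card (V - X) * f (insert v X))"
      using assms by simp
  qed
  finally show ?thesis .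
qed

lemma bexp_cong:
  assumes "\<And>X. X \<subseteq> V \<Longrightarrow> f X = h X"
  shows "bexp p V f = bexp p V h"
  unfolding bexp_def using assms by (intro sum.cong) auto

lemma bexp_mono:
  assumes "0 \<le> p" "p \<le> 1" "\<And>X. X \<subseteq> V \<Longrightarrow> f X \<le> h X"
  shows "bexp p V f \<le> bexp p V h"
  unfolding bexp_def using assms by (intro sum_mono mult_left_mono) auto

lemma bexp_add: "bexp p V (\<lambda>X. f X + h X) = bexp p V f + bexp p V h"
  by (simp add: bexp_def sum.distrib distrib_left)

lemma bexp_diff: "bexp p V (\<lambda>X. f X - h X) = bexp p V f - bexp p V h"
  by (simp add: bexp_def sum_subtractf right_diff_distrib)

lemma bexp_cmult: "bexp p V (\<lambda>X. c * f X) = c * bexp p V f"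
  by (simp add: bexp_def sum_distrib_left mult.left_commute)

lemma bexp_sum: "bexp p V (\<lambda>X. \<Sum>i\<in>A. f i X) = (\<Sum>i\<in>A. bexp p V (f i))"
  unfolding bexp_def sum_distrib_left by (rule sum.swap)

lemma bexp_const: "finite V \<Longrightarrow> bexp p V (\<lambda>X. c) = c"
  by (induction V rule: finite_induct) (auto simp: bexp_insert algebra_simps)

lemma bexp_nonneg: "0 \<le> p \<Longrightarrow> p \<le> 1 \<Longrightarrow> (\<And>X. X \<subseteq> V \<Longrightarrow> 0 \<le> f X) \<Longrightarrow> 0 \<le> bexp p V f"
  unfolding bexp_def by (intro sum_nonneg mult_nonneg_nonneg) auto

lemma bexp_point:
  assumes "0 \<le> p" "p \<le> 1" "finite V" "X \<subseteq> V" "\<And>X. X \<subseteq> V \<Longrightarrow> 0 \<le> f X"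
  shows "p ^ card X * (1 - p) ^ card (V - X) * f X \<le> bexp p V f"
  unfolding bexp_def using assms by (intro member_le_sum) auto

text \<open>Once \<open>T\<close> is included, the points outside \<open>T\<close> are still
  independent. Since \<open>f (T \<union> X)\<close> ignores what \<open>X\<close> does on
  \<open>T\<close>, the expectation on the right may again run over all of \<open>V\<close>.\<close>

lemma bexp_inside:
  assumes "finite V" "T \<subseteq> V"
  shows "bexp p V (\<lambda>X. of_bool (T \<subseteq> X) * f X) = p ^ card T * bexp p V (\<lambda>X. f (T \<union> X))"
proof -
  have "finite T" using assms finite_subset by auto
  then show ?thesis using assms(2)
  proof (induction T arbitrary: f rule: finite_induct)
    case (insert v T)
    define V' where "V' = V - {v}"
    have V: "V = insert v V'" "finite V'" "v \<notin> V'" using insert assms V'_def by auto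
    have "bexp p V (\<lambda>X. of_bool (insert v T \<subseteq> X) * f X)
       = bexp p V (\<lambda>X. of_bool (T \<subseteq> X) * (of_bool (v \<in> X) * f X))"
      by (intro bexp_cong) (auto simp: of_bool_def)
    also have "\<dots> = p ^ card T * bexp p V (\<lambda>X. of_bool (v \<in> T \<union> X) * f (T \<union> X))"
      using insert by simp
    also have "bexp p V (\<lambda>X. of_bool (v \<in> T \<union> X) * f (T \<union> X)) =
        p * bexp p V' (\<lambda>X. f (insert v (T \<union> X)))"
    proof -
      have "bexp p V' (\<lambda>X. of_bool (v \<in> T \<union> X) * f (T \<union> X)) = bexp p V' (\<lambda>X. 0)"
        using V insert by (intro bexp_cong) auto
      then show ?thesis unfolding V(1) bexp_insert [OF V(2,3)] using V(2) by (simp add: bexp_const)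
    qed
    also have "bexp p V' (\<lambda>X. f (insert v (T \<union> X))) = bexp p V (\<lambda>X. f (insert v T \<union> X))"
      unfolding V(1) bexp_insert [OF V(2,3)] by (simp add: algebra_simps)
    finally show ?case using insert by simp
  qed simp
qed

lemma bexp_outside:
  assumes "finite V" "T \<subseteq> V"
  shows "bexp p V (\<lambda>X. of_bool (X \<inter> T = {})) = (1 - p) ^ card T"
proof -
  have "finite T" using assms finite_subset by auto
  then show ?thesis using assms
  proof (induction T arbitrary: V rule: finite_induct)
    case empty then show ?case by (simp add: bexp_const)
  next
    case (insert v T)
    define V' where "V' = V - {v}"
    have V: "V = insert v V'" "finite V'" "v \<notin> V'" "T \<subseteq> V'" using insert V'_def by auto
    have "bexp p V' (\<lambda>X. of_bool (X \<inter> insert v T = {})) = bexp p V' (\<lambda>X. of_bool (X \<inter> T = {}))"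
      using V by (intro bexp_cong) auto
    then show ?case
      unfolding V(1) bexp_insert [OF V(2,3)] using insert.IH [OF V(2,4)] insert(1,2) V(2)
      by (simp add: bexp_const)
  qed
qed

lemma bexp_inside_outside:
  assumes "finite V" "T \<subseteq> V" "O' \<subseteq> V" "T \<inter> O' = {}"
  shows "bexp p V (\<lambda>X. of_bool (T \<subseteq> X \<and> X \<inter> O' = {})) = p ^ card T * (1 - p) ^ card O'"
proof -
  have "bexp p V (\<lambda>X. of_bool (T \<subseteq> X \<and> X \<inter> O' = {}))
      = bexp p V (\<lambda>X. of_bool (T \<subseteq> X) * of_bool (X \<inter> O' = {}))"
    by (intro bexp_cong) auto
  also have "\<dots> = p ^ card T * bexp p V (\<lambda>X. of_bool (X \<inter> O' = {}))"
    unfolding bexp_inside [OF assms(1,2)] using assms(4)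
    by (intro arg_cong [of _ _ "\<lambda>x. p ^ card T * x"] bexp_cong) (auto simp: of_bool_def)
  finally show ?thesis using bexp_outside [OF assms(1,3)] by simp
qed

text \<open>Induction on the ground set. Conditioning on the last point leaves two averages for each
  function, both decreasing when the point is added, and the covariance of these is
  \<open>p * (1 - p) * ((a - b) * (c - d))\<close>, which is nonnegative.\<close>

lemma harris:
  assumes "finite V" "0 \<le> p" "p \<le> 1"
    and "\<And>X Y. X \<subseteq> Y \<Longrightarrow> Y \<subseteq> V \<Longrightarrow> f Y \<le> f X"
    and "\<And>X Y. X \<subseteq> Y \<Longrightarrow> Y \<subseteq> V \<Longrightarrow> h Y \<le> h X"
  shows "bexp p V f * bexp p V h \<le> bexp p V (\<lambda>X. f X * h X)"
  using assms(1,4,5)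
proof (induction V arbitrary: f h rule: finite_induct)
  case (insert v V)
  let ?f1 = "\<lambda>X. f (insert v X)" and ?h1 = "\<lambda>X. h (insert v X)"
  note bi = bexp_insert [OF insert(1,2)]
  have IH0: "bexp p V f * bexp p V h \<le> bexp p V (\<lambda>X. f X * h X)"
    by (rule insert.IH; rule insert.prems; blast)
  have IH1: "bexp p V ?f1 * bexp p V ?h1 \<le> bexp p V (\<lambda>X. ?f1 X * ?h1 X)"
    by (rule insert.IH; rule insert.prems; blast)
  have f: "bexp p V ?f1 \<le> bexp p V f"
    by (rule bexp_mono [OF assms(2,3)]) (rule insert.prems(1); blast)
  have h: "bexp p V ?h1 \<le> bexp p V h"
    by (rule bexp_mono [OF assms(2,3)]) (rule insert.prems(2); blast)
  define a b c d where abcd: "a = bexp p V f" "b = bexp p V ?f1" "c = bexp p V h" "d = bexp p V ?h1"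
  have "((1 - p) * a + p * b) * ((1 - p) * c + p * d) =
     (1 - p) * (a * c) + p * (b * d) - p * (1 - p) * ((a - b) * (c - d))"
    by (simp add: algebra_simps power2_eq_square)
  also have "\<dots> \<le> (1 - p) * (a * c) + p * (b * d)"
    using f h assms(2,3) abcd by simp
  also have "\<dots> \<le> (1 - p) * bexp p V (\<lambda>X. f X * h X) + p * bexp p V (\<lambda>X. ?f1 X * ?h1 X)"
    using IH0 IH1 assms(2,3) abcd by (intro add_mono mult_left_mono) auto
  finally show ?case by (simp add: bi abcd)
qed simp

text \<open>Avoiding a set \<open>F\<close> is a decreasing event of probability
  \<open>1 - p ^ card F\<close>; \<open>harris\<close> multiplies these one by one.\<close>

lemma harris_avoid:
  assumes "finite V" "0 \<le> p" "p \<le> 1" "finite \<B>" "\<And>F. F \<in> \<B> \<Longrightarrow> F \<subseteq> V"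
  shows "(\<Prod>F\<in>\<B>. 1 - p ^ card F) \<le> bexp p V (\<lambda>X. of_bool (\<forall>F\<in>\<B>. \<not> F \<subseteq> X))"
  using assms(4,5)
proof (induction \<B> rule: finite_induct)
  case empty then show ?case using assms by (simp add: bexp_const)
next
  case (insert F \<B>)
  let ?f = "\<lambda>X. of_bool (\<not> F \<subseteq> X) :: real" and ?h = "\<lambda>X. of_bool (\<forall>F\<in>\<B>. \<not> F \<subseteq> X) :: real"
  have "bexp p V ?f = bexp p V (\<lambda>X. 1 - of_bool (F \<subseteq> X) * 1)"
    by (intro bexp_cong) auto
  also have "\<dots> = 1 - p ^ card F"
    using insert.prems assms(1) by (subst bexp_diff, subst bexp_inside) (auto simp: bexp_const)
  finally have f: "bexp p V ?f = 1 - p ^ card F" .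
  have "(\<Prod>F\<in>insert F \<B>. 1 - p ^ card F) = bexp p V ?f * (\<Prod>F\<in>\<B>. 1 - p ^ card F)"
    using insert f by simp
  also have "\<dots> \<le> bexp p V ?f * bexp p V ?h"
    using insert assms by (intro mult_left_mono bexp_nonneg) auto
  also have "\<dots> \<le> bexp p V (\<lambda>X. ?f X * ?h X)"
  proof (rule harris [OF assms(1-3)])
    fix X Y assume "X \<subseteq> Y" "Y \<subseteq> V"
    then show "?f Y \<le> ?f X" "?h Y \<le> ?h X" by (simp_all add: of_bool_def) blast+
  qed
  also have "\<dots> = bexp p V (\<lambda>X. of_bool (\<forall>F\<in>insert F \<B>. \<not> F \<subseteq> X))"
    by (intro bexp_cong) auto
  finally show ?case .
qed

section \<open>Hypergraph containers\<close>

definition downset :: "'a set \<Rightarrow> 'a set set \<Rightarrow> bool" where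
  "downset V D \<longleftrightarrow> D \<subseteq> Pow V \<and> (\<forall>X\<in>D. \<forall>Y\<subseteq>X. Y \<in> D)"

text \<open>Members may meet \<open>T\<close>, unlike in a link. In this form
  \<open>p ^ card T\<close> times the weight is the probability that a random set contains
  \<open>T\<close> and lies in \<open>D\<close>; see \<open>bexp_inside_downset\<close>.\<close>

definition extendable :: "'a set set \<Rightarrow> 'a set \<Rightarrow> 'a set set" where
  "extendable D T = {X \<in> D. T \<union> X \<in> D}"

definition weight :: "real \<Rightarrow> 'a set \<Rightarrow> 'a set set \<Rightarrow> real" where
  "weight p V D = bexp p V (\<lambda>X. of_bool (X \<in> D))"

text \<open>The permitted loss grows with \<open>card T\<close> because a set \<open>T\<close> that
  fails the test adds \<open>card T\<close> points to the fingerprint: each of them is paid for by a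
  factor \<open>1 - \<eta>\<close> in the weight.\<close>

definition stable :: "real \<Rightarrow> real \<Rightarrow> nat \<Rightarrow> 'a set \<Rightarrow> 'a set set \<Rightarrow> bool" where
  "stable \<eta> p l V D \<longleftrightarrow> (\<forall>T\<in>D. T \<noteq> {} \<and> card T \<le> l \<longrightarrow>
     (1 - \<eta>) ^ card T * weight p V D \<le> weight p V (extendable D T))"

lemma downset_extendable: "downset V D \<Longrightarrow> downset V (extendable D T)"
proof -
  assume D: "downset V D"
  have "Y \<in> extendable D T" if X: "X \<in> extendable D T" and Y: "Y \<subseteq> X" for X Y
  proof -
    have "T \<union> Y \<subseteq> T \<union> X" using Y by blast
    then show ?thesis using D X Y unfolding downset_def extendable_def by blast
  qed
  then show ?thesis using D unfolding downset_def extendable_def by blast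
qed

lemma weight_mono: "0 \<le> p \<Longrightarrow> p \<le> 1 \<Longrightarrow> D \<subseteq> D' \<Longrightarrow> weight p V D \<le> weight p V D'"
  unfolding weight_def by (intro bexp_mono) auto

lemma weight_nonneg: "0 \<le> p \<Longrightarrow> p \<le> 1 \<Longrightarrow> 0 \<le> weight p V D"
  unfolding weight_def by (intro bexp_nonneg) auto

lemma weight_ge_empty:
  assumes "finite V" "0 \<le> p" "p \<le> 1" "{} \<in> D"
  shows "(1 - p) ^ card V \<le> weight p V D"
  using bexp_point [OF assms(2,3,1), of "{}" "\<lambda>X. of_bool (X \<in> D)"] assms(4)
  by (simp add: weight_def)

lemma weight_le_one: "finite V \<Longrightarrow> 0 \<le> p \<Longrightarrow> p \<le> 1 \<Longrightarrow> weight p V D \<le> 1"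
  using bexp_mono [of p V "\<lambda>X. of_bool (X \<in> D)" "\<lambda>X. 1"] by (simp add: weight_def bexp_const)

lemma bexp_inside_downset:
  assumes "finite V" "downset V D" "T \<subseteq> V"
  shows "bexp p V (\<lambda>X. of_bool (T \<subseteq> X) * of_bool (X \<in> D)) = p ^ card T * weight p V (extendable D T)"
  unfolding bexp_inside [OF assms(1,3)] weight_def
  using assms(2) unfolding downset_def extendable_def
  by (intro arg_cong [of _ _ "\<lambda>x. p ^ card T * x"] bexp_cong) (auto simp: of_bool_def)

text \<open>A decision tree of questions \<open>T \<subseteq> I\<close>: yes leads to
  \<open>D1\<close>, no to \<open>D0\<close>, both strictly smaller than \<open>D\<close>. The
  fingerprint \<open>g I\<close> is the union of all \<open>T\<close> answered with yes, and
  \<open>f I\<close> is the final state. A set between \<open>g I\<close> and \<open>I\<close> gets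
  the same answers, the yes ones because it contains \<open>g I\<close> and the no ones because it
  lies in \<open>I\<close>. In particular \<open>f (g I) = f I\<close>, so the container can be read
  off the fingerprint.\<close>

lemma container_algorithm:
  assumes "finite V" "0 \<le> p" "p \<le> 1" "0 \<le> \<eta>" "\<eta> \<le> 1" "downset V D"
  shows "\<exists>f g. \<forall>I\<in>D. g I \<subseteq> I \<and> I \<in> f I \<and> downset V (f I) \<and> f I \<subseteq> D \<and> stable \<eta> p l V (f I) \<and>
    weight p V (f I) \<le> (1 - \<eta>) ^ card (g I) * weight p V D \<and>
    (\<forall>A. g I \<subseteq> A \<and> A \<subseteq> I \<longrightarrow> f A = f I)"
proof -
  have "finite D" using assms(1,6) unfolding downset_def by (meson finite_Pow_iff finite_subset)
  then show ?thesis using assms(6)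
  proof (induction D rule: finite_psubset_induct)
    case (psubset D)
    show ?case
    proof (cases "stable \<eta> p l V D")
      case True
      then show ?thesis using psubset.prems
        by (intro exI [of _ "\<lambda>_. D"] exI [of _ "\<lambda>_. {}"]) auto
    next
      case False
      then obtain T where T: "T \<in> D" "T \<noteq> {}"
        "weight p V (extendable D T) < (1 - \<eta>) ^ card T * weight p V D"
        unfolding stable_def by (auto simp: not_le)
      define D1 where "D1 = extendable D T"
      define D0 where "D0 = {X \<in> D. \<not> T \<subseteq> X}"
      have "weight p V D1 < 1 * weight p V D"
        using T(3) mult_right_mono [OF power_le_one [of "1 - \<eta>" "card T"] weight_nonneg [of p V D]] assms
        unfolding D1_def by linarith
      then have "D1 \<noteq> D" by auto
      moreover have "D1 \<subseteq> D" unfolding D1_def extendable_def by blast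
      ultimately have D1: "D1 \<subset> D" "downset V D1"
        using downset_extendable [OF psubset.prems] unfolding D1_def by blast+
      have "D0 \<subseteq> D" "T \<notin> D0" unfolding D0_def by blast+
      then have D0: "D0 \<subset> D" using T by blast
      have D0': "downset V D0"
        using psubset.prems unfolding D0_def downset_def by blast
      obtain f1 g1 where 1: "\<forall>I\<in>D1. g1 I \<subseteq> I \<and> I \<in> f1 I \<and> downset V (f1 I) \<and> f1 I \<subseteq> D1 \<and>
          stable \<eta> p l V (f1 I) \<and> weight p V (f1 I) \<le> (1 - \<eta>) ^ card (g1 I) * weight p V D1 \<and>
          (\<forall>A. g1 I \<subseteq> A \<and> A \<subseteq> I \<longrightarrow> f1 A = f1 I)"
        using psubset.IH [OF D1] by (elim exE)
      obtain f0 g0 where 0: "\<forall>I\<in>D0. g0 I \<subseteq> I \<and> I \<in> f0 I \<and> downset V (f0 I) \<and> f0 I \<subseteq> D0 \<and>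
          stable \<eta> p l V (f0 I) \<and> weight p V (f0 I) \<le> (1 - \<eta>) ^ card (g0 I) * weight p V D0 \<and>
          (\<forall>A. g0 I \<subseteq> A \<and> A \<subseteq> I \<longrightarrow> f0 A = f0 I)"
        using psubset.IH [OF D0 D0'] by (elim exE)
      define f where "f = (\<lambda>A. if T \<subseteq> A then f1 A else f0 A)"
      define g where "g = (\<lambda>A. if T \<subseteq> A then T \<union> g1 A else g0 A)"
      have fg: "g I \<subseteq> I \<and> I \<in> f I \<and> downset V (f I) \<and> f I \<subseteq> D \<and> stable \<eta> p l V (f I) \<and>
          weight p V (f I) \<le> (1 - \<eta>) ^ card (g I) * weight p V D \<and>
          (\<forall>A. g I \<subseteq> A \<and> A \<subseteq> I \<longrightarrow> f A = f I)" if I: "I \<in> D" for I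
      proof (cases "T \<subseteq> I")
        case True
        have I1: "I \<in> D1" using I True unfolding D1_def extendable_def by (simp add: Un_absorb1)
        have P: "g1 I \<subseteq> I" "I \<in> f1 I" "downset V (f1 I)" "stable \<eta> p l V (f1 I)"
            "\<forall>A. g1 I \<subseteq> A \<and> A \<subseteq> I \<longrightarrow> f1 A = f1 I" "f1 I \<subseteq> D1"
          using bspec [OF 1 I1] by - (elim conjE, assumption)+
        have "weight p V (f1 I) \<le> (1 - \<eta>) ^ card (g1 I) * weight p V D1" using bspec [OF 1 I1] by (elim conjE)
        also have "\<dots> \<le> (1 - \<eta>) ^ card (g1 I) * ((1 - \<eta>) ^ card T * weight p V D)"
          using T(3) assms unfolding D1_def by (intro mult_left_mono) auto
        also have "\<dots> = (1 - \<eta>) ^ (card T + card (g1 I)) * weight p V D" by (simp add: power_add)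
        also have "\<dots> \<le> (1 - \<eta>) ^ card (T \<union> g1 I) * weight p V D"
          using assms weight_nonneg by (intro mult_right_mono power_decreasing card_Un_le) auto
        finally have w: "weight p V (f1 I) \<le> (1 - \<eta>) ^ card (T \<union> g1 I) * weight p V D" .
        have fg: "f I = f1 I" "g I = T \<union> g1 I" using True unfolding f_def g_def by auto
        have fA: "f A = f1 I" if A: "T \<union> g1 I \<subseteq> A" "A \<subseteq> I" for A
        proof -
          have "T \<subseteq> A" using A(1) by blast
          then have "f A = f1 A" unfolding f_def by simp
          also have "\<dots> = f1 I" using P(5) A by (meson le_supE)
          finally show ?thesis .
        qed
        have gI: "T \<union> g1 I \<subseteq> I" using P(1) True by blast
        have fD: "f1 I \<subseteq> D" using P(6) D1(1) by blast
        show ?thesis unfolding fg using gI P(2-4) fD w fA by (intro conjI allI impI) (assumption | elim conjE)+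
      next
        case False
        have I0: "I \<in> D0" using I False unfolding D0_def by simp
        have P: "g0 I \<subseteq> I" "I \<in> f0 I" "downset V (f0 I)" "stable \<eta> p l V (f0 I)"
            "\<forall>A. g0 I \<subseteq> A \<and> A \<subseteq> I \<longrightarrow> f0 A = f0 I" "f0 I \<subseteq> D0"
          using bspec [OF 0 I0] by - (elim conjE, assumption)+
        have "weight p V (f0 I) \<le> (1 - \<eta>) ^ card (g0 I) * weight p V D0" using bspec [OF 0 I0] by (elim conjE)
        also have "\<dots> \<le> (1 - \<eta>) ^ card (g0 I) * weight p V D"
          using assms D0 by (intro mult_left_mono weight_mono) auto
        finally have w: "weight p V (f0 I) \<le> (1 - \<eta>) ^ card (g0 I) * weight p V D" .
        have fg: "f I = f0 I" "g I = g0 I" using False unfolding f_def g_def by auto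
        have fA: "f A = f0 I" if A: "g0 I \<subseteq> A" "A \<subseteq> I" for A
        proof -
          have "\<not> T \<subseteq> A" using A(2) False by blast
          then have "f A = f0 A" unfolding f_def by simp
          also have "\<dots> = f0 I" using P(5) A by (meson le_supE)
          finally show ?thesis .
        qed
        have gI: "g0 I \<subseteq> I" by (rule P(1))
        have fD: "f0 I \<subseteq> D" using P(6) D0 by blast
        show ?thesis unfolding fg using gI P(2-4) fD w fA by (intro conjI allI impI) (assumption | elim conjE)+
      qed
      show ?thesis by (rule exI [of _ f], rule exI [of _ g], rule ballI, rule fg)
    qed
  qed
qed

section \<open>Few minimal non-faces in a stable state\<close>

definition minimal_nonmembers :: "'a set \<Rightarrow> 'a set set \<Rightarrow> nat \<Rightarrow> 'a set set" where
  "minimal_nonmembers V D j = {F. F \<subseteq> V \<and> F \<notin> D \<and> (\<forall>Y. Y \<subset> F \<longrightarrow> Y \<in> D) \<and> card F = j}"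

text \<open>If too many minimal non-members contain \<open>T\<close>, then the number of them that a random member of \<open>D\<close>
  completes together with \<open>T\<close> is concentrated enough to be positive more often than stability allows.
  By induction from larger to smaller \<open>T\<close> the second moment involves no large degrees.\<close>

lemma stable_degree:
  assumes V: "finite V" and p: "0 < p" "p < 1" and D: "downset V D" "{} \<in> D"
    and st: "stable (1 / (8 * real l)) p l V D" and j: "j \<le> l"
    and T: "T \<noteq> {}" "card T \<le> j" "T \<subseteq> V"
  shows "real (card {F \<in> minimal_nonmembers V D j. T \<subseteq> F}) \<le> (4 * real l / p) ^ (j - card T)"
  using T
proof (induction "j - card T" arbitrary: T rule: less_induct)
  case less
  define lam where "lam = 4 * real l / p"
  define \<F> where "\<F> = (\<lambda>T. {F \<in> minimal_nonmembers V D j. T \<subseteq> F})"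
  have finF: "finite (\<F> T)" for T
    unfolding \<F>_def minimal_nonmembers_def using V by (auto intro: finite_subset [of _ "Pow V"])
  have FT: "F \<subseteq> V" "F \<notin> D" "\<And>Y. Y \<subset> F \<Longrightarrow> Y \<in> D" "card F = j" "T \<subseteq> F" "finite F" if "F \<in> \<F> T" for F T
    using that V finite_subset unfolding \<F>_def minimal_nonmembers_def by auto
  have fT: "finite T" using less.prems V finite_subset by auto
  have cT: "card T \<ge> 1" using fT less.prems by (simp add: Suc_leI card_gt_0_iff)
  have l: "real l \<ge> 1" using j less.prems cT by linarith
  have lam: "lam \<ge> 1" using l p unfolding lam_def by (simp add: field_simps)
  show ?case
  proof (cases "T \<in> D \<and> card T < j")
    \<comment> \<open>If \<open>T \<notin> D\<close> or \<open>card T = j\<close>, a minimal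
      non-member of size \<open>j\<close> containing \<open>T\<close> can only be \<open>T\<close>
      itself.\<close>
    case False
    have "\<F> T \<subseteq> {T}"
    proof
      fix F assume F: "F \<in> \<F> T"
      show "F \<in> {T}" using False FT [OF F] card_seteq [of F T] by (cases "T = F") auto
    qed
    then have "card (\<F> T) \<le> card {T}" by (intro card_mono) auto
    then have "real (card (\<F> T)) \<le> 1" by simp
    also have "\<dots> \<le> lam ^ (j - card T)" using lam by simp
    finally show ?thesis unfolding \<F>_def lam_def .
  next
    case True
    define s where "s = j - card T"
    define m where "m = real (card (\<F> T))"
    define W where "W = weight p V D"
    have W: "W > 0"
    proof -
      have "0 < (1 - p) ^ card V" using p by simp
      also have "\<dots> \<le> W" unfolding W_def using weight_ge_empty V p D by (metis less_imp_le)
      finally show ?thesis .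
    qed
    have sl: "real s \<le> real l" "real (card T) \<le> real l" using j True unfolding s_def by auto
    have ext_ge: "weight p V (extendable D L) \<ge> (1 - real (card L) / (8 * real l)) * W"
      if L: "L \<in> D" "card L \<le> l" for L
    proof (cases "L = {}")
      case True then show ?thesis by (simp add: extendable_def W_def)
    next
      case False
      have "1 + real (card L) * (- 1 / (8 * real l)) \<le> (1 + - 1 / (8 * real l)) ^ card L"
        using l by (intro Bernoulli_inequality) (simp add: field_simps)
      then have "(1 - real (card L) / (8 * real l)) * W \<le> (1 - 1 / (8 * real l)) ^ card L * W"
        using W by (intro mult_right_mono) auto
      also have "\<dots> \<le> weight p V (extendable D L)"
        using st False L unfolding stable_def W_def by auto
      finally show ?thesis .
    qed
    \<comment> \<open>\<open>Z X\<close> counts the \<open>F\<close> that \<open>X\<close> completes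
      together with \<open>T\<close>. A member \<open>X\<close> of \<open>D\<close> with
      \<open>Z X > 0\<close> is thrown out of \<open>D\<close> by \<open>T\<close>, so it lies in
      \<open>B\<close>. Within \<open>D\<close>, then, \<open>Z\<close> lives on a set of weight at
      most \<open>W / 8\<close>, although its mean is at least \<open>7 / 8 * m * p ^ s * W\<close>;
      the second moment will exclude this.\<close>
    define Z where "Z = (\<lambda>X. \<Sum>F\<in>\<F> T. of_bool (F - T \<subseteq> X) :: real)"
    define B where "B = D - extendable D T"
    have link: "F - T \<in> D" "card (F - T) = s" "F - T \<subseteq> V" if "F \<in> \<F> T" for F
    proof -
      note F = FT [OF that]
      have "F - T \<subset> F" using less.prems(1) F(5) by blast
      then show "F - T \<in> D" by (rule F(3))
      show "card (F - T) = s" using F fT unfolding s_def by (simp add: card_Diff_subset)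
      show "F - T \<subseteq> V" using F by auto
    qed
    have u: "bexp p V (\<lambda>X. of_bool (X \<in> B)) \<le> W / 8"
    proof -
      have "bexp p V (\<lambda>X. of_bool (X \<in> B)) = bexp p V (\<lambda>X. of_bool (X \<in> D) - of_bool (X \<in> extendable D T))"
        unfolding B_def extendable_def by (intro bexp_cong) (auto simp: of_bool_def)
      also have "\<dots> = W - weight p V (extendable D T)"
        unfolding bexp_diff W_def weight_def ..
      also have "\<dots> \<le> W - (1 - real (card T) / (8 * real l)) * W"
        using ext_ge [of T] True j by simp
      also have "\<dots> = (real (card T) / real l) * (W / 8)" by (simp add: field_simps)
      also have "\<dots> \<le> 1 * (W / 8)" using sl l W by (intro mult_right_mono) (auto simp: field_simps)
      finally show ?thesis by simp
    qed
    have c: "bexp p V (\<lambda>X. of_bool (X \<in> D) * Z X) \<ge> m * p ^ s * (7 / 8 * W)"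
    proof -
      have "bexp p V (\<lambda>X. of_bool (X \<in> D) * Z X) =
          (\<Sum>F\<in>\<F> T. bexp p V (\<lambda>X. of_bool (F - T \<subseteq> X) * of_bool (X \<in> D)))"
        unfolding bexp_sum [symmetric] Z_def sum_distrib_left by (simp add: mult.commute)
      also have "\<dots> = (\<Sum>F\<in>\<F> T. p ^ s * weight p V (extendable D (F - T)))"
        using link by (intro sum.cong refl) (simp add: bexp_inside_downset [OF V D(1)])
      also have "\<dots> \<ge> (\<Sum>F\<in>\<F> T. p ^ s * (7 / 8 * W))"
      proof (intro sum_mono mult_left_mono)
        fix F assume F: "F \<in> \<F> T"
        have "7 / 8 * W \<le> (1 - real s / (8 * real l)) * W"
          using sl l W by (intro mult_right_mono) (auto simp: field_simps)
        also have "\<dots> \<le> weight p V (extendable D (F - T))"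
          using ext_ge [of "F - T"] link [OF F] sl by simp
        finally show "7 / 8 * W \<le> weight p V (extendable D (F - T))" .
      qed (use p in auto)
      finally show ?thesis by (simp add: m_def)
    qed
    show ?thesis
    proof (rule ccontr)
      assume "\<not> ?thesis"
      then have m: "m > lam ^ s" unfolding \<F>_def lam_def s_def m_def by simp
      moreover have "lam ^ s \<ge> 1" using lam by simp
      ultimately have m1: "m > 1" by linarith
      \<comment> \<open>The pairs are sorted by the overlap \<open>U\<close> of the two remainders.
        By induction the degree of \<open>T \<union> U\<close> is at most
        \<open>lam ^ (s - card U)\<close>, hence at most \<open>m / lam ^ card U\<close>. As
        \<open>lam * p = 4 * l\<close>, summing over \<open>U\<close> gives
        \<open>m * (1 + 1 / (4 * l)) ^ s\<close>, which is at most \<open>3 * m\<close>; the factor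
        \<open>4 * l\<close> in the degree bound serves to keep this sum bounded.\<close>
      have inner: "(\<Sum>F'\<in>\<F> T. p ^ card ((F - T) \<union> (F' - T))) \<le> p ^ (2 * s) * (3 * m)" if F: "F \<in> \<F> T" for F
      proof -
        define L where "L = F - T"
        have L: "finite L" "card L = s" using link [OF F] FT(6) [OF F] unfolding L_def by auto
        have "(\<Sum>F'\<in>\<F> T. p ^ card (L \<union> (F' - T))) \<le>
            (\<Sum>F'\<in>\<F> T. p ^ (2 * s) * (\<Sum>U\<in>Pow L. of_bool (T \<union> U \<subseteq> F') * (1 / p) ^ card U))"
        proof (rule sum_mono)
          fix F' assume F': "F' \<in> \<F> T"
          define L' where "L' = F' - T"
          have L': "finite L'" "card L' = s" using link [OF F'] FT(6) [OF F'] unfolding L'_def by auto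
          have card: "card (L \<union> L') + card (L \<inter> L') = 2 * s"
            using card_Un_Int [OF L(1) L'(1)] L L' by simp
          have "p ^ card (L \<union> L') = p ^ (card (L \<union> L') + card (L \<inter> L')) * (1 / p) ^ card (L \<inter> L')"
            using p by (simp add: power_add power_one_over)
          also have "\<dots> = p ^ (2 * s) * (1 / p) ^ card (L \<inter> L')" unfolding card ..
          also have "(1 / p) ^ card (L \<inter> L') \<le> (\<Sum>U\<in>Pow L. of_bool (T \<union> U \<subseteq> F') * (1 / p) ^ card U)"
          proof -
            have "T \<union> (L \<inter> L') \<subseteq> F'" using FT(5) [OF F'] unfolding L'_def by auto
            then have "(1 / p) ^ card (L \<inter> L') = of_bool (T \<union> (L \<inter> L') \<subseteq> F') * (1 / p) ^ card (L \<inter> L')"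
              by simp
            also have "\<dots> \<le> (\<Sum>U\<in>Pow L. of_bool (T \<union> U \<subseteq> F') * (1 / p) ^ card U)"
              using L p by (intro member_le_sum [of "L \<inter> L'" "Pow L" "\<lambda>U. of_bool (T \<union> U \<subseteq> F') * (1 / p) ^ card U"]) auto
            finally show ?thesis .
          qed
          finally show "p ^ card (L \<union> (F' - T)) \<le>
              p ^ (2 * s) * (\<Sum>U\<in>Pow L. of_bool (T \<union> U \<subseteq> F') * (1 / p) ^ card U)"
            using p unfolding L'_def by (simp add: mult_left_mono)
        qed
        also have "\<dots> = p ^ (2 * s) * (\<Sum>U\<in>Pow L. \<Sum>F'\<in>\<F> T. of_bool (T \<union> U \<subseteq> F') * (1 / p) ^ card U)"
          unfolding sum_distrib_left [symmetric] by (subst sum.swap) simp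
        also have "\<dots> = p ^ (2 * s) * (\<Sum>U\<in>Pow L. real (card (\<F> (T \<union> U))) * (1 / p) ^ card U)"
        proof -
          have "(\<Sum>F'\<in>\<F> T. of_bool (T \<union> U \<subseteq> F') * (1 / p) ^ card U) =
              real (card (\<F> (T \<union> U))) * (1 / p) ^ card U" for U
          proof -
            have "\<F> T \<inter> {F'. T \<union> U \<subseteq> F'} = \<F> (T \<union> U)" unfolding \<F>_def by auto
            then show ?thesis
              using finF unfolding sum_distrib_right [symmetric] by simp
          qed
          then show ?thesis by simp
        qed
        also have "\<dots> \<le> p ^ (2 * s) * (\<Sum>U\<in>Pow L. m * (1 / (4 * real l)) ^ card U)"
        proof (intro mult_left_mono sum_mono)
          fix U assume U: "U \<in> Pow L"
          show "real (card (\<F> (T \<union> U))) * (1 / p) ^ card U \<le> m * (1 / (4 * real l)) ^ card U"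
          proof (cases "U = {}")
            case True then show ?thesis unfolding m_def by simp
          next
            case False
            have fU: "finite U" "U \<inter> T = {}" using U L finite_subset unfolding L_def by auto
            have cU: "card (T \<union> U) = card T + card U" using fU fT by (simp add: card_Un_disjoint Int_commute)
            have Us: "card U \<le> s" using U L by (metis PowD card_mono)
            have "real (card (\<F> (T \<union> U))) \<le> lam ^ (j - card (T \<union> U))"
              unfolding \<F>_def lam_def
            proof (rule less.hyps)
              have "card U > 0" using fU False by (simp add: card_gt_0_iff)
              then show "j - card (T \<union> U) < j - card T" using cU True by linarith
              show "T \<union> U \<noteq> {}" using less.prems by auto
              show "card (T \<union> U) \<le> j" using cU Us True unfolding s_def by linarith
              show "T \<union> U \<subseteq> V" using less.prems U FT(1) [OF F] unfolding L_def by auto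
            qed
            also have "j - card (T \<union> U) = s - card U" using cU unfolding s_def by simp
            also have "lam ^ (s - card U) = lam ^ s * (1 / lam) ^ card U"
              using lam Us by (simp add: power_diff power_one_over)
            also have "\<dots> \<le> m * (1 / lam) ^ card U"
              using m lam by (intro mult_right_mono) auto
            finally have "real (card (\<F> (T \<union> U))) * (1 / p) ^ card U \<le> m * (1 / lam) ^ card U * (1 / p) ^ card U"
              using p by (intro mult_right_mono) auto
            also have "\<dots> = m * (1 / (4 * real l)) ^ card U"
              using p unfolding lam_def mult.assoc power_mult_distrib [symmetric] by simp
            finally show ?thesis .
          qed
        qed (use p in auto)
        also have "(\<Sum>U\<in>Pow L. m * (1 / (4 * real l)) ^ card U) = m * (1 + 1 / (4 * real l)) ^ s"
          unfolding sum_distrib_left [symmetric] using sum_Pow_power_card [OF L(1)] L(2) by simp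
        also have "(1 + 1 / (4 * real l)) ^ s \<le> 3"
        proof -
          have "(1 + 1 / (4 * real l)) ^ s \<le> exp (1 / (4 * real l)) ^ s"
            using l by (intro power_mono exp_ge_add_one_self) auto
          also have "\<dots> = exp (real s / (4 * real l))" by (simp add: exp_of_nat_mult [symmetric])
          also have "\<dots> \<le> exp 1" using sl l by (simp add: field_simps)
          also have "\<dots> \<le> 3" by (rule exp_le)
          finally show ?thesis .
        qed
        finally show ?thesis using m1 p unfolding L_def by (simp add: mult_left_mono mult.commute)
      qed
      have z: "bexp p V (\<lambda>X. of_bool (X \<in> D) * (Z X)\<^sup>2) \<le> 3 * m\<^sup>2 * p ^ (2 * s) * W"
      proof -
        have "bexp p V (\<lambda>X. of_bool (X \<in> D) * (Z X)\<^sup>2) =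
            bexp p V (\<lambda>X. \<Sum>F\<in>\<F> T. \<Sum>F'\<in>\<F> T. of_bool ((F - T) \<union> (F' - T) \<subseteq> X) * of_bool (X \<in> D))"
        proof (rule bexp_cong)
          fix X
          have "(Z X)\<^sup>2 = (\<Sum>F\<in>\<F> T. \<Sum>F'\<in>\<F> T. of_bool ((F - T) \<union> (F' - T) \<subseteq> X))"
            unfolding power2_eq_square Z_def sum_product by (intro sum.cong refl) auto
          then show "of_bool (X \<in> D) * (Z X)\<^sup>2 =
              (\<Sum>F\<in>\<F> T. \<Sum>F'\<in>\<F> T. of_bool ((F - T) \<union> (F' - T) \<subseteq> X) * of_bool (X \<in> D))"
            unfolding sum_distrib_right [symmetric] by simp
        qed
        also have "\<dots> = (\<Sum>F\<in>\<F> T. \<Sum>F'\<in>\<F> T. p ^ card ((F - T) \<union> (F' - T)) * weight p V (extendable D ((F - T) \<union> (F' - T))))"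
          unfolding bexp_sum
        proof (intro sum.cong refl)
          fix F F' assume "F \<in> \<F> T" "F' \<in> \<F> T"
          then have "(F - T) \<union> (F' - T) \<subseteq> V" using link by blast
          then show "bexp p V (\<lambda>X. of_bool (F - T \<union> (F' - T) \<subseteq> X) * of_bool (X \<in> D)) =
              p ^ card (F - T \<union> (F' - T)) * weight p V (extendable D (F - T \<union> (F' - T)))"
            by (rule bexp_inside_downset [OF V D(1)])
        qed
        also have "\<dots> \<le> (\<Sum>F\<in>\<F> T. \<Sum>F'\<in>\<F> T. p ^ card ((F - T) \<union> (F' - T)) * W)"
          using p unfolding W_def
          by (intro sum_mono mult_left_mono weight_mono) (auto simp: extendable_def)
        also have "\<dots> \<le> (\<Sum>F\<in>\<F> T. p ^ (2 * s) * (3 * m) * W)"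
        proof (rule sum_mono)
          fix F assume "F \<in> \<F> T"
          then show "(\<Sum>F'\<in>\<F> T. p ^ card ((F - T) \<union> (F' - T)) * W) \<le> p ^ (2 * s) * (3 * m) * W"
            unfolding sum_distrib_right [symmetric] using W inner by (intro mult_right_mono) auto
        qed
        also have "\<dots> = 3 * m\<^sup>2 * p ^ (2 * s) * W" by (simp add: m_def power2_eq_square)
        finally show ?thesis .
      qed
      \<comment> \<open>Cauchy-Schwarz, written as nonnegativity of a mean square. For x = c * m *
        p^s the bounds give c^2/8 - 7c/4 + 3 in units of (m * p^s)^2 * W, negative for 2 < c < 12; c
        = 4 gives -2.\<close>
      define x where "x = 4 * m * p ^ s"
      have x: "x > 0" using m1 p unfolding x_def by simp
      have "0 \<le> bexp p V (\<lambda>X. (x * of_bool (X \<in> B) - of_bool (X \<in> D) * Z X)\<^sup>2)"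
        using p by (intro bexp_nonneg) auto
      also have "\<dots> = bexp p V (\<lambda>X. (x\<^sup>2 * of_bool (X \<in> B) - 2 * x * (of_bool (X \<in> D) * Z X)) + of_bool (X \<in> D) * (Z X)\<^sup>2)"
      proof (rule bexp_cong)
        fix X
        have *: "Z X = 0" if "X \<in> D" "X \<notin> B"
        proof -
          have "T \<union> X \<in> D" using that unfolding B_def extendable_def by auto
          then have "\<not> F - T \<subseteq> X" if "F \<in> \<F> T" for F
            using FT(2,5) [OF that] D(1) unfolding downset_def by (metis Diff_partition Un_mono order_refl)
          then show ?thesis unfolding Z_def by simp
        qed
        show "(x * of_bool (X \<in> B) - of_bool (X \<in> D) * Z X)\<^sup>2 =
            (x\<^sup>2 * of_bool (X \<in> B) - 2 * x * (of_bool (X \<in> D) * Z X)) + of_bool (X \<in> D) * (Z X)\<^sup>2"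
        proof (cases "X \<in> D")
          case True
          then show ?thesis using * by (cases "X \<in> B") (auto simp: power2_eq_square algebra_simps)
        next
          case False
          then have "X \<notin> B" by (simp add: B_def)
          then show ?thesis using False by simp
        qed
      qed
      also have "\<dots> = x\<^sup>2 * bexp p V (\<lambda>X. of_bool (X \<in> B)) - 2 * x * bexp p V (\<lambda>X. of_bool (X \<in> D) * Z X)
          + bexp p V (\<lambda>X. of_bool (X \<in> D) * (Z X)\<^sup>2)"
        by (simp only: bexp_add bexp_diff bexp_cmult)
      also have "\<dots> \<le> x\<^sup>2 * (W / 8) - 2 * x * (m * p ^ s * (7 / 8 * W)) + 3 * m\<^sup>2 * p ^ (2 * s) * W"
      proof -
        have "x\<^sup>2 * bexp p V (\<lambda>X. of_bool (X \<in> B)) \<le> x\<^sup>2 * (W / 8)"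
          by (rule mult_left_mono [OF u]) simp
        moreover have "2 * x * (m * p ^ s * (7 / 8 * W)) \<le> 2 * x * bexp p V (\<lambda>X. of_bool (X \<in> D) * Z X)"
          using x by (intro mult_left_mono [OF c]) simp
        ultimately show ?thesis using z by linarith
      qed
      also have "\<dots> = - 2 * ((m * p ^ s)\<^sup>2 * W)"
      proof -
        have "m\<^sup>2 * p ^ (2 * s) = (m * p ^ s)\<^sup>2"
          by (simp add: power_mult_distrib power_mult [symmetric] mult.commute)
        then have "3 * m\<^sup>2 * p ^ (2 * s) * W = 3 * (m * p ^ s)\<^sup>2 * W" by simp
        moreover have "(4 * y)\<^sup>2 * (W / 8) - 2 * (4 * y) * (y * (7 / 8 * W)) + 3 * y\<^sup>2 * W = - 2 * (y\<^sup>2 * W)"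
          for y :: real by (simp add: power2_eq_square)
        from this [of "m * p ^ s"] have "x\<^sup>2 * (W / 8) - 2 * x * (m * p ^ s * (7 / 8 * W))
            + 3 * (m * p ^ s)\<^sup>2 * W = - 2 * ((m * p ^ s)\<^sup>2 * W)"
          unfolding x_def by (simp only: mult.assoc)
        ultimately show ?thesis by linarith
      qed
      also have "\<dots> < 0" using m1 p W by simp
      finally show False by simp
    qed
  qed
qed

text \<open>The fingerprint is short because the weight starts at most 1, ends at least
  \<open>(1 - p) ^ card V\<close> and loses a factor \<open>1 - 1 / (8 * l)\<close> per point. A
  hyperedge inside the container is not in the final state, so it contains a minimal non-member. By
  \<open>stable_degree\<close> for singletons there are at most
  \<open>card V * (4 * l / p) ^ (j - 1)\<close> of these of size \<open>j\<close>, and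
  \<open>deg\<close> is normalised so that the hyperedges above them number at most
  \<open>\<mu>\<close> for each \<open>j\<close>.\<close>

theorem hypergraph_containers:
  fixes V :: "'a set" and \<H> :: "'a set set"
  assumes V: "finite V" "V \<noteq> {}" and p: "0 < p" "p \<le> 1 / 2" and l: "l \<ge> 1"
    and H: "\<And>E. E \<in> \<H> \<Longrightarrow> E \<subseteq> V \<and> E \<noteq> {} \<and> card E \<le> l"
    and deg: "\<And>F. F \<subseteq> V \<Longrightarrow> 2 \<le> card F \<Longrightarrow> card F \<le> l \<Longrightarrow>
      real (card V) * (4 * real l / p) ^ (card F - 1) * real (card {E \<in> \<H>. F \<subseteq> E}) \<le> \<mu>"
    and mu: "\<mu> \<ge> 0"
  shows "\<exists>C g. \<forall>I. I \<subseteq> V \<and> (\<forall>E\<in>\<H>. \<not> E \<subseteq> I) \<longrightarrow>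
      g I \<subseteq> I \<and> I \<subseteq> C (g I) \<and> C (g I) \<subseteq> V \<and> real (card (g I)) \<le> 16 * real l * p * real (card V) \<and>
      real (card {E \<in> \<H>. E \<subseteq> C (g I)}) \<le> real l * \<mu>"
proof -
  define D0 where "D0 = {I. I \<subseteq> V \<and> (\<forall>E\<in>\<H>. \<not> E \<subseteq> I)}"
  define \<eta> where "\<eta> = 1 / (8 * real l)"
  have \<eta>: "0 < \<eta>" "\<eta> < 1" using l unfolding \<eta>_def by (auto simp: field_simps)
  have D0: "downset V D0" unfolding downset_def D0_def by blast
  have p1: "0 \<le> p" "p \<le> 1" "p < 1" using p by auto
  obtain f g where fg: "\<forall>I\<in>D0. g I \<subseteq> I \<and> I \<in> f I \<and> downset V (f I) \<and> f I \<subseteq> D0 \<and>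
      stable \<eta> p l V (f I) \<and> weight p V (f I) \<le> (1 - \<eta>) ^ card (g I) * weight p V D0 \<and>
      (\<forall>A. g I \<subseteq> A \<and> A \<subseteq> I \<longrightarrow> f A = f I)"
    using container_algorithm [OF V(1) p1(1,2) _ _ D0, of \<eta> l] \<eta> by auto
  show ?thesis
  \<comment> \<open>The container consists of the points whose singletons belong to the final state.
    A minimal non-member inside it therefore has at least two points, which is why
    \<open>deg\<close> starts at \<open>2 \<le> card F\<close>.\<close>
  proof (rule exI [of _ "\<lambda>S. \<Union> (f S)"], rule exI [of _ g], intro allI impI)
    fix I assume "I \<subseteq> V \<and> (\<forall>E\<in>\<H>. \<not> E \<subseteq> I)"
    then have I: "I \<in> D0" unfolding D0_def by blast
    define D where "D = f I"
    have P: "g I \<subseteq> I" "I \<in> D" "downset V D" "D \<subseteq> D0" "stable \<eta> p l V D"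
        "weight p V D \<le> (1 - \<eta>) ^ card (g I) * weight p V D0"
        "\<forall>A. g I \<subseteq> A \<and> A \<subseteq> I \<longrightarrow> f A = f I"
      using bspec [OF fg I] unfolding D_def by - (elim conjE, assumption)+
    have fgI: "f (g I) = D" using P(1,7) unfolding D_def by blast
    have emp: "{} \<in> D" using P(2,3) unfolding downset_def by blast
    have finD: "finite D" using P(3) V unfolding downset_def by (meson finite_Pow_iff finite_subset)
    have CV: "\<Union> D \<subseteq> V" using P(3) unfolding downset_def by blast
    have single: "{v} \<in> D" if "v \<in> \<Union> D" for v
      using that P(3) unfolding downset_def by blast
    have "real (card (g I)) \<le> 16 * real l * p * real (card V)"
    proof -
      have "exp (- 2 * p) ^ card V \<le> (1 - p) ^ card V"
        using p by (intro power_mono exp_le_one_minus) auto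
      also have "\<dots> \<le> weight p V D" using weight_ge_empty V p1 emp by blast
      also have "\<dots> \<le> (1 - \<eta>) ^ card (g I) * weight p V D0" by (rule P)
      also have "\<dots> \<le> (1 - \<eta>) ^ card (g I) * 1"
        using \<eta> weight_le_one [OF V(1) p1(1,2)] by (intro mult_left_mono) auto
      also have "\<dots> \<le> exp (- \<eta>) ^ card (g I)"
        using \<eta> exp_ge_add_one_self [of "- \<eta>"] by (simp add: power_mono)
      finally have "exp (real (card V) * (- 2 * p)) \<le> exp (real (card (g I)) * (- \<eta>))"
        by (simp only: exp_of_nat_mult)
      then have "real (card (g I)) * \<eta> \<le> real (card V) * (2 * p)" by simp
      then show ?thesis using l unfolding \<eta>_def by (simp add: field_simps)
    qed
    moreover have "real (card {E \<in> \<H>. E \<subseteq> \<Union> D}) \<le> real l * \<mu>"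
    proof -
      define N where "N = real (card V)"
      define lam where "lam = 4 * real l / p"
      have N: "N > 0" using V unfolding N_def by (simp add: card_gt_0_iff)
      have lam: "lam > 0" using l p unfolding lam_def by simp
      define M where "M = (\<lambda>j. {F \<in> minimal_nonmembers V D j. F \<subseteq> \<Union> D})"
      have finM: "finite (M j)" for j
        unfolding M_def minimal_nonmembers_def using V by (auto intro: finite_subset [of _ "Pow V"])
      have finH: "finite \<H>" using V H by (meson PowI finite_Pow_iff finite_subset subsetI)
      have "{E \<in> \<H>. E \<subseteq> \<Union> D} \<subseteq> (\<Union>j\<in>{2..l}. \<Union>F\<in>M j. {E \<in> \<H>. F \<subseteq> E})"
      proof
        fix E assume E: "E \<in> {E \<in> \<H>. E \<subseteq> \<Union> D}"
        then have fE: "finite E" "card E \<le> l" using H finite_subset [OF _ V(1)] by blast+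
        have "E \<notin> D" using E P(4) unfolding D0_def by auto
        then obtain F where "F \<in> {F. F \<subseteq> E \<and> F \<notin> D}"
            "\<forall>Y\<in>{F. F \<subseteq> E \<and> F \<notin> D}. Y \<subseteq> F \<longrightarrow> F = Y"
          using finite_has_minimal2 [of "{F. F \<subseteq> E \<and> F \<notin> D}" E] fE(1) by auto
        then have F: "F \<subseteq> E" "F \<notin> D" "\<And>Y. Y \<subseteq> F \<Longrightarrow> Y \<notin> D \<Longrightarrow> Y = F" by blast+
        have fF: "finite F" "card F \<le> l" using F fE by (auto intro: finite_subset order_trans [OF card_mono])
        have "card F \<noteq> 0" using F(2) emp fF by auto
        moreover have "card F \<noteq> 1"
        proof
          assume "card F = 1"
          then obtain v where "F = {v}" by (meson card_1_singletonE)
          then show False using F(1,2) E single [of v] by auto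
        qed
        ultimately have "card F \<in> {2..l}" using fF(2) unfolding atLeastAtMost_iff by linarith
        moreover have "F \<in> M (card F)"
          using F E CV unfolding M_def minimal_nonmembers_def by blast
        ultimately show "E \<in> (\<Union>j\<in>{2..l}. \<Union>F\<in>M j. {E \<in> \<H>. F \<subseteq> E})" using F(1) E by blast
      qed
      then have "card {E \<in> \<H>. E \<subseteq> \<Union> D} \<le> card (\<Union>j\<in>{2..l}. \<Union>F\<in>M j. {E \<in> \<H>. F \<subseteq> E})"
        using finM finH by (intro card_mono) auto
      also have "\<dots> \<le> (\<Sum>j\<in>{2..l}. \<Sum>F\<in>M j. card {E \<in> \<H>. F \<subseteq> E})"
        using finM by (intro order_trans [OF card_UN_le] sum_mono) auto
      finally have "real (card {E \<in> \<H>. E \<subseteq> \<Union> D}) \<le> real (\<Sum>j\<in>{2..l}. \<Sum>F\<in>M j. card {E \<in> \<H>. F \<subseteq> E})"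
        by (simp only: of_nat_le_iff)
      also have "\<dots> = (\<Sum>j\<in>{2..l}. \<Sum>F\<in>M j. real (card {E \<in> \<H>. F \<subseteq> E}))" by simp
      also have "\<dots> \<le> (\<Sum>j\<in>{2..l}. \<mu>)"
      proof (rule sum_mono)
        fix j assume j: "j \<in> {2..l}"
        have fM: "F \<subseteq> V" "card F = j" "F \<noteq> {}" "F \<subseteq> \<Union> D" "F \<in> minimal_nonmembers V D j" if "F \<in> M j" for F
          using that j unfolding M_def minimal_nonmembers_def by auto
        have "M j \<subseteq> (\<Union>v\<in>\<Union> D. {F \<in> minimal_nonmembers V D j. {v} \<subseteq> F})"
        proof
          fix F assume F: "F \<in> M j"
          then obtain v where "v \<in> F" using fM(3) by blast
          then show "F \<in> (\<Union>v\<in>\<Union> D. {F \<in> minimal_nonmembers V D j. {v} \<subseteq> F})"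
            using fM(4,5) [OF F] by blast
        qed
        then have "card (M j) \<le> card (\<Union>v\<in>\<Union> D. {F \<in> minimal_nonmembers V D j. {v} \<subseteq> F})"
        proof (rule card_mono [rotated])
          show "finite (\<Union>v\<in>\<Union> D. {F \<in> minimal_nonmembers V D j. {v} \<subseteq> F})"
            by (rule finite_subset [of _ "Pow V"]) (use V in \<open>auto simp: minimal_nonmembers_def\<close>)
        qed
        also have "\<dots> \<le> (\<Sum>v\<in>\<Union> D. card {F \<in> minimal_nonmembers V D j. {v} \<subseteq> F})"
          by (rule card_UN_le [OF finite_subset [OF CV V(1)]])
        finally have "real (card (M j)) \<le> (\<Sum>v\<in>\<Union> D. real (card {F \<in> minimal_nonmembers V D j. {v} \<subseteq> F}))"
          unfolding of_nat_sum [symmetric] of_nat_le_iff .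
        also have "\<dots> \<le> (\<Sum>v\<in>\<Union> D. lam ^ (j - card {v}))"
        proof (rule sum_mono)
          fix v assume "v \<in> \<Union> D"
          then show "real (card {F \<in> minimal_nonmembers V D j. {v} \<subseteq> F}) \<le> lam ^ (j - card {v})"
            unfolding lam_def using CV j P(5) unfolding \<eta>_def
            by (intro stable_degree [OF V(1) p(1) p1(3) P(3) emp]) auto
        qed
        also have "\<dots> = real (card (\<Union> D)) * lam ^ (j - 1)" by simp
        also have "\<dots> \<le> N * lam ^ (j - 1)"
          unfolding N_def using lam CV V by (intro mult_right_mono) (auto intro: card_mono)
        finally have cM: "real (card (M j)) \<le> N * lam ^ (j - 1)" .
        have pos: "N * lam ^ (j - 1) > 0" using N lam by simp
        have "(\<Sum>F\<in>M j. real (card {E \<in> \<H>. F \<subseteq> E})) \<le> (\<Sum>F\<in>M j. \<mu> / (N * lam ^ (j - 1)))"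
        proof (rule sum_mono)
          fix F assume F: "F \<in> M j"
          then show "real (card {E \<in> \<H>. F \<subseteq> E}) \<le> \<mu> / (N * lam ^ (j - 1))"
            using deg [of F] fM [OF F] j pos unfolding N_def lam_def
            by (simp add: pos_le_divide_eq mult.commute)
        qed
        also have "\<dots> = real (card (M j)) * (\<mu> / (N * lam ^ (j - 1)))" by simp
        also have "\<dots> \<le> N * lam ^ (j - 1) * (\<mu> / (N * lam ^ (j - 1)))"
          using cM mu pos by (intro mult_right_mono) auto
        also have "\<dots> = \<mu>" using pos by (metis less_irrefl nonzero_mult_div_cancel_left times_divide_eq_right)
        finally show "(\<Sum>F\<in>M j. real (card {E \<in> \<H>. F \<subseteq> E})) \<le> \<mu>" .
      qed
      also have "\<dots> \<le> real l * \<mu>" using mu by (simp add: mult_right_mono)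
      finally show ?thesis .
    qed
    ultimately show "g I \<subseteq> I \<and> I \<subseteq> \<Union> (f (g I)) \<and> \<Union> (f (g I)) \<subseteq> V \<and>
        real (card (g I)) \<le> 16 * real l * p * real (card V) \<and>
        real (card {E \<in> \<H>. E \<subseteq> \<Union> (f (g I))}) \<le> real l * \<mu>"
      unfolding fgI using P(1,2) CV by (intro conjI) (assumption | blast)+
  qed
qed

section \<open>Ramsey numbers and supersaturation\<close>

lemma ramsey_number_colouring:
  assumes "finite Y" "card Y = ramsey_number k r" "f \<in> nsets Y 2 \<rightarrow> {..<r}"
  obtains K i where "K \<in> nsets Y k" "i < r" "f ` nsets K 2 \<subseteq> {i}"
proof -
  obtain h where h: "bij_betw h {..<ramsey_number k r} Y"
    using assms(1,2) by (metis atLeast0LessThan ex_bij_betw_nat_finite)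
  have inj: "inj_on h {..<ramsey_number k r}" using h by (rule bij_betw_imp_inj_on)
  have img: "h ` B \<in> nsets Y m" if "B \<in> nsets {..<ramsey_number k r} m" for B m
  proof -
    have B: "B \<subseteq> {..<ramsey_number k r}" "finite B" "card B = m" using that unfolding nsets_def by auto
    then have "card (h ` B) = m" using inj by (metis card_image inj_on_subset)
    moreover have "h ` B \<subseteq> Y" using B(1) h unfolding bij_betw_def by blast
    ultimately show ?thesis using B(2) unfolding nsets_def by blast
  qed
  have "(\<lambda>e. f (h ` e)) \<in> nsets {..<ramsey_number k r} 2 \<rightarrow> {..<r}"
    using img [of _ 2] assms(3) by blast
  then obtain H i where H: "H \<in> nsets {..<ramsey_number k r} k" "i < r"
      "(\<lambda>e. f (h ` e)) ` nsets H 2 \<subseteq> {i}"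
    using bspec [OF ramsey_number_partn [of k r, unfolded partn_def], of "\<lambda>e. f (h ` e)"]
    by (auto simp: monochromatic_def)
  have Hs: "H \<subseteq> {..<ramsey_number k r}" using H(1) unfolding nsets_def by auto
  show ?thesis
  proof (rule that [OF img [OF H(1)] H(2)])
    show "f ` nsets (h ` H) 2 \<subseteq> {i}"
    proof (rule image_subsetI)
      fix e assume e: "e \<in> nsets (h ` H) 2"
      then obtain d where d: "d \<subseteq> H" "e = h ` d" unfolding nsets_def by (auto simp: subset_image_iff)
      have injd: "inj_on h d" using inj d(1) Hs by (meson inj_on_subset order_trans)
      then have "card d = 2" "finite d"
        using e d unfolding nsets_def by (auto simp: card_image finite_image_iff)
      then have "d \<in> nsets H 2" using d(1) unfolding nsets_def by blast
      then show "f e \<in> {i}" using H(3) d(2) by blast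
    qed
  qed
qed

lemma ramsey_number_ge:
  assumes "r \<ge> 1"
  shows "k \<le> ramsey_number k r"
proof -
  have "(\<lambda>_. 0) \<in> nsets {..<ramsey_number k r} 2 \<rightarrow> {..<r}" using assms by auto
  then obtain K and i :: nat where "K \<in> nsets {..<ramsey_number k r} k"
    by (rule ramsey_number_colouring [OF finite_lessThan card_lessThan])
  then show ?thesis unfolding nsets_def using card_mono [of "{..<ramsey_number k r}" K] by auto
qed

text \<open>Colouring each edge by its smaller endpoint leaves no monochromatic triangle.\<close>

lemma ramsey_number_gt_colours:
  assumes "k \<ge> 3"
  shows "r < ramsey_number k r"
proof (rule ccontr)
  assume "\<not> ?thesis"
  then have le: "ramsey_number k r \<le> r" by simp
  have "Min \<in> nsets {..<ramsey_number k r} 2 \<rightarrow> {..<r}"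
  proof
    fix e assume "e \<in> nsets {..<ramsey_number k r} 2"
    then have e: "e \<subseteq> {..<ramsey_number k r}" "finite e" "e \<noteq> {}" unfolding nsets_def by auto
    then have "Min e \<in> {..<ramsey_number k r}" using Min_in by blast
    then show "Min e \<in> {..<r}" using le by simp
  qed
  then obtain K i where K: "K \<in> nsets {..<ramsey_number k r} k" "Min ` nsets K 2 \<subseteq> {i}"
    by (rule ramsey_number_colouring [OF finite_lessThan card_lessThan])
  have fK: "finite K" "card K \<ge> 3" using K(1) assms unfolding nsets_def by auto
  then have "K \<noteq> {}" by auto
  then have a: "Min K \<in> K" using fK by simp
  define K' where "K' = K - {Min K}"
  have "card K' \<ge> 2" using fK a unfolding K'_def by simp
  moreover have "finite K'" using fK unfolding K'_def by simp
  ultimately have "K' \<noteq> {}" "finite K'" by auto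
  then have b: "Min K' \<in> K'" by simp
  have "card (K' - {Min K'}) \<ge> 1" using \<open>card K' \<ge> 2\<close> \<open>finite K'\<close> b by simp
  then have "K' - {Min K'} \<noteq> {}" by (metis card.empty not_one_le_zero)
  then obtain c where c: "c \<in> K'" "c \<noteq> Min K'" by blast
  have ab: "Min K < Min K'" using a b fK unfolding K'_def by (metis DiffE Min_le insertI1 order_le_less)
  have bc: "Min K' < c" using c \<open>finite K'\<close> by (metis Min_le order_le_less)
  have "{Min K, Min K'} \<in> nsets K 2" "{Min K', c} \<in> nsets K 2"
    using a b c ab bc unfolding K'_def nsets_def by auto
  then have "Min {Min K, Min K'} = i" "Min {Min K', c} = i" using K(2) by blast+
  then show False using ab bc by simp
qed

lemma card_supersets_le:
  assumes "finite A" "S \<subseteq> A"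
  shows "card {Y \<in> nsets A m. S \<subseteq> Y} \<le> (card A - card S) choose (m - card S)"
proof -
  have S: "finite S" using assms finite_subset by blast
  have "inj_on (\<lambda>Y. Y - S) {Y \<in> nsets A m. S \<subseteq> Y}"
    by (rule inj_onI) auto
  moreover have "(\<lambda>Y. Y - S) ` {Y \<in> nsets A m. S \<subseteq> Y} \<subseteq> nsets (A - S) (m - card S)"
    using S by (auto simp: nsets_def card_Diff_subset)
  moreover have "finite (nsets (A - S) (m - card S))"
    using assms by (simp add: finite_imp_finite_nsets)
  ultimately have "card {Y \<in> nsets A m. S \<subseteq> Y} \<le> card (nsets (A - S) (m - card S))"
    by (rule card_inj_on_le)
  also have "\<dots> = (card A - card S) choose (m - card S)"
    using S assms by (simp add: card_Diff_subset)
  finally show ?thesis .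
qed

text \<open>Double counting of \<open>R\<close>-subsets \<open>Y\<close> of \<open>A\<close>: each
  contains an edge outside all \<open>C i\<close> or a \<open>k\<close>-clique inside some
  \<open>C i\<close>, since otherwise choosing for every edge a class that contains it would
  contradict the Ramsey property. By \<open>few\<close> the cliques account for at most half of the
  \<open>Y\<close>, so the uncovered edges account for the other half, and each edge lies in a
  proportion (R choose 2) / (n choose 2) of all \<open>Y\<close>. Finally 2 * (R choose 2) <=
  R^2.\<close>

lemma supersaturation:
  assumes A: "finite A" and R: "R = ramsey_number k r" "k \<ge> 2" "r \<ge> 1" "R \<le> card A"
    and few: "2 * (\<Sum>i<r. card {K \<in> nsets A k. nsets K 2 \<subseteq> C i}) * (R choose k) \<le> card A choose k"
  shows "card A choose 2 \<le> R\<^sup>2 * card (nsets A 2 - (\<Union>i<r. C i))"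
proof -
  define n where "n = card A"
  define Out where "Out = nsets A 2 - (\<Union>i<r. C i)"
  define B where "B = (\<Sum>i<r. card {K \<in> nsets A k. nsets K 2 \<subseteq> C i})"
  have kR: "k \<le> R" using ramsey_number_ge R by simp
  have fin: "finite (nsets A m)" for m using A by (simp add: finite_imp_finite_nsets)
  have "nsets A R \<subseteq> (\<Union>e\<in>Out. {Y \<in> nsets A R. e \<subseteq> Y}) \<union>
      (\<Union>i<r. \<Union>K\<in>{K \<in> nsets A k. nsets K 2 \<subseteq> C i}. {Y \<in> nsets A R. K \<subseteq> Y})"
  proof
    fix Y assume Y: "Y \<in> nsets A R"
    then have Y': "Y \<subseteq> A" "finite Y" "card Y = ramsey_number k r" using R(1) unfolding nsets_def by auto
    have YA: "nsets Y m \<subseteq> nsets A m" for m using Y'(1) by (rule nsets_mono)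
    show "Y \<in> (\<Union>e\<in>Out. {Y \<in> nsets A R. e \<subseteq> Y}) \<union>
      (\<Union>i<r. \<Union>K\<in>{K \<in> nsets A k. nsets K 2 \<subseteq> C i}. {Y \<in> nsets A R. K \<subseteq> Y})"
    proof (cases "\<exists>e\<in>nsets Y 2. e \<in> Out")
      case True
      then obtain e where e: "e \<in> Out" "e \<subseteq> Y" unfolding nsets_def by blast
      then show ?thesis using Y by blast
    next
      case False
      then have "\<forall>e\<in>nsets Y 2. \<exists>i<r. e \<in> C i" using YA [of 2] unfolding Out_def by blast
      then obtain f where f: "\<forall>e\<in>nsets Y 2. f e < r \<and> e \<in> C (f e)" by metis
      then have "f \<in> nsets Y 2 \<rightarrow> {..<r}" by blast
      then obtain K i where K: "K \<in> nsets Y k" "i < r" "f ` nsets K 2 \<subseteq> {i}"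
        by (rule ramsey_number_colouring [OF Y'(2,3)])
      have KY: "K \<subseteq> Y" using K(1) unfolding nsets_def by blast
      have "nsets K 2 \<subseteq> C i" using f K(3) nsets_mono [OF KY, of 2] by blast
      moreover have "K \<in> nsets A k" using K(1) YA by blast
      ultimately show ?thesis using K(2) KY Y by blast
    qed
  qed
  then have "card (nsets A R) \<le> card ((\<Union>e\<in>Out. {Y \<in> nsets A R. e \<subseteq> Y}) \<union>
      (\<Union>i<r. \<Union>K\<in>{K \<in> nsets A k. nsets K 2 \<subseteq> C i}. {Y \<in> nsets A R. K \<subseteq> Y}))"
    using fin unfolding Out_def by (intro card_mono) auto
  also have "\<dots> \<le> card (\<Union>e\<in>Out. {Y \<in> nsets A R. e \<subseteq> Y}) +
      card (\<Union>i<r. \<Union>K\<in>{K \<in> nsets A k. nsets K 2 \<subseteq> C i}. {Y \<in> nsets A R. K \<subseteq> Y})"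
    by (rule card_Un_le)
  also have "\<dots> \<le> card Out * ((n - 2) choose (R - 2)) + B * ((n - k) choose (R - k))"
  proof (rule add_mono)
    have sup: "card {Y \<in> nsets A R. S \<subseteq> Y} \<le> (n - m) choose (R - m)" if "S \<in> nsets A m" for S m
      using that card_supersets_le [OF A, of S R] unfolding nsets_def n_def by auto
    have "card (\<Union>e\<in>Out. {Y \<in> nsets A R. e \<subseteq> Y}) \<le> (\<Sum>e\<in>Out. card {Y \<in> nsets A R. e \<subseteq> Y})"
      using fin unfolding Out_def by (intro card_UN_le) auto
    also have "\<dots> \<le> (\<Sum>e\<in>Out. (n - 2) choose (R - 2))"
      using sup unfolding Out_def by (intro sum_mono) blast
    finally show "card (\<Union>e\<in>Out. {Y \<in> nsets A R. e \<subseteq> Y}) \<le> card Out * ((n - 2) choose (R - 2))" by simp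
    have "card (\<Union>i<r. \<Union>K\<in>{K \<in> nsets A k. nsets K 2 \<subseteq> C i}. {Y \<in> nsets A R. K \<subseteq> Y})
        \<le> (\<Sum>i<r. card (\<Union>K\<in>{K \<in> nsets A k. nsets K 2 \<subseteq> C i}. {Y \<in> nsets A R. K \<subseteq> Y}))"
      by (intro card_UN_le) auto
    also have "\<dots> \<le> (\<Sum>i<r. card {K \<in> nsets A k. nsets K 2 \<subseteq> C i} * ((n - k) choose (R - k)))"
    proof (rule sum_mono)
      fix i
      have "card (\<Union>K\<in>{K \<in> nsets A k. nsets K 2 \<subseteq> C i}. {Y \<in> nsets A R. K \<subseteq> Y})
          \<le> (\<Sum>K\<in>{K \<in> nsets A k. nsets K 2 \<subseteq> C i}. card {Y \<in> nsets A R. K \<subseteq> Y})"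
        using fin by (intro card_UN_le) auto
      also have "\<dots> \<le> (\<Sum>K\<in>{K \<in> nsets A k. nsets K 2 \<subseteq> C i}. (n - k) choose (R - k))"
        using sup by (intro sum_mono) blast
      finally show "card (\<Union>K\<in>{K \<in> nsets A k. nsets K 2 \<subseteq> C i}. {Y \<in> nsets A R. K \<subseteq> Y})
          \<le> card {K \<in> nsets A k. nsets K 2 \<subseteq> C i} * ((n - k) choose (R - k))" by simp
    qed
    finally show "card (\<Union>i<r. \<Union>K\<in>{K \<in> nsets A k. nsets K 2 \<subseteq> C i}. {Y \<in> nsets A R. K \<subseteq> Y})
        \<le> B * ((n - k) choose (R - k))" unfolding B_def by (simp add: sum_distrib_right)
  qed
  finally have le: "n choose R \<le> card Out * ((n - 2) choose (R - 2)) + B * ((n - k) choose (R - k))"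
    by (simp add: n_def)
  have nk: "n choose k > 0" using kR R(4) unfolding n_def by simp
  have nR: "n choose R > 0" using R(4) unfolding n_def by simp
  have "(n choose k) * (2 * B * ((n - k) choose (R - k))) = 2 * B * ((n choose R) * (R choose k))"
    using choose_mult [OF kR, of n] R(4) unfolding n_def by simp
  also have "\<dots> \<le> (n choose k) * (n choose R)"
    using mult_right_mono [OF few, of "n choose R"] unfolding B_def [symmetric] n_def [symmetric]
    by (simp add: mult.commute mult.left_commute)
  finally have "2 * B * ((n - k) choose (R - k)) \<le> n choose R" using nk by simp
  then have "n choose R \<le> 2 * (card Out * ((n - 2) choose (R - 2)))" using le by linarith
  then have "(n choose 2) * (n choose R) \<le> (n choose 2) * (2 * (card Out * ((n - 2) choose (R - 2))))"
    by (rule mult_left_mono) simp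
  also have "\<dots> = 2 * card Out * ((n choose 2) * ((n - 2) choose (R - 2)))" by (simp only: ac_simps)
  also have "\<dots> = 2 * card Out * ((n choose R) * (R choose 2))"
    using choose_mult [of 2 R n] R kR unfolding n_def by simp
  finally have "(n choose R) * (n choose 2) \<le> (n choose R) * (card Out * (2 * (R choose 2)))"
    by (simp only: ac_simps)
  then have "n choose 2 \<le> card Out * (2 * (R choose 2))" using nR by simp
  also have "\<dots> \<le> card Out * (R * R)"
    by (intro mult_left_mono) (auto simp: choose_two algebra_simps)
  finally show ?thesis unfolding n_def Out_def power2_eq_square by (simp add: mult.commute)
qed

section \<open>Random sets covered by few independent sets\<close>

text \<open>Tuples are grouped by their union \<open>U\<close>: at most
  \<open>(2 ^ r) ^ card U\<close> tuples of subsets of \<open>U\<close> have it, and the binomial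
  theorem sums over \<open>U\<close>.\<close>

lemma sum_PiE_Union_power:
  fixes y :: real
  assumes "finite V" "0 \<le> y"
  shows "(\<Sum>S\<in>PiE {..<r} (\<lambda>_. Pow V). y ^ card (\<Union>i<r. S i)) \<le> exp (2 ^ r * y * real (card V))"
proof -
  define P where "P = PiE {..<r} (\<lambda>_. Pow V)"
  have finP: "finite P" unfolding P_def using assms(1) by (intro finite_PiE) auto
  have sub: "(\<lambda>S. \<Union>i<r. S i) ` P \<subseteq> Pow V" unfolding P_def by (auto simp: PiE_iff)
  have "(\<Sum>S\<in>P. y ^ card (\<Union>i<r. S i)) =
      (\<Sum>U\<in>Pow V. \<Sum>S\<in>{S \<in> P. (\<Union>i<r. S i) = U}. y ^ card (\<Union>i<r. S i))"
    using sum.group [OF finP _ sub, of "\<lambda>S. y ^ card (\<Union>i<r. S i)"] assms(1) by simp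
  also have "\<dots> = (\<Sum>U\<in>Pow V. real (card {S \<in> P. (\<Union>i<r. S i) = U}) * y ^ card U)"
    by simp
  also have "\<dots> \<le> (\<Sum>U\<in>Pow V. (2 ^ r) ^ card U * y ^ card U)"
  proof (intro sum_mono mult_right_mono)
    fix U assume "U \<in> Pow V"
    then have U: "finite U" using assms(1) finite_subset by auto
    have "{S \<in> P. (\<Union>i<r. S i) = U} \<subseteq> PiE {..<r} (\<lambda>_. Pow U)"
      unfolding P_def by (intro subsetI PiE_I) (auto simp: PiE_iff extensional_def)
    then have "card {S \<in> P. (\<Union>i<r. S i) = U} \<le> card (PiE {..<r} (\<lambda>_. Pow U))"
      using U by (intro card_mono finite_PiE) auto
    also have "\<dots> = (2 ^ r) ^ card U"
    proof -
      have "card (PiE {..<r} (\<lambda>_. Pow U)) = (2 ^ card U) ^ r"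
        using U by (simp add: card_PiE card_Pow)
      also have "\<dots> = (2 ^ r) ^ card U" unfolding power_mult [symmetric] by (simp only: mult.commute)
      finally show ?thesis .
    qed
    finally have "real (card {S \<in> P. (\<Union>i<r. S i) = U}) \<le> real ((2 ^ r) ^ card U)"
      by (simp only: of_nat_le_iff)
    then show "real (card {S \<in> P. (\<Union>i<r. S i) = U}) \<le> (2 ^ r) ^ card U" by simp
  qed (use assms in auto)
  also have "\<dots> = (\<Sum>U\<in>Pow V. (2 ^ r * y) ^ card U)" by (simp add: power_mult_distrib)
  also have "\<dots> = (1 + 2 ^ r * y) ^ card V" by (rule sum_Pow_power_card [OF assms(1)])
  also have "\<dots> \<le> exp (2 ^ r * y) ^ card V"
    using assms(2) by (intro power_mono exp_ge_add_one_self) auto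
  also have "\<dots> = exp (2 ^ r * y * real (card V))" by (simp add: exp_of_nat_mult [symmetric] mult.commute)
  finally show ?thesis unfolding P_def .
qed

text \<open>A union \<open>X\<close> of \<open>r\<close> independent sets contains all their
  fingerprints and avoids everything outside all their containers; these conditions concern disjoint
  sets of points, as every fingerprint lies in its container. For the union bound over fingerprints,
  \<open>q ^ card (U S)\<close> is replaced by
  \<open>(1 / lam) ^ (r * \<sigma>) * (q * lam) ^ card (U S)\<close>. The small base
  \<open>q * lam\<close> makes the sum over all tuples, of whatever size, at most
  \<open>exp (\<delta> * q * N / 2)\<close>, half of the gain from the avoided points, so no count
  of small sets is required.\<close>

lemma covered_by_independent_bound:
  fixes V :: "'a set" and r :: nat
  assumes V: "finite V" and q: "0 \<le> q" "q \<le> 1" and lam: "0 < lam" "lam \<le> 1" "2 ^ r * lam \<le> \<delta> / 2"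
    and cont: "\<And>I. I \<subseteq> V \<Longrightarrow> Q I \<Longrightarrow> g I \<subseteq> I \<and> I \<subseteq> C (g I) \<and> card (g I) \<le> \<sigma>"
    and out: "\<And>Is. (\<And>i. i < r \<Longrightarrow> Is i \<subseteq> V \<and> Q (Is i)) \<Longrightarrow>
      \<delta> * real (card V) \<le> real (card (V - (\<Union>i<r. C (g (Is i)))))"
  shows "bexp q V (\<lambda>X. of_bool (\<exists>Is. (\<forall>i<r. Is i \<subseteq> V \<and> Q (Is i)) \<and> X = (\<Union>i<r. Is i)))
    \<le> exp (- \<delta> * q * real (card V) / 2) * (1 / lam) ^ (r * \<sigma>)"
proof -
  define N where "N = real (card V)"
  define P where "P = PiE {..<r} (\<lambda>_. g ` {I. I \<subseteq> V \<and> Q I})"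
  define U where "U = (\<lambda>S :: nat \<Rightarrow> 'a set. \<Union>i<r. S i)"
  define Out where "Out = (\<lambda>S :: nat \<Rightarrow> 'a set. V - (\<Union>i<r. C (S i)))"
  have gV: "g ` {I. I \<subseteq> V \<and> Q I} \<subseteq> Pow V" using cont by blast
  then have PV: "P \<subseteq> PiE {..<r} (\<lambda>_. Pow V)" unfolding P_def by (intro PiE_mono)
  have finPV: "finite (PiE {..<r} (\<lambda>_. Pow V))" using V by (intro finite_PiE) auto
  then have finP: "finite P" using PV finite_subset by blast
  have PI: "\<exists>Is. (\<forall>i<r. Is i \<subseteq> V \<and> Q (Is i)) \<and> (\<forall>i<r. S i = g (Is i))" if "S \<in> P" for S
  proof -
    have "\<forall>i<r. \<exists>I. I \<subseteq> V \<and> Q I \<and> S i = g I"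
    proof (intro allI impI)
      fix i assume "i < r"
      then have "S i \<in> g ` {I. I \<subseteq> V \<and> Q I}" using that unfolding P_def by (auto intro: PiE_mem)
      then show "\<exists>I. I \<subseteq> V \<and> Q I \<and> S i = g I" by blast
    qed
    then show ?thesis by metis
  qed
  have "bexp q V (\<lambda>X. of_bool (\<exists>Is. (\<forall>i<r. Is i \<subseteq> V \<and> Q (Is i)) \<and> X = (\<Union>i<r. Is i)))
      \<le> bexp q V (\<lambda>X. \<Sum>S\<in>P. of_bool (U S \<subseteq> X \<and> X \<inter> Out S = {}))"
  proof (rule bexp_mono [OF q])
    fix X
    show "of_bool (\<exists>Is. (\<forall>i<r. Is i \<subseteq> V \<and> Q (Is i)) \<and> X = (\<Union>i<r. Is i))
        \<le> (\<Sum>S\<in>P. of_bool (U S \<subseteq> X \<and> X \<inter> Out S = {}) :: real)"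
    proof (cases "\<exists>Is. (\<forall>i<r. Is i \<subseteq> V \<and> Q (Is i)) \<and> X = (\<Union>i<r. Is i)")
      case True
      then obtain Is where Is: "\<And>i. i < r \<Longrightarrow> Is i \<subseteq> V \<and> Q (Is i)" "X = (\<Union>i<r. Is i)" by blast
      define S where "S = (\<lambda>i\<in>{..<r}. g (Is i))"
      have c: "g (Is i) \<subseteq> Is i" "Is i \<subseteq> C (g (Is i))" if "i < r" for i
        using cont Is(1) [OF that] by blast+
      have S: "S \<in> P" unfolding S_def P_def using Is(1) by auto
      have "U S \<subseteq> X" using c(1) unfolding U_def S_def Is(2) by auto
      moreover have "X \<inter> Out S = {}" using c(2) unfolding Out_def S_def Is(2) by auto
      ultimately have "(1::real) = of_bool (U S \<subseteq> X \<and> X \<inter> Out S = {})" by simp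
      also have "\<dots> \<le> (\<Sum>S\<in>P. of_bool (U S \<subseteq> X \<and> X \<inter> Out S = {}))"
        using S finP by (intro member_le_sum) auto
      finally show ?thesis by (simp only: True of_bool_eq)
    next
      case False
      then have "of_bool (\<exists>Is. (\<forall>i<r. Is i \<subseteq> V \<and> Q (Is i)) \<and> X = (\<Union>i<r. Is i)) = (0 :: real)"
        by (simp only: of_bool_eq)
      also have "\<dots> \<le> (\<Sum>S\<in>P. of_bool (U S \<subseteq> X \<and> X \<inter> Out S = {}))" by (intro sum_nonneg) simp
      finally show ?thesis .
    qed
  qed
  also have "\<dots> = (\<Sum>S\<in>P. q ^ card (U S) * (1 - q) ^ card (Out S))"
    unfolding bexp_sum
  proof (rule sum.cong [OF refl])
    fix S assume S: "S \<in> P"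
    then obtain Is where Is: "\<And>i. i < r \<Longrightarrow> Is i \<subseteq> V \<and> Q (Is i)" "\<And>i. i < r \<Longrightarrow> S i = g (Is i)"
      using PI by blast
    have c: "S i \<subseteq> C (S i)" if "i < r" for i
      using cont Is(1) [OF that] Is(2) [OF that] by force
    have "U S \<subseteq> V" using S PV unfolding U_def by (auto simp: PiE_iff)
    moreover have "U S \<inter> Out S = {}" using c unfolding U_def Out_def by blast
    ultimately show "bexp q V (\<lambda>X. of_bool (U S \<subseteq> X \<and> X \<inter> Out S = {})) = q ^ card (U S) * (1 - q) ^ card (Out S)"
      unfolding Out_def by (intro bexp_inside_outside V) auto
  qed
  also have "\<dots> \<le> (\<Sum>S\<in>P. (1 / lam) ^ (r * \<sigma>) * (q * lam) ^ card (U S) * exp (- \<delta> * q * N))"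
  proof (intro sum_mono mult_mono)
    fix S assume S: "S \<in> P"
    then obtain Is where Is: "\<And>i. i < r \<Longrightarrow> Is i \<subseteq> V \<and> Q (Is i)" "\<And>i. i < r \<Longrightarrow> S i = g (Is i)"
      using PI by blast
    have "card (U S) \<le> (\<Sum>i<r. card (S i))" unfolding U_def by (intro card_UN_le) auto
    also have "\<dots> \<le> (\<Sum>i<r. \<sigma>)" using Is cont by (intro sum_mono) auto
    finally have cU: "card (U S) \<le> r * \<sigma>" by simp
    have "lam ^ (r * \<sigma>) \<le> lam ^ card (U S)" using lam cU by (intro power_decreasing) auto
    then have "1 \<le> (1 / lam) ^ (r * \<sigma>) * lam ^ card (U S)"
      using lam by (simp add: power_one_over field_simps)
    then have "q ^ card (U S) * 1 \<le> q ^ card (U S) * ((1 / lam) ^ (r * \<sigma>) * lam ^ card (U S))"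
      using q by (intro mult_left_mono) auto
    then show "q ^ card (U S) \<le> (1 / lam) ^ (r * \<sigma>) * (q * lam) ^ card (U S)"
      by (simp add: power_mult_distrib mult.left_commute)
    have "Out S = V - (\<Union>i<r. C (g (Is i)))" unfolding Out_def using Is(2) by auto
    then have co: "\<delta> * N \<le> real (card (Out S))" using out [of Is] Is(1) unfolding N_def by simp
    have "(1 - q) ^ card (Out S) \<le> exp (- q) ^ card (Out S)"
      using q exp_ge_add_one_self [of "- q"] by (intro power_mono) auto
    also have "\<dots> = exp (- (q * real (card (Out S))))" by (simp add: exp_of_nat_mult [symmetric] mult.commute)
    also have "\<dots> \<le> exp (- \<delta> * q * N)"
      using mult_left_mono [OF co q(1)] by (simp add: mult_ac)
    finally show "(1 - q) ^ card (Out S) \<le> exp (- \<delta> * q * N)" .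
  qed (use q lam in auto)
  also have "\<dots> = (1 / lam) ^ (r * \<sigma>) * exp (- \<delta> * q * N) * (\<Sum>S\<in>P. (q * lam) ^ card (U S))"
    unfolding sum_distrib_left by (intro sum.cong refl) (simp only: mult_ac)
  also have "\<dots> \<le> (1 / lam) ^ (r * \<sigma>) * exp (- \<delta> * q * N) * exp (\<delta> * q * N / 2)"
  proof (rule mult_left_mono)
    have "(\<Sum>S\<in>P. (q * lam) ^ card (U S)) \<le> (\<Sum>S\<in>PiE {..<r} (\<lambda>_. Pow V). (q * lam) ^ card (U S))"
      using finPV PV q lam by (intro sum_mono2) auto
    also have "\<dots> \<le> exp (2 ^ r * (q * lam) * N)"
      unfolding U_def N_def using q lam by (intro sum_PiE_Union_power V) auto
    also have "\<dots> \<le> exp (\<delta> * q * N / 2)"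
    proof -
      have "(2 ^ r * lam) * (q * N) \<le> \<delta> / 2 * (q * N)"
        using lam q unfolding N_def by (intro mult_right_mono) auto
      then show ?thesis by (simp add: mult_ac)
    qed
    finally show "(\<Sum>S\<in>P. (q * lam) ^ card (U S)) \<le> exp (\<delta> * q * N / 2)" .
  qed (use lam in auto)
  also have "\<dots> = exp (- \<delta> * q * N / 2) * (1 / lam) ^ (r * \<sigma>)"
  proof -
    have "exp (- \<delta> * q * N) * exp (\<delta> * q * N / 2) = exp (- \<delta> * q * N / 2)"
      by (simp add: exp_add [symmetric])
    then show ?thesis by (simp add: mult.assoc mult.commute)
  qed
  finally show ?thesis unfolding N_def .
qed

section \<open>Short cycles of cliques\<close>

definition edges_of :: "'a set list \<Rightarrow> 'a set set" where
  "edges_of Bs = (\<Union>B\<in>set Bs. nsets B 2)"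

text \<open>The head of the list is the last clique of the path. It meets the union of the others in two
  vertices of its predecessor, so that the union of a path is glued from cliques along single edges.\<close>

primrec clique_paths :: "'a set \<Rightarrow> nat \<Rightarrow> nat \<Rightarrow> 'a set list set" where
  "clique_paths A k 0 = (\<lambda>K. [K]) ` nsets A k"
| "clique_paths A k (Suc t) =
     {K # Bs | K Bs. Bs \<in> clique_paths A k t \<and> K \<in> nsets A k \<and> K \<inter> \<Union> (set Bs) \<in> nsets (hd Bs) 2}"

lemma edges_of_Cons: "edges_of (K # Bs) = nsets K 2 \<union> edges_of Bs"
  by (simp add: edges_of_def)

lemma edges_of_subset: "d \<in> edges_of Bs \<Longrightarrow> d \<subseteq> \<Union> (set Bs) \<and> card d = 2 \<and> finite d"
  unfolding edges_of_def nsets_def by auto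

lemma doubleton_edge: "{x, y} \<in> edges_of Bs \<Longrightarrow> x \<in> \<Union> (set Bs) \<and> y \<in> \<Union> (set Bs) \<and> x \<noteq> y"
  unfolding edges_of_def by (auto simp del: Union_iff)

lemma clique_paths_set:
  "Bs \<in> clique_paths A k t \<Longrightarrow> length Bs = Suc t \<and> set Bs \<subseteq> nsets A k"
proof (induction t arbitrary: Bs)
  case (Suc t)
  then obtain K Bs' where "Bs = K # Bs'" "Bs' \<in> clique_paths A k t" "K \<in> nsets A k" by auto
  then show ?case using Suc.IH [of Bs'] by simp
qed auto

lemma clique_paths_hd: "Bs \<in> clique_paths A k t \<Longrightarrow> hd Bs \<in> set Bs"
  using clique_paths_set [of Bs A k t] by (cases Bs) auto

lemma clique_paths_Union:
  assumes "Bs \<in> clique_paths A k t"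
  shows "finite (\<Union> (set Bs))" "card (\<Union> (set Bs)) \<le> Suc t * k" "\<Union> (set Bs) \<subseteq> A"
proof -
  note B = clique_paths_set [OF assms]
  have c: "finite K \<and> card K = k \<and> K \<subseteq> A" if "K \<in> set Bs" for K
    using B that unfolding nsets_def by blast
  show "finite (\<Union> (set Bs))" "\<Union> (set Bs) \<subseteq> A" using c by auto
  have "card (\<Union> (set Bs)) \<le> (\<Sum>K\<in>set Bs. card K)" by (rule card_Union_le_sum_card)
  also have "\<dots> = card (set Bs) * k" using c by simp
  also have "\<dots> \<le> Suc t * k" using B card_length [of Bs] by (intro mult_right_mono) auto
  finally show "card (\<Union> (set Bs)) \<le> Suc t * k" .
qed

lemma edges_of_finite: "Bs \<in> clique_paths A k t \<Longrightarrow> finite (edges_of Bs)"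
  using clique_paths_set [of Bs A k t] unfolding edges_of_def
  by (auto intro!: finite_imp_finite_nsets simp: nsets_def [of A])

text \<open>The new clique meets the old vertices in just two points, already joined in its
  predecessor. So gluing creates no new edge among old vertices.\<close>

lemma clique_paths_old_edge:
  assumes "Bs \<in> clique_paths A k t" "K \<inter> \<Union> (set Bs) \<in> nsets (hd Bs) 2"
    and "d \<in> nsets K 2" "d \<subseteq> \<Union> (set Bs)"
  shows "d = K \<inter> \<Union> (set Bs)" "d \<in> edges_of Bs"
proof -
  have d: "d \<subseteq> K \<inter> \<Union> (set Bs)" "card d = 2" using assms(3,4) unfolding nsets_def by auto
  have "finite (K \<inter> \<Union> (set Bs))" "card (K \<inter> \<Union> (set Bs)) = 2" using assms(2) unfolding nsets_def by auto
  then show *: "d = K \<inter> \<Union> (set Bs)" using d by (metis card_subset_eq)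
  show "d \<in> edges_of Bs" using clique_paths_hd [OF assms(1)] assms(2) * unfolding edges_of_def by blast
qed

text \<open>A vertex of \<open>L\<close> outside the earlier cliques has all its neighbours in the
  last clique, so \<open>L\<close> is that clique; otherwise \<open>L\<close> lives in the shorter
  path, which has the same edges on these vertices.\<close>

lemma clique_in_path:
  assumes "Bs \<in> clique_paths A k t" "L \<subseteq> \<Union> (set Bs)" "card L = k" "nsets L 2 \<subseteq> edges_of Bs"
  shows "L \<in> set Bs"
  using assms
proof (induction t arbitrary: Bs)
  case 0
  then obtain K where K: "Bs = [K]" "K \<in> nsets A k" by auto
  then have "L \<subseteq> K" "finite K" "card K = k" using 0 unfolding nsets_def by auto
  then show ?case using card_subset_eq [of K L] 0 K by simp
next
  case (Suc t)
  then obtain K Bs' where K: "Bs = K # Bs'" "Bs' \<in> clique_paths A k t" "K \<in> nsets A k"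
      "K \<inter> \<Union> (set Bs') \<in> nsets (hd Bs') 2" by auto
  have fK: "finite K" "card K = k" using K(3) unfolding nsets_def by auto
  show ?case
  proof (cases "L \<subseteq> \<Union> (set Bs')")
    case True
    have "nsets L 2 \<subseteq> edges_of Bs'"
    proof
      fix d assume d: "d \<in> nsets L 2"
      then have "d \<subseteq> \<Union> (set Bs')" using True unfolding nsets_def by blast
      moreover have "d \<in> nsets K 2 \<or> d \<in> edges_of Bs'" using d Suc.prems(4) K(1) edges_of_Cons by blast
      ultimately show "d \<in> edges_of Bs'" using clique_paths_old_edge(2) [OF K(2,4)] by blast
    qed
    then show ?thesis using Suc.IH [OF K(2) True Suc.prems(3)] K(1) by simp
  next
    case False
    then obtain x where x: "x \<in> L" "x \<notin> \<Union> (set Bs')" by blast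
    then have xK: "x \<in> K" using Suc.prems(2) K(1) by auto
    have "y \<in> K" if y: "y \<in> L" for y
    proof (cases "y = x")
      case False
      then have "{x, y} \<in> nsets L 2" using x y by simp
      then have "{x, y} \<in> nsets K 2 \<or> {x, y} \<in> edges_of Bs'" using Suc.prems(4) K(1) edges_of_Cons by blast
      then show ?thesis using x(2) doubleton_edge [of x y Bs'] by auto
    qed (use xK in simp)
    then have "L \<subseteq> K" by blast
    then show ?thesis using card_subset_eq [OF fK(1)] fK(2) Suc.prems(3) K(1) by simp
  qed
qed

lemma finite_common_neighbours:
  assumes "Bs \<in> clique_paths A k t"
  shows "finite {z. {x, z} \<in> edges_of Bs \<and> {y, z} \<in> edges_of Bs}"
proof (rule finite_subset [OF subsetI clique_paths_Union(1) [OF assms]])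
  fix z assume "z \<in> {z. {x, z} \<in> edges_of Bs \<and> {y, z} \<in> edges_of Bs}"
  then show "z \<in> \<Union> (set Bs)" using doubleton_edge [of x z Bs] by simp
qed

text \<open>If both vertices are old, the last clique cannot supply a common neighbour outside the
  old vertices, for it would contain both and make them adjacent. Otherwise they lie on different
  sides of the last gluing edge, and a common neighbour must be one of its two ends.\<close>

lemma common_neighbours:
  assumes "Bs \<in> clique_paths A k t" "x \<in> \<Union> (set Bs)" "y \<in> \<Union> (set Bs)" "x \<noteq> y" "{x, y} \<notin> edges_of Bs"
  shows "card {z. {x, z} \<in> edges_of Bs \<and> {y, z} \<in> edges_of Bs} \<le> 2"
  using assms
proof (induction t arbitrary: Bs)
  case 0
  then obtain K where K: "Bs = [K]" by auto
  then have "{x, y} \<in> edges_of Bs" using 0 by (simp add: edges_of_def)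
  then show ?case using 0 by simp
next
  case (Suc t)
  then obtain K Bs' where K: "Bs = K # Bs'" "Bs' \<in> clique_paths A k t" "K \<in> nsets A k"
      "K \<inter> \<Union> (set Bs') \<in> nsets (hd Bs') 2" by auto
  let ?U = "\<Union> (set Bs')"
  have E: "d \<in> edges_of Bs \<longleftrightarrow> d \<in> nsets K 2 \<or> d \<in> edges_of Bs'" for d
    using K(1) edges_of_Cons by blast
  have out: "z \<in> K \<and> x \<in> K" if "{x, z} \<in> edges_of Bs" "x \<notin> ?U \<or> z \<notin> ?U" for x z
    using that doubleton_edge [of x z Bs'] unfolding E by auto
  have inn: "z \<in> ?U \<and> x \<in> ?U" if "{x, z} \<in> edges_of Bs" "x \<notin> K \<or> z \<notin> K" for x z
    using that doubleton_edge [of x z Bs'] unfolding E by auto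
  have notK: "\<not> (x \<in> K \<and> y \<in> K)" using Suc.prems(4,5) unfolding E by auto
  have cut: "finite (K \<inter> ?U)" "card (K \<inter> ?U) = 2" using K(4) unfolding nsets_def by auto
  have xy: "x \<in> K \<union> ?U" "y \<in> K \<union> ?U" using Suc.prems(2,3) K(1) by auto
  show ?case
  proof (cases "x \<in> ?U \<and> y \<in> ?U")
    case True
    have "{z. {x, z} \<in> edges_of Bs \<and> {y, z} \<in> edges_of Bs} \<subseteq> {z. {x, z} \<in> edges_of Bs' \<and> {y, z} \<in> edges_of Bs'}"
    proof (rule subsetI)
      fix z assume "z \<in> {z. {x, z} \<in> edges_of Bs \<and> {y, z} \<in> edges_of Bs}"
      then have z: "{x, z} \<in> edges_of Bs" "{y, z} \<in> edges_of Bs" by auto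
      then have zU: "z \<in> ?U" using out notK by blast
      have "{x, z} \<in> edges_of Bs'" "{y, z} \<in> edges_of Bs'"
        using z zU True clique_paths_old_edge(2) [OF K(2,4)] unfolding E by blast+
      then show "z \<in> {z. {x, z} \<in> edges_of Bs' \<and> {y, z} \<in> edges_of Bs'}" by simp
    qed
    moreover have "finite {z. {x, z} \<in> edges_of Bs' \<and> {y, z} \<in> edges_of Bs'}"
      by (rule finite_common_neighbours [OF K(2)])
    ultimately have "card {z. {x, z} \<in> edges_of Bs \<and> {y, z} \<in> edges_of Bs}
        \<le> card {z. {x, z} \<in> edges_of Bs' \<and> {y, z} \<in> edges_of Bs'}" by (intro card_mono)
    also have "\<dots> \<le> 2" using Suc.IH [OF K(2)] True Suc.prems(4,5) unfolding E by blast
    finally show ?thesis .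
  next
    case False
    have "{z. {x, z} \<in> edges_of Bs \<and> {y, z} \<in> edges_of Bs} \<subseteq> K \<inter> ?U"
      using False notK xy out inn by blast
    then show ?thesis using cut card_mono by fastforce
  qed
qed

text \<open>Two non-adjacent vertices \<open>x\<close> and \<open>y\<close> of \<open>L\<close> are separated by the two ends of an edge, hence all but two
  of the other vertices of \<open>L\<close> miss one of the edges to \<open>x\<close> and \<open>y\<close>.\<close>

lemma missing_edges:
  assumes "Bs \<in> clique_paths A k t" "L \<subseteq> \<Union> (set Bs)" "card L = k" "L \<notin> set Bs"
  shows "max 1 (k - 3) \<le> card (nsets L 2 - edges_of Bs)"
proof -
  have fL: "finite L" using assms(2) clique_paths_Union(1) [OF assms(1)] finite_subset by blast
  have "\<not> nsets L 2 \<subseteq> edges_of Bs" using clique_in_path assms by blast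
  then obtain x y where xy: "x \<in> L" "y \<in> L" "x \<noteq> y" "{x, y} \<notin> edges_of Bs"
    by (auto simp: nsets_2_eq)
  define N where "N = {z. {x, z} \<in> edges_of Bs \<and> {y, z} \<in> edges_of Bs}"
  have N: "card N \<le> 2" unfolding N_def
    by (rule common_neighbours [OF assms(1)]) (use xy assms(2) in auto)
  have finN: "finite N" unfolding N_def
    by (rule finite_common_neighbours [OF assms(1)])
  define Z where "Z = L - {x, y} - N"
  \<comment> \<open>Every \<open>z \<in> Z\<close> is assigned a missing edge from \<open>z\<close>
    to \<open>x\<close> or \<open>y\<close>; the edge determines \<open>z\<close> because
    \<open>z\<close> is neither of them. With \<open>{x, y}\<close> this gives 1 + (k - 4) missing
    edges, and the truncated subtraction yields 1 when \<open>k = 3\<close>.\<close>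
  define h where "h = (\<lambda>z. if {x, z} \<in> edges_of Bs then {y, z} else {x, z})"
  have "card L - 2 \<le> card (L - {x, y})" using xy fL by (simp add: card_Diff_subset)
  then have "k - 4 \<le> card Z" using diff_card_le_card_Diff [OF finN, of "L - {x, y}"] N assms(3)
    unfolding Z_def by linarith
  have finZ: "finite Z" unfolding Z_def using fL by simp
  have inj: "inj_on h Z"
    by (rule inj_onI) (auto simp: h_def Z_def doubleton_eq_iff split: if_splits)
  have new: "{x, y} \<notin> h ` Z" unfolding h_def Z_def by (auto simp: doubleton_eq_iff split: if_splits)
  have "insert {x, y} (h ` Z) \<subseteq> nsets L 2 - edges_of Bs"
    using xy unfolding h_def Z_def N_def by auto
  moreover have "finite (nsets L 2 - edges_of Bs)" using fL by (simp add: finite_imp_finite_nsets)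
  ultimately have "card (insert {x, y} (h ` Z)) \<le> card (nsets L 2 - edges_of Bs)" by (rule card_mono [rotated])
  moreover have "card (insert {x, y} (h ` Z)) = Suc (card Z)"
    using new finZ inj by (simp add: card_image)
  ultimately show ?thesis using \<open>k - 4 \<le> card Z\<close> by linarith
qed

text \<open>\<open>Bs\<close> has \<open>t + 1\<close> cliques, so \<open>t + 3 \<le> g\<close> says
  that there are fewer than \<open>g\<close> cliques including \<open>K\<close>. An overlap in three
  vertices is forbidden, not just one in two edges: this is what forces consecutive cliques to be
  glued along exactly one edge in \<open>clique_pathI\<close>.\<close>

definition no_short_cycle :: "'a set \<Rightarrow> nat \<Rightarrow> nat \<Rightarrow> 'a set set \<Rightarrow> bool" where
  "no_short_cycle A k g E \<longleftrightarrow> (\<forall>t Bs K. t + 3 \<le> g \<and> Bs \<in> clique_paths A k t \<and> K \<in> nsets A k \<and>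
     K \<notin> set Bs \<and> 3 \<le> card (K \<inter> \<Union> (set Bs)) \<longrightarrow> \<not> edges_of (K # Bs) \<subseteq> E)"

section \<open>From short cycles to girth\<close>

definition share_edge :: "'a set \<Rightarrow> 'a set \<Rightarrow> bool" where
  "share_edge K L \<longleftrightarrow> nsets K 2 \<inter> nsets L 2 \<noteq> {}"

text \<open>Connectedness under sharing an edge, given by an order of insertion so that edges can be
  counted one clique at a time.\<close>

inductive edge_connected :: "'a set set \<Rightarrow> bool" where
  single: "edge_connected {K}"
| insert: "edge_connected S \<Longrightarrow> K \<notin> S \<Longrightarrow> B \<in> S \<Longrightarrow> share_edge K B \<Longrightarrow> edge_connected (insert K S)"

lemma share_edge_sym: "share_edge K L \<Longrightarrow> share_edge L K"
  unfolding share_edge_def by blast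

lemma edge_connected_path:
  assumes "edge_connected S" "A \<in> S" "B \<in> S"
  shows "\<exists>xs. xs \<noteq> [] \<and> hd xs = A \<and> last xs = B \<and> distinct xs \<and> set xs \<subseteq> S \<and> successively share_edge xs"
  using assms
proof (induction arbitrary: A B rule: edge_connected.induct)
  case (single K)
  then show ?case by (intro exI [of _ "[K]"]) auto
next
  case (insert S K C)
  consider "A = K" "B = K" | "A = K" "B \<in> S" | "A \<in> S" "B = K" | "A \<in> S" "B \<in> S"
    using insert.prems by blast
  then show ?case
  proof cases
    case 1
    then show ?thesis by (intro exI [of _ "[K]"]) auto
  next
    case 2
    obtain xs where xs: "xs \<noteq> []" "hd xs = C" "last xs = B" "distinct xs" "set xs \<subseteq> S" "successively share_edge xs"
      using insert.IH [OF insert.hyps(3) 2(2)] by blast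
    have "successively share_edge (K # xs)"
      using xs insert.hyps(4) by (cases xs) auto
    moreover have "distinct (K # xs)" using xs(4,5) insert.hyps(2) by auto
    ultimately show ?thesis using xs 2 by (intro exI [of _ "K # xs"]) auto
  next
    case 3
    obtain xs where xs: "xs \<noteq> []" "hd xs = A" "last xs = C" "distinct xs" "set xs \<subseteq> S" "successively share_edge xs"
      using insert.IH [OF 3(1) insert.hyps(3)] by blast
    have "successively share_edge (xs @ [K])"
      using xs share_edge_sym [OF insert.hyps(4)] by (simp add: successively_append_iff)
    moreover have "distinct (xs @ [K])" using xs(4,5) insert.hyps(2) by auto
    ultimately show ?thesis using xs 3 by (intro exI [of _ "xs @ [K]"]) auto
  next
    case 4
    then obtain xs where "xs \<noteq> []" "hd xs = A" "last xs = B" "distinct xs" "set xs \<subseteq> S" "successively share_edge xs"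
      using insert.IH [OF 4] by blast
    then show ?thesis by (intro exI [of _ xs]) auto
  qed
qed

lemma edge_connected_finite: "edge_connected S \<Longrightarrow> finite S"
  by (induction rule: edge_connected.induct) auto

text \<open>A clique shares an edge with its predecessor in the list; if it met the union of the
  others in a third vertex, the two together would form a short cycle. So the intersection is
  exactly that edge.\<close>

lemma clique_pathI:
  assumes "no_short_cycle A k g E" "t + 2 \<le> g" "distinct xs" "length xs = Suc t"
    and "set xs \<subseteq> {K \<in> nsets A k. nsets K 2 \<subseteq> E}" "successively share_edge xs"
  shows "xs \<in> clique_paths A k t"
  using assms(2-6)
proof (induction t arbitrary: xs)
  case 0
  then obtain K where "xs = [K]" by (auto simp: length_Suc_conv)
  then show ?case using 0 by simp
next
  case (Suc t)
  then obtain K Bs where xs: "xs = K # Bs" "length Bs = Suc t" by (auto simp: length_Suc_conv)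
  then have ne: "Bs \<noteq> []" by auto
  have suc: "successively share_edge Bs" "share_edge K (hd Bs)"
    using Suc.prems(5) xs ne by (cases Bs; simp)+
  have Bs: "Bs \<in> clique_paths A k t"
    using Suc.prems xs suc(1) by (intro Suc.IH) auto
  have K: "K \<in> nsets A k" "K \<notin> set Bs" using Suc.prems xs by auto
  have hdB: "hd Bs \<in> set Bs" using ne by simp
  have fin: "finite (K \<inter> \<Union> (set Bs))" using K(1) unfolding nsets_def by blast
  have "edges_of (K # Bs) \<subseteq> E" using Suc.prems(4) xs(1) unfolding edges_of_def by auto
  then have lt: "card (K \<inter> \<Union> (set Bs)) < 3"
  proof -
    have "t + 3 \<le> g" using Suc.prems(1) by linarith
    then show ?thesis using assms(1) Bs K \<open>edges_of (K # Bs) \<subseteq> E\<close> unfolding no_short_cycle_def not_le [symmetric] by blast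
  qed
  obtain e where e: "e \<in> nsets K 2" "e \<in> nsets (hd Bs) 2" using suc(2) unfolding share_edge_def by blast
  have sub: "e \<subseteq> K \<inter> \<Union> (set Bs)" using e hdB unfolding nsets_def by blast
  have "card e = 2" using e unfolding nsets_def by blast
  then have "e = K \<inter> \<Union> (set Bs)" using card_seteq [OF fin sub] lt by simp
  then have "K \<inter> \<Union> (set Bs) \<in> nsets (hd Bs) 2" using e(2) by simp
  then show ?case using Bs K(1) xs(1) by auto
qed

text \<open>It suffices that each inserted clique \<open>K\<close> shares only one edge with the
  union of the earlier ones. Two shared edges would lie in cliques \<open>A1\<close> and
  \<open>A2\<close> joined by a path inside \<open>S\<close>; two edges span at least three
  vertices, so \<open>K\<close> would close this path to a short cycle.\<close>

lemma edge_connected_edge_count: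
  assumes nsc: "no_short_cycle A k g E" and S: "edge_connected S" and g: "card S < g"
    and C: "S \<subseteq> {K \<in> nsets A k. nsets K 2 \<subseteq> E}" and k: "k \<ge> 2"
  shows "((k choose 2) - 1) * card S + 1 \<le> card (\<Union>K\<in>S. nsets K 2)"
  using S g C
proof (induction rule: edge_connected.induct)
  case (single K)
  then have "card K = k" unfolding nsets_def by auto
  moreover have "k choose 2 \<ge> 1" using k binomial_right_mono [of 2 k 2] by simp
  ultimately show ?case by simp
next
  case (insert S K B)
  have finS: "finite S" using insert.hyps(1) by (rule edge_connected_finite)
  then have cS: "card (insert K S) = Suc (card S)" using insert.hyps(2) by simp
  have KA: "K \<in> nsets A k" "finite K" "card K = k" "nsets K 2 \<subseteq> E"
    using insert.prems unfolding nsets_def by auto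
  have SC: "S \<subseteq> {K \<in> nsets A k. nsets K 2 \<subseteq> E}" using insert.prems by blast
  have IH: "((k choose 2) - 1) * card S + 1 \<le> card (\<Union>K\<in>S. nsets K 2)"
    using insert.IH insert.prems cS by simp
  have fin2: "finite (nsets K' 2)" if "K' \<in> S" for K'
    using that SC unfolding nsets_def [of A] by (auto intro: finite_imp_finite_nsets)
  have finE: "finite (\<Union>K\<in>S. nsets K 2)" using finS fin2 by blast
  have finK: "finite (nsets K 2)" using KA by (simp add: finite_imp_finite_nsets)
  have "card (nsets K 2 \<inter> (\<Union>K\<in>S. nsets K 2)) \<le> 1"
  proof (rule ccontr)
    assume "\<not> ?thesis"
    then obtain e1 e2 where e: "e1 \<in> nsets K 2" "e2 \<in> nsets K 2" "e1 \<noteq> e2"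
        "e1 \<in> (\<Union>K\<in>S. nsets K 2)" "e2 \<in> (\<Union>K\<in>S. nsets K 2)"
      using card_le_Suc0_iff_eq [of "nsets K 2 \<inter> (\<Union>K\<in>S. nsets K 2)"] finK by auto
    then obtain A1 A2 where A12: "A1 \<in> S" "e1 \<in> nsets A1 2" "A2 \<in> S" "e2 \<in> nsets A2 2" by blast
    obtain xs where xs: "xs \<noteq> []" "hd xs = A1" "last xs = A2" "distinct xs" "set xs \<subseteq> S" "successively share_edge xs"
      using edge_connected_path [OF insert.hyps(1) A12(1,3)] by blast
    obtain t where t: "length xs = Suc t" using xs(1) by (cases xs) auto
    have "length xs \<le> card S" using xs(4,5) finS by (metis card_mono distinct_card)
    \<comment> \<open>The path lies in \<open>S\<close>, which does not contain \<open>K\<close>, so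
      \<open>t + 1 \<le> card S\<close> and \<open>card S + 1 < g\<close>.\<close>
    then have tg: "t + 3 \<le> g" using t insert.prems(1) cS by linarith
    have P: "xs \<in> clique_paths A k t"
      using xs t tg SC by (intro clique_pathI [OF nsc]) auto
    have "A1 \<in> set xs" "A2 \<in> set xs" using xs(1-3) by auto
    then have sub: "e1 \<union> e2 \<subseteq> K \<inter> \<Union> (set xs)" using e A12 unfolding nsets_def by blast
    have c: "card e1 = 2" "card e2 = 2" "finite e1" "finite e2" using e(1,2) unfolding nsets_def by auto
    have "\<not> e2 \<subseteq> e1" using c e(3) by (metis card_subset_eq)
    then have "e1 \<subset> e1 \<union> e2" by blast
    then have "2 < card (e1 \<union> e2)" using c psubset_card_mono [of "e1 \<union> e2" e1] by simp
    also have "\<dots> \<le> card (K \<inter> \<Union> (set xs))" using sub KA(2) by (intro card_mono) auto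
    finally have "3 \<le> card (K \<inter> \<Union> (set xs))" by simp
    moreover have "edges_of (K # xs) \<subseteq> E" using KA(4) SC xs(5) unfolding edges_of_def by auto
    moreover have "K \<notin> set xs" using xs(5) insert.hyps(2) by blast
    ultimately show False using nsc tg P KA(1) unfolding no_short_cycle_def by blast
  qed
  moreover have "card (nsets K 2 \<union> (\<Union>K\<in>S. nsets K 2)) + card (nsets K 2 \<inter> (\<Union>K\<in>S. nsets K 2)) =
      (k choose 2) + card (\<Union>K\<in>S. nsets K 2)"
    using card_Un_Int [OF finK finE] KA(3) by simp
  moreover have "k choose 2 \<ge> 1" using k binomial_right_mono [of 2 k 2] by simp
  ultimately have "(k choose 2) - 1 + card (\<Union>K\<in>S. nsets K 2) \<le> card (nsets K 2 \<union> (\<Union>K\<in>S. nsets K 2))"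
    by linarith
  then have "(k choose 2) - 1 + (((k choose 2) - 1) * card S + 1) \<le> card (nsets K 2 \<union> (\<Union>K\<in>S. nsets K 2))"
    using IH by linarith
  then show ?case unfolding cS by simp
qed

text \<open>A maximal connected part shares no edge with the remaining cliques, so the edge counts
  add up, and each component contributes its own surplus of 1.\<close>

lemma clique_edge_count:
  assumes nsc: "no_short_cycle A k g E" and k: "k \<ge> 2"
    and "finite S" "S \<noteq> {}" "card S < g" "S \<subseteq> {K \<in> nsets A k. nsets K 2 \<subseteq> E}"
  shows "((k choose 2) - 1) * card S + 1 \<le> card (\<Union>K\<in>S. nsets K 2)"
  using assms(3-6)
proof (induction S rule: finite_psubset_induct)
  case (psubset S)
  define F where "F = {T. T \<subseteq> S \<and> edge_connected T}"
  obtain K0 where "K0 \<in> S" using psubset.prems(1) by blast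
  then have "{K0} \<in> F" unfolding F_def using edge_connected.single by blast
  moreover have "finite F" unfolding F_def using psubset.hyps by simp
  ultimately obtain T where T: "T \<in> F" "{K0} \<subseteq> T" "\<forall>T'\<in>F. T \<subseteq> T' \<longrightarrow> T = T'"
    using finite_has_maximal2 [of F "{K0}"] by blast
  have TS: "T \<subseteq> S" "edge_connected T" using T(1) unfolding F_def by auto
  have finT: "finite T" "card T \<le> card S" using TS psubset.hyps by (auto intro: finite_subset card_mono)
  have cT: "((k choose 2) - 1) * card T + 1 \<le> card (\<Union>K\<in>T. nsets K 2)"
    using edge_connected_edge_count [OF nsc TS(2) _ _ k] finT psubset.prems TS(1) by auto
  show ?case
  proof (cases "T = S")
    case True
    then show ?thesis using cT by simp
  next
    case False
    define T' where "T' = S - T"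
    have T': "T' \<subset> S" "T' \<noteq> {}" using False TS(1) T(2) unfolding T'_def by auto
    have finT': "finite T'" using psubset.hyps unfolding T'_def by simp
    have cS: "card S = card T + card T'" using TS(1) finT psubset.hyps unfolding T'_def
      by (simp add: card_Diff_subset)
    have fin2: "finite (nsets K' 2)" if "K' \<in> S" for K'
      using that psubset.prems(3) unfolding nsets_def [of A] by (auto intro: finite_imp_finite_nsets)
    have disj: "(\<Union>K\<in>T. nsets K 2) \<inter> (\<Union>K\<in>T'. nsets K 2) = {}"
    proof (rule ccontr)
      assume "\<not> ?thesis"
      then obtain K B where KB: "K \<in> T'" "B \<in> T" "share_edge K B" unfolding share_edge_def by blast
      then have "edge_connected (insert K T)"
        using TS(2) unfolding T'_def by (intro edge_connected.insert [of T K B]) auto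
      then have "insert K T \<in> F" using KB(1) TS(1) unfolding F_def T'_def by blast
      then have "T = insert K T" using T(3) by blast
      then show False using KB(1) unfolding T'_def by blast
    qed
    have "card T' < g" using psubset.prems(2) cS by linarith
    then have c': "((k choose 2) - 1) * card T' + 1 \<le> card (\<Union>K\<in>T'. nsets K 2)"
      using psubset.IH [OF T'(1)] T' psubset.prems(3) by blast
    have U: "(\<Union>K\<in>S. nsets K 2) = (\<Union>K\<in>T. nsets K 2) \<union> (\<Union>K\<in>T'. nsets K 2)" using TS(1) unfolding T'_def by blast
    have cU: "card ((\<Union>K\<in>T. nsets K 2) \<union> (\<Union>K\<in>T'. nsets K 2)) =
        card (\<Union>K\<in>T. nsets K 2) + card (\<Union>K\<in>T'. nsets K 2)"
    proof (rule card_Un_disjoint [OF _ _ disj])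
      show "finite (\<Union>K\<in>T. nsets K 2)" using finT(1) fin2 TS(1) by blast
      show "finite (\<Union>K\<in>T'. nsets K 2)" using finT' fin2 T'(1) by blast
    qed
    show ?thesis unfolding U cU cS distrib_left using cT c' by linarith
  qed
qed

lemma clique_iff_nsets: "clique K E \<longleftrightarrow> nsets K 2 \<subseteq> E"
  by (auto simp: clique_def nsets_2_eq)

lemma no_short_cycle_girth:
  assumes "no_short_cycle A k g E" "k \<ge> 2"
  shows "girth_at_least (k choose 2) (clique_hypergraph A E k) g"
  unfolding girth_at_least_def
proof (intro allI impI)
  fix h T
  assume h: "2 \<le> h \<and> h < g" and T: "T \<subseteq> snd (clique_hypergraph A E k) \<and> card T = h"
  have "T \<subseteq> (\<lambda>K. nsets K 2) ` {K \<in> nsets A k. nsets K 2 \<subseteq> E}"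
    using T unfolding clique_hypergraph_def clique_iff_nsets snd_conv by blast
  \<comment> \<open>One clique per hyperedge, so that \<open>S\<close> has exactly \<open>h\<close>
    elements.\<close>
  then obtain S where S: "S \<subseteq> {K \<in> nsets A k. nsets K 2 \<subseteq> E}" "inj_on (\<lambda>K. nsets K 2) S" "T = (\<lambda>K. nsets K 2) ` S"
    unfolding subset_image_inj by (elim exE conjE)
  have cS: "card S = h" using S(3) T card_image [OF S(2)] by simp
  have "finite S" by (rule ccontr) (use cS h in simp)
  moreover have "S \<noteq> {}" using cS h by auto
  ultimately have "((k choose 2) - 1) * card S + 1 \<le> card (\<Union>K\<in>S. nsets K 2)"
    using S(1) cS h by (intro clique_edge_count [OF assms]) auto
  then show "((k choose 2) - 1) * h + 1 \<le> card (\<Union> T)" using cS S(3) by simp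
qed

section \<open>The expected number of short cycles\<close>

text \<open>Edge sets instead of lists, because \<open>harris_avoid\<close> deals with events of the
  form that \<open>F\<close> is not contained in the random set. A set arising from several lists is
  counted once, so summing over lists gives an upper bound.\<close>

definition short_cycles :: "'a set \<Rightarrow> nat \<Rightarrow> nat \<Rightarrow> 'a set set set" where
  "short_cycles A k g = {edges_of (K # Bs) | K Bs t. t + 3 \<le> g \<and> Bs \<in> clique_paths A k t \<and>
     K \<in> nsets A k \<and> K \<notin> set Bs \<and> 3 \<le> card (K \<inter> \<Union> (set Bs))}"

lemma no_short_cycle_iff: "no_short_cycle A k g E \<longleftrightarrow> (\<forall>F\<in>short_cycles A k g. \<not> F \<subseteq> E)"
  unfolding no_short_cycle_def short_cycles_def by blast

section \<open>Counting paths and the cliques that close them\<close>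

lemma card_supersets_le_power:
  assumes "finite A" "S \<subseteq> A"
  shows "card {Y \<in> nsets A m. S \<subseteq> Y} \<le> card A ^ (m - card S)"
proof -
  have "card {Y \<in> nsets A m. S \<subseteq> Y} \<le> (card A - card S) choose (m - card S)"
    by (rule card_supersets_le [OF assms])
  also have "\<dots> \<le> (card A - card S) ^ (m - card S)" by (rule binomial_le_power)
  also have "\<dots> \<le> card A ^ (m - card S)" by (intro power_mono) auto
  finally show ?thesis .
qed

lemma finite_clique_paths: "finite A \<Longrightarrow> finite (clique_paths A k t)"
proof (rule finite_subset)
  assume A: "finite A"
  show "clique_paths A k t \<subseteq> {xs. set xs \<subseteq> nsets A k \<and> length xs = Suc t}"
    using clique_paths_set by blast
  show "finite {xs. set xs \<subseteq> nsets A k \<and> length xs = Suc t}"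
    using A by (intro finite_lists_length_eq finite_imp_finite_nsets)
qed

lemma card_edges_of_Cons:
  assumes "Bs \<in> clique_paths A k t" "finite K"
  shows "card (edges_of (K # Bs)) = card (edges_of Bs) + card (nsets K 2 - edges_of Bs)"
proof -
  have fin: "finite (nsets K 2 - edges_of Bs)" using assms(2) by (simp add: finite_imp_finite_nsets)
  have "edges_of (K # Bs) = edges_of Bs \<union> (nsets K 2 - edges_of Bs)" by (auto simp: edges_of_Cons)
  also have "card \<dots> = card (edges_of Bs) + card (nsets K 2 - edges_of Bs)"
    by (rule card_Un_disjoint [OF edges_of_finite [OF assms(1)] fin]) blast
  finally show ?thesis .
qed

text \<open>There are at most \<open>k ^ 2\<close> edges of the last clique to glue along and
  \<open>n ^ (k - 2)\<close> ways to complete the new clique, all of whose edges but one are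
  new.\<close>

lemma clique_path_step_sum:
  fixes q :: real
  assumes A: "finite A" "card A = n" and q: "0 \<le> q" "q \<le> 1" and Bs: "Bs \<in> clique_paths A k t"
  shows "(\<Sum>K\<in>{K \<in> nsets A k. K \<inter> \<Union> (set Bs) \<in> nsets (hd Bs) 2}. q ^ card (edges_of (K # Bs)))
    \<le> q ^ card (edges_of Bs) * (real k ^ 2 * (real n ^ (k - 2) * q ^ ((k choose 2) - 1)))"
proof -
  define X where "X = {K \<in> nsets A k. K \<inter> \<Union> (set Bs) \<in> nsets (hd Bs) 2}"
  have hd: "hd Bs \<in> nsets A k" using clique_paths_hd [OF Bs] clique_paths_set [OF Bs] by blast
  have hdk: "finite (hd Bs)" "card (hd Bs) = k" "hd Bs \<subseteq> A" using hd unfolding nsets_def by auto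
  have fin2: "finite (nsets (hd Bs) 2)" using hdk(1) by (rule finite_imp_finite_nsets)
  have "X \<subseteq> (\<Union>e\<in>nsets (hd Bs) 2. {K \<in> nsets A k. e \<subseteq> K})" unfolding X_def by blast
  then have "card X \<le> card (\<Union>e\<in>nsets (hd Bs) 2. {K \<in> nsets A k. e \<subseteq> K})"
    using A(1) fin2 by (intro card_mono) (auto simp: finite_imp_finite_nsets)
  also have "\<dots> \<le> (\<Sum>e\<in>nsets (hd Bs) 2. card {K \<in> nsets A k. e \<subseteq> K})"
    by (rule card_UN_le [OF fin2])
  also have "\<dots> \<le> (\<Sum>e\<in>nsets (hd Bs) 2. n ^ (k - 2))"
  proof (rule sum_mono)
    fix e assume "e \<in> nsets (hd Bs) 2"
    then have "e \<subseteq> A" "card e = 2" using hdk(3) unfolding nsets_def by auto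
    then show "card {K \<in> nsets A k. e \<subseteq> K} \<le> n ^ (k - 2)"
      using card_supersets_le_power [OF A(1), of e k] A(2) by simp
  qed
  also have "\<dots> = (k choose 2) * n ^ (k - 2)" using hdk by simp
  also have "\<dots> \<le> k ^ 2 * n ^ (k - 2)" by (intro mult_right_mono binomial_le_power) simp
  finally have "real (card X) \<le> real (k ^ 2 * n ^ (k - 2))" by (simp only: of_nat_le_iff)
  then have cX: "real (card X) \<le> real k ^ 2 * real n ^ (k - 2)" by simp
  have "(\<Sum>K\<in>X. q ^ card (edges_of (K # Bs))) \<le> (\<Sum>K\<in>X. q ^ card (edges_of Bs) * q ^ ((k choose 2) - 1))"
  proof (rule sum_mono)
    fix K assume K: "K \<in> X"
    then have fK: "finite K" "card K = k" "K \<inter> \<Union> (set Bs) \<in> nsets (hd Bs) 2"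
      unfolding X_def nsets_def [of A] by auto
    have "nsets K 2 \<inter> edges_of Bs \<subseteq> {K \<inter> \<Union> (set Bs)}"
      using clique_paths_old_edge(1) [OF Bs fK(3)] edges_of_subset by blast
    then have "card (nsets K 2 \<inter> edges_of Bs) \<le> card {K \<inter> \<Union> (set Bs)}" by (intro card_mono) auto
    moreover have "card (nsets K 2 - edges_of Bs) = card (nsets K 2) - card (nsets K 2 \<inter> edges_of Bs)"
      using fK(1) by (intro card_Diff_subset_Int) (simp add: finite_imp_finite_nsets)
    ultimately have "(k choose 2) - 1 \<le> card (nsets K 2 - edges_of Bs)" using fK(2) by simp
    then have "card (edges_of Bs) + ((k choose 2) - 1) \<le> card (edges_of (K # Bs))"
      using card_edges_of_Cons [OF Bs fK(1)] by simp
    then have "q ^ card (edges_of (K # Bs)) \<le> q ^ (card (edges_of Bs) + ((k choose 2) - 1))"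
      using q by (intro power_decreasing)
    then show "q ^ card (edges_of (K # Bs)) \<le> q ^ card (edges_of Bs) * q ^ ((k choose 2) - 1)"
      by (simp only: power_add)
  qed
  also have "\<dots> = real (card X) * (q ^ card (edges_of Bs) * q ^ ((k choose 2) - 1))" by simp
  also have "\<dots> \<le> real k ^ 2 * real n ^ (k - 2) * (q ^ card (edges_of Bs) * q ^ ((k choose 2) - 1))"
    using cX q by (intro mult_right_mono) auto
  finally show ?thesis unfolding X_def by (simp only: ac_simps)
qed

lemma clique_path_sum:
  fixes q :: real
  assumes A: "finite A" "card A = n" and q: "0 \<le> q" "q \<le> 1"
  shows "(\<Sum>Bs\<in>clique_paths A k t. q ^ card (edges_of Bs)) \<le>
    real n ^ k * q ^ (k choose 2) * (real k ^ 2 * (real n ^ (k - 2) * q ^ ((k choose 2) - 1))) ^ t"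
proof (induction t)
  case 0
  have "(\<Sum>Bs\<in>clique_paths A k 0. q ^ card (edges_of Bs)) = (\<Sum>K\<in>nsets A k. q ^ card (edges_of [K]))"
    unfolding clique_paths.simps by (subst sum.reindex) (auto simp: inj_on_def)
  also have "\<dots> = (\<Sum>K\<in>nsets A k. q ^ (k choose 2))"
    by (intro sum.cong refl) (simp add: edges_of_def nsets_def [of A])
  also have "\<dots> = real (n choose k) * q ^ (k choose 2)" using A by simp
  also have "\<dots> \<le> real n ^ k * q ^ (k choose 2)"
    using binomial_le_power [of n k] q by (intro mult_right_mono) (auto simp flip: of_nat_power)
  finally show ?case by simp
next
  case (Suc t)
  let ?Y = "real k ^ 2 * (real n ^ (k - 2) * q ^ ((k choose 2) - 1))"
  let ?X = "\<lambda>Bs. {K \<in> nsets A k. K \<inter> \<Union> (set Bs) \<in> nsets (hd Bs) 2}"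
  let ?S = "Sigma (clique_paths A k t) ?X"
  have finS: "finite ?S"
    using finite_clique_paths [OF A(1)] A(1) by (intro finite_SigmaI) (auto simp: finite_imp_finite_nsets)
  have img: "clique_paths A k (Suc t) = (\<lambda>(Bs, K). K # Bs) ` ?S" by (auto simp: image_iff)
  have "(\<Sum>Bs\<in>clique_paths A k (Suc t). q ^ card (edges_of Bs)) \<le>
      (\<Sum>p\<in>?S. ((\<lambda>Bs. q ^ card (edges_of Bs)) \<circ> (\<lambda>(Bs, K). K # Bs)) p)"
    unfolding img using q by (intro sum_image_le finS) auto
  also have "\<dots> = (\<Sum>Bs\<in>clique_paths A k t. \<Sum>K\<in>?X Bs. q ^ card (edges_of (K # Bs)))"
    using finite_clique_paths [OF A(1)] A(1)
    by (subst sum.Sigma) (auto simp: comp_def split_def finite_imp_finite_nsets)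
  also have "\<dots> \<le> (\<Sum>Bs\<in>clique_paths A k t. q ^ card (edges_of Bs) * ?Y)"
    by (intro sum_mono clique_path_step_sum [OF A q])
  also have "\<dots> = (\<Sum>Bs\<in>clique_paths A k t. q ^ card (edges_of Bs)) * ?Y"
    by (simp only: sum_distrib_right)
  also have "\<dots> \<le> real n ^ k * q ^ (k choose 2) * ?Y ^ t * ?Y"
    using Suc q by (intro mult_right_mono) auto
  finally show ?case by (simp only: power_Suc2 mult.assoc)
qed

text \<open>The closing cliques are grouped by their intersection \<open>W\<close> with the path. If
  \<open>W\<close> has \<open>v < k\<close> points, there are at most \<open>n ^ (k - v)\<close>
  cliques, and only edges inside \<open>W\<close> can be old. If \<open>v = k\<close>, the only
  candidate is \<open>W\<close> itself, and \<open>missing_edges\<close> provides the new edges. The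
  number of choices for \<open>W\<close> is the polynomial factor.\<close>

lemma closing_clique_sum:
  fixes q \<Gamma> :: real
  assumes A: "finite A" "card A = n" and q: "0 \<le> q" "q \<le> 1" and k: "k \<ge> 3"
    and Bs: "Bs \<in> clique_paths A k t"
    and \<Gamma>: "\<And>v. 3 \<le> v \<Longrightarrow> v < k \<Longrightarrow> real n ^ (k - v) * q ^ ((k choose 2) - (v choose 2)) \<le> \<Gamma>"
      "q ^ max 1 (k - 3) \<le> \<Gamma>"
  shows "(\<Sum>K\<in>{K \<in> nsets A k. K \<notin> set Bs \<and> 3 \<le> card (K \<inter> \<Union> (set Bs))}. q ^ card (edges_of (K # Bs)))
    \<le> q ^ card (edges_of Bs) * (real k * real (Suc t * k) ^ k * \<Gamma>)"
proof -
  let ?U = "\<Union> (set Bs)"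
  define X where "X = {K \<in> nsets A k. K \<notin> set Bs \<and> 3 \<le> card (K \<inter> ?U)}"
  define WW where "WW = (\<Union>v\<in>{3..k}. nsets ?U v)"
  have U: "finite ?U" "card ?U \<le> Suc t * k" "?U \<subseteq> A" using clique_paths_Union [OF Bs] by auto
  have XK: "finite K" "card K = k" "K \<subseteq> A" "K \<notin> set Bs" "3 \<le> card (K \<inter> ?U)" if "K \<in> X" for K
    using that unfolding X_def nsets_def [of A] by auto
  have finX: "finite X" unfolding X_def using A(1) by (simp add: finite_imp_finite_nsets)
  have finW: "finite WW" unfolding WW_def using U(1) by (simp add: finite_imp_finite_nsets)
  have q0: "0 \<le> q ^ max 1 (k - 3)" using q by simp
  then have \<Gamma>0: "0 \<le> \<Gamma>" using \<Gamma>(2) by linarith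
  have imW: "(\<lambda>K. K \<inter> ?U) ` X \<subseteq> WW"
  proof (rule image_subsetI)
    fix K assume K: "K \<in> X"
    have "card (K \<inter> ?U) \<le> k" using card_mono [OF XK(1) [OF K], of "K \<inter> ?U"] XK(2) [OF K] by simp
    moreover have "K \<inter> ?U \<in> nsets ?U (card (K \<inter> ?U))" using U(1) unfolding nsets_def by blast
    ultimately show "K \<inter> ?U \<in> WW" unfolding WW_def using XK(5) [OF K] by auto
  qed
  have part: "(\<Sum>K\<in>{K \<in> X. K \<inter> ?U = W}. q ^ card (nsets K 2 - edges_of Bs)) \<le> \<Gamma>" if W: "W \<in> WW" for W
  proof -
    obtain v where v: "3 \<le> v" "v \<le> k" "W \<subseteq> ?U" "finite W" "card W = v"
      using W unfolding WW_def nsets_def by auto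
    show ?thesis
    proof (cases "v = k")
      case True
      have "{K \<in> X. K \<inter> ?U = W} \<subseteq> {W}"
      proof
        fix K assume K: "K \<in> {K \<in> X. K \<inter> ?U = W}"
        then have "W \<subseteq> K" by auto
        then show "K \<in> {W}" using XK(1,2) [of K] K v(5) True card_subset_eq [of K W] by auto
      qed
      then have "(\<Sum>K\<in>{K \<in> X. K \<inter> ?U = W}. q ^ card (nsets K 2 - edges_of Bs))
          \<le> (\<Sum>K\<in>{K \<in> X. K \<inter> ?U = W}. q ^ max 1 (k - 3))"
      proof (intro sum_mono power_decreasing)
        fix K assume K: "K \<in> {K \<in> X. K \<inter> ?U = W}"
        then have "K = W" using \<open>{K \<in> X. K \<inter> ?U = W} \<subseteq> {W}\<close> by blast
        then have "K \<subseteq> ?U" using v(3) by simp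
        then show "max 1 (k - 3) \<le> card (nsets K 2 - edges_of Bs)"
          using missing_edges [OF Bs] XK(2,4) [of K] K by blast
      qed (use q in auto)
      also have "\<dots> \<le> (\<Sum>K\<in>{W}. q ^ max 1 (k - 3))"
        using \<open>{K \<in> X. K \<inter> ?U = W} \<subseteq> {W}\<close> q0 by (intro sum_mono2) auto
      also have "\<dots> \<le> \<Gamma>" using \<Gamma>(2) by simp
      finally show ?thesis .
    next
      case False
      then have vk: "v < k" using v by simp
      have "(\<Sum>K\<in>{K \<in> X. K \<inter> ?U = W}. q ^ card (nsets K 2 - edges_of Bs))
          \<le> (\<Sum>K\<in>{K \<in> X. K \<inter> ?U = W}. q ^ ((k choose 2) - (v choose 2)))"
      proof (intro sum_mono power_decreasing)
        fix K assume K: "K \<in> {K \<in> X. K \<inter> ?U = W}"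
        have "nsets K 2 \<inter> edges_of Bs \<subseteq> nsets W 2"
        proof
          fix d assume d: "d \<in> nsets K 2 \<inter> edges_of Bs"
          then have "d \<subseteq> ?U" using edges_of_subset by blast
          then show "d \<in> nsets W 2" using d K unfolding nsets_def by blast
        qed
        then have "card (nsets K 2 \<inter> edges_of Bs) \<le> card (nsets W 2)"
          using v(4) by (intro card_mono) (auto simp: finite_imp_finite_nsets)
        moreover have "card (nsets K 2 - edges_of Bs) = card (nsets K 2) - card (nsets K 2 \<inter> edges_of Bs)"
          using XK(1) [of K] K by (intro card_Diff_subset_Int) (simp add: finite_imp_finite_nsets)
        ultimately show "(k choose 2) - (v choose 2) \<le> card (nsets K 2 - edges_of Bs)"
          using XK(2) [of K] K v(5) by simp
      qed (use q in auto)
      also have "\<dots> = real (card {K \<in> X. K \<inter> ?U = W}) * q ^ ((k choose 2) - (v choose 2))" by simp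
      also have "\<dots> \<le> real n ^ (k - v) * q ^ ((k choose 2) - (v choose 2))"
      proof (rule mult_right_mono)
        have "card {K \<in> X. K \<inter> ?U = W} \<le> card {K \<in> nsets A k. W \<subseteq> K}"
          using A(1) by (intro card_mono) (auto simp: X_def finite_imp_finite_nsets)
        also have "\<dots> \<le> n ^ (k - v)"
          using card_supersets_le_power [OF A(1), of W k] A(2) v(3,5) U(3) by auto
        finally show "real (card {K \<in> X. K \<inter> ?U = W}) \<le> real n ^ (k - v)"
          unfolding of_nat_power [symmetric] of_nat_le_iff .
      qed (use q in auto)
      also have "\<dots> \<le> \<Gamma>" using \<Gamma>(1) v(1) vk by blast
      finally show ?thesis .
    qed
  qed
  have cW: "real (card WW) \<le> real k * real (Suc t * k) ^ k"
  proof -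
    have "card WW \<le> (\<Sum>v\<in>{3..k}. card (nsets ?U v))" unfolding WW_def by (intro card_UN_le) auto
    also have "\<dots> \<le> (\<Sum>v\<in>{3..k}. (Suc t * k) ^ k)"
    proof (rule sum_mono)
      fix v assume v: "v \<in> {3..k}"
      have "card (nsets ?U v) \<le> card ?U ^ v" using binomial_le_power by simp
      also have "\<dots> \<le> (Suc t * k) ^ v" using U(2) by (intro power_mono) auto
      also have "\<dots> \<le> (Suc t * k) ^ k" using v k by (intro power_increasing) auto
      finally show "card (nsets ?U v) \<le> (Suc t * k) ^ k" .
    qed
    also have "\<dots> \<le> k * (Suc t * k) ^ k" by simp
    finally have "real (card WW) \<le> real (k * (Suc t * k) ^ k)" by (simp only: of_nat_le_iff)
    then show ?thesis by (simp only: of_nat_mult of_nat_power)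
  qed
  have "(\<Sum>K\<in>X. q ^ card (edges_of (K # Bs))) = q ^ card (edges_of Bs) * (\<Sum>K\<in>X. q ^ card (nsets K 2 - edges_of Bs))"
    unfolding sum_distrib_left
    by (intro sum.cong refl) (simp add: card_edges_of_Cons [OF Bs XK(1)] power_add)
  also have "(\<Sum>K\<in>X. q ^ card (nsets K 2 - edges_of Bs)) =
      (\<Sum>W\<in>WW. \<Sum>K\<in>{K \<in> X. K \<inter> ?U = W}. q ^ card (nsets K 2 - edges_of Bs))"
    using sum.group [OF finX finW imW, of "\<lambda>K. q ^ card (nsets K 2 - edges_of Bs)"] by simp
  also have "\<dots> \<le> (\<Sum>W\<in>WW. \<Gamma>)" by (intro sum_mono part)
  also have "\<dots> = real (card WW) * \<Gamma>" by simp
  also have "\<dots> \<le> real k * real (Suc t * k) ^ k * \<Gamma>" using cW \<Gamma>0 by (rule mult_right_mono)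
  finally show ?thesis using q unfolding X_def by (simp add: mult_left_mono)
qed

lemma short_cycles_sum:
  fixes q \<Gamma> :: real
  assumes A: "finite A" "card A = n" and q: "0 \<le> q" "q \<le> 1" and k: "k \<ge> 3"
    and \<Gamma>: "\<And>v. 3 \<le> v \<Longrightarrow> v < k \<Longrightarrow> real n ^ (k - v) * q ^ ((k choose 2) - (v choose 2)) \<le> \<Gamma>"
      "q ^ max 1 (k - 3) \<le> \<Gamma>"
  shows "finite (short_cycles A k g)"
    "(\<Sum>F\<in>short_cycles A k g. q ^ card F) \<le>
      (\<Sum>t<g - 2. real n ^ k * q ^ (k choose 2) * (real k ^ 2 * (real n ^ (k - 2) * q ^ ((k choose 2) - 1))) ^ t
        * (real k * real (g * k) ^ k * \<Gamma>))"
proof -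
  define X where "X = (\<lambda>Bs. {K \<in> nsets A k. K \<notin> set Bs \<and> 3 \<le> card (K \<inter> \<Union> (set Bs))})"
  define S where "S = (\<lambda>t. Sigma (clique_paths A k t) X)"
  have finX: "finite (X Bs)" for Bs unfolding X_def using A(1) by (simp add: finite_imp_finite_nsets)
  have finP: "finite (clique_paths A k t)" for t by (rule finite_clique_paths [OF A(1)])
  have finS: "finite (Sigma {..<g - 2} S)" unfolding S_def using finX finP by (intro finite_SigmaI) auto
  have img: "short_cycles A k g = (\<lambda>(t, Bs, K). edges_of (K # Bs)) ` Sigma {..<g - 2} S"
  proof (intro set_eqI iffI)
    fix F assume "F \<in> short_cycles A k g"
    then obtain K Bs t where F: "F = edges_of (K # Bs)" "t + 3 \<le> g" "Bs \<in> clique_paths A k t" "K \<in> X Bs"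
      unfolding short_cycles_def X_def by blast
    then have "(t, Bs, K) \<in> Sigma {..<g - 2} S" unfolding S_def by auto
    then show "F \<in> (\<lambda>(t, Bs, K). edges_of (K # Bs)) ` Sigma {..<g - 2} S" using F(1) by force
  next
    fix F assume "F \<in> (\<lambda>(t, Bs, K). edges_of (K # Bs)) ` Sigma {..<g - 2} S"
    then obtain t Bs K where F: "F = edges_of (K # Bs)" "t < g - 2" "Bs \<in> clique_paths A k t" "K \<in> X Bs"
      unfolding S_def by auto
    then have "t + 3 \<le> g" by linarith
    then show "F \<in> short_cycles A k g" using F unfolding short_cycles_def X_def by blast
  qed
  show "finite (short_cycles A k g)" unfolding img using finS by (rule finite_imageI)
  have \<Gamma>0: "0 \<le> \<Gamma>" using \<Gamma>(2) q by (meson order_trans zero_le_power)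
  have "(\<Sum>F\<in>short_cycles A k g. q ^ card F) \<le>
      (\<Sum>p\<in>Sigma {..<g - 2} S. ((\<lambda>F. q ^ card F) \<circ> (\<lambda>(t, Bs, K). edges_of (K # Bs))) p)"
    unfolding img using q by (intro sum_image_le finS) auto
  also have "\<dots> = (\<Sum>t<g - 2. \<Sum>Bs\<in>clique_paths A k t. \<Sum>K\<in>X Bs. q ^ card (edges_of (K # Bs)))"
    using finX finP unfolding S_def by (simp add: sum.Sigma comp_def split_def)
  also have "\<dots> \<le> (\<Sum>t<g - 2. \<Sum>Bs\<in>clique_paths A k t. q ^ card (edges_of Bs) * (real k * real (g * k) ^ k * \<Gamma>))"
  proof (intro sum_mono)
    fix t Bs assume t: "t \<in> {..<g - 2}" and Bs: "Bs \<in> clique_paths A k t"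
    have "(\<Sum>K\<in>X Bs. q ^ card (edges_of (K # Bs))) \<le> q ^ card (edges_of Bs) * (real k * real (Suc t * k) ^ k * \<Gamma>)"
      unfolding X_def by (rule closing_clique_sum [OF A q k Bs \<Gamma>])
    also have "\<dots> \<le> q ^ card (edges_of Bs) * (real k * real (g * k) ^ k * \<Gamma>)"
    proof (intro mult_left_mono mult_right_mono power_mono)
      have "Suc t * k \<le> g * k" using t by (intro mult_right_mono) auto
      then show "real (Suc t * k) \<le> real (g * k)" by (simp only: of_nat_le_iff)
    qed (use q \<Gamma>0 in auto)
    finally show "(\<Sum>K\<in>X Bs. q ^ card (edges_of (K # Bs))) \<le> q ^ card (edges_of Bs) * (real k * real (g * k) ^ k * \<Gamma>)" .
  qed
  also have "\<dots> = (\<Sum>t<g - 2. (\<Sum>Bs\<in>clique_paths A k t. q ^ card (edges_of Bs)) * (real k * real (g * k) ^ k * \<Gamma>))"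
    by (simp only: sum_distrib_right)
  also have "\<dots> \<le> (\<Sum>t<g - 2. real n ^ k * q ^ (k choose 2) * (real k ^ 2 * (real n ^ (k - 2) * q ^ ((k choose 2) - 1))) ^ t
        * (real k * real (g * k) ^ k * \<Gamma>))"
    using \<Gamma>0 by (intro sum_mono mult_right_mono clique_path_sum [OF A q]) auto
  finally show "(\<Sum>F\<in>short_cycles A k g. q ^ card F) \<le>
      (\<Sum>t<g - 2. real n ^ k * q ^ (k choose 2) * (real k ^ 2 * (real n ^ (k - 2) * q ^ ((k choose 2) - 1))) ^ t
        * (real k * real (g * k) ^ k * \<Gamma>))" .
qed

section \<open>Choice of the parameters\<close>

locale parameters =
  fixes k g r :: nat
  assumes k: "k \<ge> 3" and g: "g \<ge> 3" and r: "r \<ge> 2"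
begin

definition "R = ramsey_number k r"
definition "l = k choose 2"
definition "m = real (k * R)"
text \<open>The exponent is set by \<open>short_cycles_numeric\<close>: the paths there cost about
  m^(5 g k^2), and the closing clique gains \<open>B ^ x\<close> with x at least k/4.\<close>

definition "B = m ^ (30 * g * k)"
text \<open>An exact power, so that \<open>n = B ^ (k + 1)\<close> and all later estimates compare
  integer powers of \<open>B\<close> and \<open>m\<close>.\<close>

definition "n = (k * R) ^ (30 * g * k * (k + 1))"
text \<open>Chosen to make the container parameter \<open>4 * l / p\<close> equal to
  \<open>B ^ 2 / m ^ 3\<close>; its power \<open>l - 1\<close> then balances
  \<open>n ^ (k - 2) = B ^ (2 * (l - 1))\<close>.\<close>

definition "p = 4 * real l * m ^ 3 / B ^ 2"
text \<open>Seven more powers of \<open>m\<close> than the explicit \<open>m ^ 3\<close> in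
  \<open>p\<close>; \<open>entropy_numeric\<close> uses them.\<close>

definition "q = m ^ 10 / B ^ 2"
text \<open>The number of edges guaranteed by \<open>missing_edges\<close>, and also a lower bound
  for the power of \<open>B\<close> gained by a closing clique with new vertices.\<close>

definition "x = max 1 (k - 3)"

lemma R: "k \<le> R" "r < R"
  using ramsey_number_ge [of r k] ramsey_number_gt_colours [OF k, of r] r unfolding R_def by auto

lemma m: "m \<ge> 9"
proof -
  have "3 * 3 \<le> k * R" using k R(1) by (intro mult_mono) auto
  then have "real 9 \<le> real (k * R)" by (intro of_nat_mono) simp
  then show ?thesis unfolding m_def by simp
qed

lemma m_ge: "real k \<le> m" "real R \<le> m"
  using k R unfolding m_def by (auto simp: le_numeral_extra)

lemma m_eq: "m = real k * real R"
  unfolding m_def by simp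

lemma n_eq: "real n = B ^ (k + 1)"
  unfolding n_def B_def m_def by (simp only: of_nat_power power_mult)

lemma B_ge: "j \<le> 30 * g * k \<Longrightarrow> m ^ j \<le> B"
  unfolding B_def using m by (intro power_increasing) auto

lemma gk: "g * k \<ge> 9" "g * k \<ge> k" "g * k \<ge> g"
  using mult_mono [of 3 g 3 k] g k by auto

lemma B_ge1: "B \<ge> 1"
  unfolding B_def using m by simp

lemma l_eq: "2 * l = k * (k - 1)"
  unfolding l_def by (rule two_choose_two)

lemma l_ge: "l \<ge> 3"
  using binomial_right_mono [OF k, of 2] unfolding l_def by (simp add: choose_two)

lemma l_eq': "2 * (l - 1) = (k + 1) * (k - 2)"
  using choose_two_diff [of k] k unfolding l_def by simp

lemma l_le: "2 * real l \<le> real k ^ 2"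
proof -
  have "2 * l \<le> k ^ 2" unfolding l_eq power2_eq_square by (intro mult_left_mono) auto
  then have "real (2 * l) \<le> real (k ^ 2)" by (simp only: of_nat_le_iff)
  then show ?thesis by simp
qed

lemma m_mult_le: "0 \<le> a \<Longrightarrow> a \<le> m ^ i \<Longrightarrow> 0 \<le> b \<Longrightarrow> b \<le> m ^ j \<Longrightarrow> a * b \<le> m ^ (i + j)"
  using m unfolding power_add by (intro mult_mono) auto

lemma pq: "0 < p" "p \<le> 1 / 2" "0 < q" "q \<le> 1 / 2"
proof -
  have B2: "m ^ 20 \<le> B ^ 2"
  proof -
    have "m ^ 10 \<le> B" using gk by (intro B_ge) linarith
    then have "(m ^ 10) ^ 2 \<le> B ^ 2" using m by (intro power_mono) auto
    then show ?thesis by (simp flip: power_mult)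
  qed
  have Bp: "B ^ 2 > 0" using B_ge1 by simp
  show "0 < p" "0 < q" using m l_ge Bp unfolding p_def q_def by auto
  have "8 * real l \<le> m ^ 3"
  proof -
    have "8 * real l \<le> 4 * real k ^ 2" using l_le by simp
    also have "\<dots> \<le> m * m ^ 2" using m m_ge(1) by (intro mult_mono power_mono) auto
    finally show ?thesis by (simp add: power2_eq_square power3_eq_cube)
  qed
  then have "8 * real l * m ^ 3 \<le> m ^ (3 + 3)" using m by (intro m_mult_le) auto
  also have "\<dots> \<le> m ^ 20" using m by (intro power_increasing) auto
  finally show "p \<le> 1 / 2" using B2 Bp unfolding p_def by (simp add: field_simps)
  have "2 * m ^ 10 \<le> m ^ (1 + 10)" using m by (intro m_mult_le) auto
  also have "\<dots> \<le> m ^ 20" using m by (intro power_increasing) auto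
  finally show "q \<le> 1 / 2" using B2 Bp unfolding q_def by (simp add: field_simps)
qed

text \<open>Only \<open>v = k\<close>, \<open>j = l\<close> is tight; it determines the factor \<open>m ^ 3\<close> in \<open>p\<close>.\<close>

lemma codegree_numeric:
  assumes j: "2 \<le> j" "j \<le> l" "j \<le> v choose 2" and v: "3 \<le> v" "v \<le> k"
  shows "real n ^ 2 * (4 * real l / p) ^ (j - 1) * real n ^ (k - v) \<le> real n ^ k / m ^ (k + 2)"
proof -
  have lp: "4 * real l / p = B ^ 2 / m ^ 3"
    using l_ge m B_ge1 unfolding p_def by (simp add: field_simps)
  have "B ^ (2 * (j - 1)) * m ^ (k + 2) \<le> B ^ ((k + 1) * (v - 2)) * m ^ (3 * (j - 1))"
  \<comment> \<open>As soon as the exponents of \<open>B\<close> differ, one spare factor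
    \<open>B\<close> exceeds \<open>m ^ (k + 2)\<close>. Equality forces \<open>v = k\<close> and
    \<open>j = l\<close>.\<close>
  proof (cases "2 * (j - 1) + 1 \<le> (k + 1) * (v - 2)")
    case True
    have "m ^ (k + 2) \<le> B" using gk k by (intro B_ge) linarith
    then have "B ^ (2 * (j - 1)) * m ^ (k + 2) \<le> B ^ (2 * (j - 1)) * B"
      using B_ge1 by (intro mult_left_mono) auto
    also have "\<dots> = B ^ (2 * (j - 1) + 1)" by simp
    also have "\<dots> \<le> B ^ ((k + 1) * (v - 2)) * 1"
      using True B_ge1 by (simp only: mult_1_right power_increasing)
    also have "\<dots> \<le> B ^ ((k + 1) * (v - 2)) * m ^ (3 * (j - 1))"
      using B_ge1 m by (intro mult_left_mono) auto
    finally show ?thesis .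
  next
    case False
    have "2 * (j - 1) \<le> (v + 1) * (v - 2)" using choose_two_diff [of v] j(3) v(1) by linarith
    have vk: "v = k"
    proof (rule ccontr)
      assume "v \<noteq> k"
      then have "(v + 1) * (v - 2) \<le> k * (v - 2)" using v by (intro mult_right_mono) auto
      moreover have "(k + 1) * (v - 2) = k * (v - 2) + (v - 2)" by simp
      ultimately show False using False \<open>2 * (j - 1) \<le> (v + 1) * (v - 2)\<close> v(1) by linarith
    qed
    have jl: "j = l"
    proof (rule ccontr)
      assume "j \<noteq> l"
      then have "2 * (j - 1) + 1 \<le> 2 * (l - 1)" using j by linarith
      then show False using False vk l_eq' by simp
    qed
    have "k + 2 \<le> 3 * (l - 1)"
    proof -
      have "(k + 1) * 1 \<le> (k + 1) * (k - 2)" using k by (intro mult_left_mono) auto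
      then have "k + 1 \<le> 2 * (l - 1)" unfolding l_eq' by simp
      then show ?thesis using k by linarith
    qed
    then have "m ^ (k + 2) \<le> m ^ (3 * (j - 1))" unfolding jl using m by (intro power_increasing) auto
    moreover have "2 * (j - 1) = (k + 1) * (v - 2)" unfolding jl vk by (rule l_eq')
    ultimately show ?thesis using B_ge1 by (simp add: mult_left_mono)
  qed
  then have "(B ^ 2 / m ^ 3) ^ (j - 1) * m ^ (k + 2) \<le> B ^ ((k + 1) * (v - 2))"
    using m by (simp add: power_divide power_mult [symmetric] field_simps)
  then have "(4 * real l / p) ^ (j - 1) * m ^ (k + 2) \<le> real n ^ (v - 2)"
    unfolding lp n_eq power_mult [symmetric] .
  then have "(real n ^ 2 * real n ^ (k - v)) * ((4 * real l / p) ^ (j - 1) * m ^ (k + 2))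
      \<le> (real n ^ 2 * real n ^ (k - v)) * real n ^ (v - 2)" by (intro mult_left_mono) auto
  also have "\<dots> = real n ^ k"
  proof -
    have "2 + (k - v) + (v - 2) = k" using v by linarith
    then show ?thesis by (metis power_add)
  qed
  finally show ?thesis using m by (simp add: field_simps)
qed

text \<open>The hypothesis \<open>few\<close> of \<open>supersaturation\<close> for \<open>r\<close>
  containers: \<open>m ^ k\<close> cancels \<open>k ^ k * R ^ k\<close>, and the two further powers
  of \<open>m\<close> absorb \<open>2 * r * l\<close>.\<close>

lemma cliques_numeric:
  "2 * (real r * (real l * (real n ^ k / m ^ (k + 2)))) * real R ^ k \<le> (real n / real k) ^ k"
proof -
  have Rk: "real R > 0" "real k > 0" using k R by auto
  have "2 * real r * real l \<le> real R * real k ^ 2"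
    using mult_mono [of "real r" "real R" "2 * real l" "real k ^ 2"] R(2) l_le by (simp add: mult_ac)
  also have "\<dots> \<le> m ^ 2"
    using Rk R k unfolding m_eq power_mult_distrib power2_eq_square [of "real R"]
    by (simp add: mult.commute)
  finally have le: "2 * real r * real l / m ^ 2 \<le> 1" using m by simp
  have "2 * (real r * (real l * (real n ^ k / m ^ (k + 2)))) * real R ^ k
      = (real n / real k) ^ k * (2 * real r * real l / m ^ 2)"
    using Rk unfolding m_eq by (simp add: field_simps power_add power_mult_distrib power2_eq_square)
  also have "\<dots> \<le> (real n / real k) ^ k * 1" using le by (intro mult_left_mono) auto
  finally show ?thesis by simp
qed

text \<open>The left side bounds the logarithm of the cost of \<open>r\<close> fingerprints at
  \<open>3 * R\<close> per point. The right side is half of the exponent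
  \<open>\<delta> * q * N / 2\<close> with \<open>\<delta> = 1 / R ^ 2\<close>.\<close>

lemma entropy_numeric:
  assumes "0 \<le> N"
  shows "3 * real R * (real r * (16 * real l * p * N)) \<le> q * N / (4 * real R ^ 2)"
proof -
  have Rp: "real R > 0" using k R by simp
  have "192 * real R ^ 4 * real l * (4 * real l) \<le> 192 * m ^ 4"
  proof -
    have "(2 * real l) ^ 2 \<le> (real k ^ 2) ^ 2" using l_le by (intro power_mono) auto
    then have "4 * real l ^ 2 \<le> real k ^ 4" by (simp add: power_mult_distrib flip: power_mult)
    then have "192 * real R ^ 4 * (4 * real l ^ 2) \<le> 192 * real R ^ 4 * real k ^ 4"
      by (intro mult_left_mono) auto
    then show ?thesis unfolding m_eq by (simp add: power_mult_distrib power2_eq_square mult_ac)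
  qed
  also have "\<dots> \<le> m ^ (3 + 4)"
  proof (rule m_mult_le)
    have "(9::real) ^ 3 \<le> m ^ 3" using m by (intro power_mono) auto
    then show "192 \<le> m ^ 3" by simp
  qed (use m in auto)
  finally have "192 * real R ^ 4 * real l * (4 * real l) * m ^ 3 \<le> m ^ 7 * m ^ 3"
    using m by (intro mult_right_mono) auto
  then have "192 * real R ^ 4 * real l * (4 * real l * m ^ 3) / B ^ 2 \<le> m ^ 10 / B ^ 2"
    using B_ge1 by (intro divide_right_mono) (auto simp flip: power_add)
  then have "192 * real R ^ 4 * real l * p \<le> q" unfolding p_def q_def by simp
  then have "192 * real R ^ 4 * real l * p * N \<le> q * N" using assms by (rule mult_right_mono)
  then have *: "48 * real R ^ 2 * real l * p * N \<le> q * N / (4 * real R ^ 2)"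
    using Rp by (simp add: field_simps power4_eq_xxxx power2_eq_square)
  have "3 * real R * (real r * (16 * real l * p * N)) = real r * (48 * real R * real l * p * N)" by simp
  also have "\<dots> \<le> real R * (48 * real R * real l * p * N)"
    using R(2) pq assms by (intro mult_right_mono) auto
  also have "\<dots> = 48 * real R ^ 2 * real l * p * N" by (simp add: power2_eq_square)
  finally show ?thesis using * by linarith
qed

lemma colour_base_numeric: "2 ^ (r + 1) * real R ^ 2 \<le> exp (3 * real R)"
proof -
  have "(2::real) ^ (r + 1) \<le> exp 1 ^ (r + 1)"
    using exp_ge_add_one_self [of 1] by (intro power_mono) auto
  also have "\<dots> \<le> exp 1 ^ R" using R(2) by (intro power_increasing) auto
  also have "\<dots> = exp (real R)" by (simp add: exp_of_nat_mult [symmetric])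
  finally have 1: "(2::real) ^ (r + 1) \<le> exp (real R)" .
  have "real R \<le> exp (real R)" using exp_ge_add_one_self [of "real R"] by linarith
  then have 2: "real R ^ 2 \<le> exp (real R) ^ 2" by (intro power_mono) auto
  have "2 ^ (r + 1) * real R ^ 2 \<le> exp (real R) * exp (real R) ^ 2"
    using 1 2 by (intro mult_mono) auto
  also have "\<dots> = exp (3 * real R)"
    by (simp add: power2_eq_square exp_add [symmetric])
  finally show ?thesis .
qed

definition "\<Gamma> = m ^ (10 * l) / B ^ x"

text \<open>Since 2 * ((k choose 2) - (v choose 2)) = (k-v)(k+v-1), the power of \<open>B\<close> in
  the denominator exceeds that in \<open>n ^ (k - v)\<close> by (k-v)(v-2), which is at least k-3
  for 3 <= v <= k-1, with equality at both ends.\<close>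

lemma closing_numeric:
  assumes "3 \<le> v" "v < k"
  shows "real n ^ (k - v) * q ^ ((k choose 2) - (v choose 2)) \<le> \<Gamma>"
proof -
  define a where "a = (k choose 2) - (v choose 2)"
  obtain u where u: "v = u + 3" using le_Suc_ex [OF assms(1)] by (auto simp: add.commute)
  obtain d where d: "k = u + 3 + Suc d" using less_imp_Suc_add [OF assms(2)] unfolding u by auto
  have "k * (k - 1) = (k - v) * (k + v - 1) + v * (v - 1)"
    unfolding d u by (simp add: algebra_simps)
  then have a2: "2 * a = (k - v) * (k + v - 1)"
    unfolding a_def diff_mult_distrib2 two_choose_two by simp
  have x: "x = u + Suc d" using d unfolding x_def by simp
  have "(k + 1) * (k - v) + x \<le> 2 * a"
    unfolding a2 x unfolding d u by (simp add: algebra_simps)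
  then have "B ^ ((k + 1) * (k - v) + x) \<le> B ^ (2 * a)" using B_ge1 by (intro power_increasing)
  moreover have "m ^ (10 * a) \<le> m ^ (10 * l)" using m unfolding a_def l_def by (intro power_increasing) auto
  ultimately have "B ^ ((k + 1) * (k - v) + x) * m ^ (10 * a) \<le> B ^ (2 * a) * m ^ (10 * l)"
    using m B_ge1 by (intro mult_mono) auto
  then have "B ^ ((k + 1) * (k - v)) * m ^ (10 * a) / B ^ (2 * a) \<le> m ^ (10 * l) / B ^ x"
    using B_ge1 by (simp add: field_simps power_add)
  then show ?thesis
    unfolding \<Gamma>_def n_eq q_def a_def [symmetric] power_divide power_mult [symmetric] by simp
qed

lemma x_le: "x \<le> l" "k \<le> 4 * x"
proof -
  have "2 * k \<le> k * (k - 1)" using k by simp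
  then have "k \<le> l" using l_eq by linarith
  then show "x \<le> l" "k \<le> 4 * x" using k unfolding x_def by auto
qed

lemma closing_numeric': "q ^ max 1 (k - 3) \<le> \<Gamma>"
proof -
  have "m ^ (10 * x) \<le> m ^ (10 * l)" using m x_le(1) by (intro power_increasing) auto
  moreover have "B ^ x \<le> B ^ (2 * x)" using B_ge1 by (intro power_increasing) auto
  ultimately have "m ^ (10 * x) / B ^ (2 * x) \<le> m ^ (10 * l) / B ^ x"
    using m B_ge1 by (intro frac_le) auto
  then show ?thesis unfolding \<Gamma>_def q_def x_def [symmetric] power_divide power_mult [symmetric] .
qed

text \<open>By \<open>nq\<close> the first clique counts like one glued to an arbitrary edge, which
  brings out the factor \<open>q * n ^ 2\<close> of the right side. What remains are fewer than
  \<open>g\<close> factors \<open>Y\<close>, polynomial factors and \<open>\<Gamma>\<close>, whose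
  denominator \<open>B ^ x\<close> outweighs them.\<close>

lemma short_cycles_numeric:
  "(\<Sum>t<g - 2. real n ^ k * q ^ (k choose 2) * (real k ^ 2 * (real n ^ (k - 2) * q ^ ((k choose 2) - 1))) ^ t
        * (real k * real (g * k) ^ k * \<Gamma>)) * (32 * real R ^ 2) < q * real n ^ 2"
proof -
  define Y where "Y = m ^ (10 * (l - 1))"
  have Y: "real n ^ (k - 2) * q ^ (l - 1) = Y"
    unfolding n_eq q_def Y_def power_divide power_mult [symmetric] l_eq' using B_ge1 by simp
  have Y1: "Y \<ge> 1" unfolding Y_def using m by simp
  have nq: "real n ^ k * q ^ l = real n ^ 2 * q * Y"
  proof -
    have "real n ^ k = real n ^ 2 * real n ^ (k - 2)"
    proof -
      have "k = 2 + (k - 2)" using k by linarith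
      then show ?thesis by (metis power_add)
    qed
    moreover have "q ^ l = q * q ^ (l - 1)" using l_ge by (simp flip: power_Suc)
    ultimately show ?thesis unfolding Y [symmetric] by simp
  qed
  define Z where "Z = real k ^ 2 * Y"
  have k1: "1 \<le> real k ^ 2" using k by simp
  have Z1: "Z \<ge> 1" "Y \<le> Z" using mult_mono [OF k1 Y1] mult_right_mono [OF k1, of Y] Y1 unfolding Z_def by auto
  define W where "W = real k * real (g * k) ^ k * \<Gamma>"
  have \<Gamma>0: "\<Gamma> \<ge> 0" unfolding \<Gamma>_def using m B_ge1 by simp
  have W0: "W \<ge> 0" unfolding W_def using \<Gamma>0 by simp
  have "(\<Sum>t<g - 2. real n ^ 2 * q * Y * Z ^ t * W) \<le> (\<Sum>t<g - 2. real n ^ 2 * q * Z ^ g * W)"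
  proof (intro sum_mono mult_right_mono [OF _ W0])
    fix t assume t: "t \<in> {..<g - 2}"
    have "Y * Z ^ t \<le> Z * Z ^ t" using Z1 by (intro mult_right_mono) auto
    also have "\<dots> = Z ^ Suc t" by simp
    also have "\<dots> \<le> Z ^ (g - 2)" using t Z1 by (intro power_increasing) auto
    finally have "Y * Z ^ t \<le> Z ^ (g - 2)" .
    also have "\<dots> \<le> Z ^ g" using Z1 by (intro power_increasing) auto
    finally have "real n ^ 2 * q * (Y * Z ^ t) \<le> real n ^ 2 * q * Z ^ g"
      using pq by (intro mult_left_mono) auto
    then show "real n ^ 2 * q * Y * Z ^ t \<le> real n ^ 2 * q * Z ^ g" by (simp only: mult.assoc)
  qed
  then have "(\<Sum>t<g - 2. real n ^ 2 * q * Y * Z ^ t * W) \<le> real (g - 2) * (real n ^ 2 * q * Z ^ g * W)"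
    by simp
  also have "\<dots> \<le> real g * (real n ^ 2 * q * Z ^ g * W)"
    using pq Z1 W0 by (intro mult_right_mono) auto
  finally have sum: "(\<Sum>t<g - 2. real n ^ 2 * q * Y * Z ^ t * W) \<le> real g * (real n ^ 2 * q * Z ^ g * W)" .
  \<comment> \<open>The exponents of \<open>m\<close> that bound, in this order, 32 R^2 k, g^(k+1)
    (through g <= m^g), k^k, k^(2g), Y^g and the numerator of \<open>\<Gamma>\<close>.\<close>
  define T where "T = (2 + 2) + g * (k + 1) + k + 2 * g + 10 * (l - 1) * g + 10 * l"
  have T: "T \<le> 30 * g * k * x"
  proof -
    \<comment> \<open>The shift removes the truncated subtractions, leaving polynomials that can be
      compared coefficient by coefficient.\<close>
    define a b where "a = k - 2" and "b = g - 3"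
    then have ab: "k = a + 2" "g = b + 3" using k g by linarith+
    have "4 * T = 16 + 4 * g * (k + 1) + 4 * k + 8 * g + 20 * (2 * (l - 1)) * g + 20 * (2 * l)"
      unfolding T_def by (simp add: algebra_simps)
    also have "\<dots> = 16 + 4 * g * (k + 1) + 4 * k + 8 * g + 20 * ((k + 1) * (k - 2)) * g + 20 * (k * (k - 1))"
      unfolding l_eq l_eq' ..
    also have "\<dots> \<le> 30 * g * k * k" unfolding ab by (simp add: algebra_simps)
    also have "\<dots> \<le> 30 * g * k * (4 * x)" using x_le(2) by (intro mult_left_mono) auto
    finally show ?thesis by simp
  qed
  have g_le: "real g \<le> m ^ g"
  proof -
    have "real g \<le> 2 ^ g" using of_nat_less_two_power [of g] by (simp add: less_imp_le)
    also have "\<dots> \<le> m ^ g" using m by (intro power_mono) auto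
    finally show ?thesis .
  qed
  have pos: "m ^ j > 0" for j using m by simp
  have "real g * Z ^ g * (real k * real (g * k) ^ k * m ^ (10 * l)) * (32 * real R ^ 2)
      = (32 * (real R ^ 2 * real k)) * real g ^ (k + 1) * real k ^ k * (real k ^ 2) ^ g * Y ^ g * m ^ (10 * l)"
    unfolding Z_def by (simp add: power_mult_distrib mult_ac)
  also have "\<dots> < m ^ (2 + 2) * m ^ (g * (k + 1)) * m ^ k * m ^ (2 * g) * m ^ (10 * (l - 1) * g) * m ^ (10 * l)"
  proof -
    have "32 < m ^ 2" using power_mono [of 9 m 2] m by simp
    moreover have "real R ^ 2 * real k \<le> m ^ 2"
    proof -
      have "real R ^ 2 * real k \<le> real R ^ 2 * real k ^ 2" using k by (intro mult_left_mono) (auto simp: power2_eq_square)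
      then show ?thesis unfolding m_eq by (simp add: power_mult_distrib mult.commute)
    qed
    moreover have "0 < real R ^ 2 * real k" using k R by simp
    ultimately have 1: "32 * (real R ^ 2 * real k) < m ^ (2 + 2)"
      unfolding power_add by (intro mult_less_le_imp_less) auto
    have 2: "real g ^ (k + 1) \<le> m ^ (g * (k + 1))"
      unfolding power_mult using g_le by (intro power_mono) auto
    have 3: "real k ^ k \<le> m ^ k" using m_ge by (intro power_mono) auto
    have 4: "(real k ^ 2) ^ g \<le> m ^ (2 * g)"
      unfolding power_mult using m_ge by (intro power_mono) auto
    have 5: "Y ^ g = m ^ (10 * (l - 1) * g)" unfolding Y_def power_mult ..
    have kg: "0 < real k" "0 < real g" using k g by auto
    have a: "32 * (real R ^ 2 * real k) * real g ^ (k + 1) < m ^ (2 + 2) * m ^ (g * (k + 1))"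
      using 1 2 kg by (intro mult_less_le_imp_less) auto
    have b: "32 * (real R ^ 2 * real k) * real g ^ (k + 1) * real k ^ k < m ^ (2 + 2) * m ^ (g * (k + 1)) * m ^ k"
      by (rule mult_less_le_imp_less [OF a 3]) (use kg in auto)
    have c: "32 * (real R ^ 2 * real k) * real g ^ (k + 1) * real k ^ k * (real k ^ 2) ^ g
        < m ^ (2 + 2) * m ^ (g * (k + 1)) * m ^ k * m ^ (2 * g)"
      by (rule mult_less_le_imp_less [OF b 4]) (use kg in auto)
    show ?thesis unfolding 5
      by (intro mult_strict_right_mono c pos)
  qed
  also have "\<dots> = m ^ T" unfolding T_def power_add [symmetric] ..
  also have "\<dots> \<le> m ^ (30 * g * k * x)" using T m by (intro power_increasing) auto
  also have "\<dots> = B ^ x" unfolding B_def power_mult ..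
  finally have "real g * Z ^ g * (real k * real (g * k) ^ k * m ^ (10 * l)) * (32 * real R ^ 2) < B ^ x" .
  then have "real g * Z ^ g * (real k * real (g * k) ^ k * m ^ (10 * l)) * (32 * real R ^ 2) / B ^ x < 1"
    using B_ge1 by simp
  also have "real g * Z ^ g * (real k * real (g * k) ^ k * m ^ (10 * l)) * (32 * real R ^ 2) / B ^ x
      = real g * Z ^ g * W * (32 * real R ^ 2)"
    unfolding W_def \<Gamma>_def by simp
  finally have lt: "real g * Z ^ g * W * (32 * real R ^ 2) < 1" .
  have npos: "q * real n ^ 2 > 0" using pq B_ge1 unfolding n_eq by simp
  have "(\<Sum>t<g - 2. real n ^ 2 * q * Y * Z ^ t * W) * (32 * real R ^ 2)
      \<le> real g * (real n ^ 2 * q * Z ^ g * W) * (32 * real R ^ 2)"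
    using sum by (intro mult_right_mono) auto
  also have "\<dots> = (real g * Z ^ g * W * (32 * real R ^ 2)) * (q * real n ^ 2)" by (simp only: mult_ac)
  also have "\<dots> < 1 * (q * real n ^ 2)" using lt npos by (rule mult_strict_right_mono)
  finally show ?thesis
    using Y nq unfolding l_def Z_def W_def by simp
qed

text \<open>\<open>30 * (k + 1) \<le> 40 * k\<close>, with equality at \<open>k = 3\<close>, carries
  the 30 in the exponent of \<open>B\<close> over to 40.\<close>

lemma card_numeric: "n \<le> k ^ (40 * g * k ^ 4) * ramsey_number k r ^ (40 * g * k ^ 2)"
proof -
  have R1: "R \<ge> 1" "k \<ge> 1" using k R by auto
  have "30 * (k + 1) \<le> 40 * k" using k by presburger
  then have "g * k * (30 * (k + 1)) \<le> g * k * (40 * k)" by (rule mult_left_mono) simp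
  then have e: "30 * g * k * (k + 1) \<le> 40 * g * k ^ 2" by (simp add: power2_eq_square mult_ac)
  have "k ^ 2 \<le> k ^ 4" using R1 by (intro power_increasing) auto
  then have e': "40 * g * k ^ 2 \<le> 40 * g * k ^ 4" by simp
  have "n \<le> (k * R) ^ (40 * g * k ^ 2)"
    unfolding n_def using R1 by (intro power_increasing [OF e]) simp
  also have "\<dots> = k ^ (40 * g * k ^ 2) * R ^ (40 * g * k ^ 2)" by (rule power_mult_distrib)
  also have "\<dots> \<le> k ^ (40 * g * k ^ 4) * R ^ (40 * g * k ^ 2)"
    using R1 by (intro mult_right_mono power_increasing [OF e']) auto
  finally show ?thesis unfolding R_def .
qed

end

section \<open>The random graph\<close>

context parameters
begin

definition "A = {..<n}"
definition "V = nsets A 2"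
definition "cliques = (\<lambda>K. nsets K 2) ` nsets A k"
definition "clique_free I \<longleftrightarrow> (\<forall>E\<in>cliques. \<not> E \<subseteq> I)"
text \<open>The edge sets with an \<open>r\<close>-colouring free of monochromatic cliques; the
  colour classes may overlap, which suits the union of containers.\<close>

definition "covered X \<longleftrightarrow> (\<exists>Is. (\<forall>i<r. Is i \<subseteq> V \<and> clique_free (Is i)) \<and> X = (\<Union>i<r. Is i))"

lemma A: "finite A" "card A = n"
  unfolding A_def by auto

lemma V: "finite V" "card V = n choose 2"
  unfolding V_def using A by (auto simp: finite_imp_finite_nsets)

lemma n_ge: "R \<le> n" "k \<le> n" "2 \<le> n"
proof -
  have kR: "1 \<le> k" "1 \<le> R" using k R by auto
  have n: "(k * R) ^ 1 \<le> n" unfolding n_def using kR gk k g by (intro power_increasing) auto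
  have "R \<le> k * R" "k \<le> k * R" using kR by auto
  then show "R \<le> n" "k \<le> n" using n unfolding power_one_right by linarith+
  then show "2 \<le> n" using k by linarith
qed

lemma inj_cliques: "inj_on (\<lambda>K. nsets K 2) (nsets A k)"
proof (rule inj_on_inverseI [of _ Union])
  fix K assume "K \<in> nsets A k"
  then have "card K \<ge> 2" using k unfolding nsets_def by auto
  then show "\<Union> (nsets K 2) = K" by (rule Union_nsets_2)
qed

lemma card_cliques: "card {E \<in> cliques. P E} = card {K \<in> nsets A k. P (nsets K 2)}"
proof -
  have "{E \<in> cliques. P E} = (\<lambda>K. nsets K 2) ` {K \<in> nsets A k. P (nsets K 2)}"
    unfolding cliques_def by blast
  moreover have "inj_on (\<lambda>K. nsets K 2) {K \<in> nsets A k. P (nsets K 2)}"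
    by (rule inj_on_subset [OF inj_cliques]) blast
  ultimately show ?thesis by (simp add: card_image)
qed

lemma cliques_members:
  assumes "E \<in> cliques"
  shows "E \<subseteq> V \<and> E \<noteq> {} \<and> card E \<le> l"
proof -
  obtain K where K: "K \<in> nsets A k" "E = nsets K 2" using assms unfolding cliques_def by blast
  then have K': "K \<subseteq> A" "finite K" "card K = k" unfolding nsets_def by auto
  have "card E = l" using K K' unfolding l_def by simp
  moreover have "E \<noteq> {}" using \<open>card E = l\<close> l_ge by auto
  moreover have "E \<subseteq> V" unfolding V_def K(2) by (rule nsets_mono [OF K'(1)])
  ultimately show ?thesis by simp
qed

lemma card_V_bounds: "real (card V) \<le> real n ^ 2" "real n ^ 2 \<le> 4 * real (card V)" "0 < real (card V)"
proof -
  have "card V \<le> n ^ 2" unfolding V(2) by (rule binomial_le_power)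
  then have "real (card V) \<le> real (n ^ 2)" by (simp only: of_nat_le_iff)
  then show "real (card V) \<le> real n ^ 2" by simp
  have "n \<le> 2 * (n - 1)" using n_ge by linarith
  then have "n * n \<le> n * (2 * (n - 1))" by (rule mult_left_mono) simp
  also have "\<dots> = 4 * card V" unfolding V(2) using two_choose_two [of n] by linarith
  finally have "real (n * n) \<le> real (4 * card V)" by (simp only: of_nat_le_iff)
  then show "real n ^ 2 \<le> 4 * real (card V)" by (simp add: power2_eq_square)
  moreover have "0 < real n ^ 2" using n_ge by simp
  ultimately show "0 < real (card V)" by linarith
qed

text \<open>The cliques through \<open>F\<close> are governed by the number \<open>v\<close> of
  vertices that \<open>F\<close> spans: at most \<open>n ^ (k - v)\<close> if
  \<open>v \<le> k\<close> and none beyond. Two distinct edges span at least three vertices, and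
  \<open>v\<close> vertices carry at most \<open>v choose 2\<close> edges, as
  \<open>codegree_numeric\<close> requires.\<close>

lemma clique_codegree:
  assumes F: "F \<subseteq> V" "2 \<le> card F" "card F \<le> l"
  shows "real (card V) * (4 * real l / p) ^ (card F - 1) * real (card {E \<in> cliques. F \<subseteq> E})
    \<le> real n ^ k / m ^ (k + 2)"
proof -
  define v where "v = card (\<Union> F)"
  have finF: "finite F" using F(1) V(1) finite_subset by blast
  have FA: "\<Union> F \<subseteq> A" using F(1) unfolding V_def nsets_def by blast
  have finU: "finite (\<Union> F)" using FA A(1) finite_subset by blast
  have "F \<subseteq> nsets (\<Union> F) 2" using F(1) unfolding V_def nsets_def by blast
  then have jv: "card F \<le> v choose 2"
    using card_mono [OF finite_imp_finite_nsets [OF finU]] unfolding v_def by (metis card_nsets)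
  have v3: "3 \<le> v"
  proof (rule ccontr)
    assume "\<not> 3 \<le> v"
    then have "v choose 2 \<le> 2 choose 2" by (intro binomial_right_mono) simp
    then show False using jv F(2) by simp
  qed
  have "card {E \<in> cliques. F \<subseteq> E} = card {K \<in> nsets A k. F \<subseteq> nsets K 2}" by (rule card_cliques)
  also have "\<dots> \<le> card {K \<in> nsets A k. \<Union> F \<subseteq> K}"
  proof (rule card_mono)
    show "finite {K \<in> nsets A k. \<Union> F \<subseteq> K}" using A(1) by (simp add: finite_imp_finite_nsets)
    show "{K \<in> nsets A k. F \<subseteq> nsets K 2} \<subseteq> {K \<in> nsets A k. \<Union> F \<subseteq> K}"
      unfolding nsets_def by blast
  qed
  finally have le: "card {E \<in> cliques. F \<subseteq> E} \<le> card {K \<in> nsets A k. \<Union> F \<subseteq> K}" .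
  have lam0: "0 \<le> (4 * real l / p) ^ (card F - 1)" using pq(1) by simp
  show ?thesis
  proof (cases "v \<le> k")
    case True
    have "card {E \<in> cliques. F \<subseteq> E} \<le> n ^ (k - v)"
      using le card_supersets_le_power [OF A(1) FA, of k] A(2) unfolding v_def by simp
    then have "real (card {E \<in> cliques. F \<subseteq> E}) \<le> real n ^ (k - v)"
      unfolding of_nat_power [symmetric] of_nat_le_iff .
    then have "real (card V) * (4 * real l / p) ^ (card F - 1) * real (card {E \<in> cliques. F \<subseteq> E})
        \<le> real n ^ 2 * (4 * real l / p) ^ (card F - 1) * real n ^ (k - v)"
      using card_V_bounds lam0 by (intro mult_mono mult_nonneg_nonneg) auto
    also have "\<dots> \<le> real n ^ k / m ^ (k + 2)" by (rule codegree_numeric [OF F(2,3) jv v3 True])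
    finally show ?thesis .
  next
    case False
    have "{K \<in> nsets A k. \<Union> F \<subseteq> K} = {}"
    proof (rule ccontr)
      assume "\<not> ?thesis"
      then obtain K where "K \<in> nsets A k" "\<Union> F \<subseteq> K" by blast
      then have "finite K" "card K = k" unfolding nsets_def by auto
      then have "v \<le> k" using card_mono \<open>\<Union> F \<subseteq> K\<close> unfolding v_def by metis
      then show False using False by simp
    qed
    then have "card {E \<in> cliques. F \<subseteq> E} = 0" using le by (metis card.empty le_zero_eq)
    then show ?thesis using m by simp
  qed
qed

lemma covered_probability:
  "bexp q V (\<lambda>X. of_bool (covered X)) \<le> exp (- (q * real (card V) / (4 * real R ^ 2)))"
proof -
  define N where "N = real (card V)"
  define \<mu> where "\<mu> = real n ^ k / m ^ (k + 2)"
  define \<sigma> where "\<sigma> = nat \<lfloor>16 * real l * p * N\<rfloor>"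
  \<comment> \<open>\<open>\<delta>\<close> is the proportion of edges that
    \<open>supersaturation\<close> leaves outside the containers, and \<open>lam\<close> is the
    largest value with \<open>2 ^ r * lam \<le> \<delta> / 2\<close>.\<close>
  define \<delta> where "\<delta> = 1 / real R ^ 2"
  define lam where "lam = 1 / (2 ^ (r + 1) * real R ^ 2)"
  have Rp: "real R \<ge> 1" using k R by simp
  have \<mu>0: "0 \<le> \<mu>" unfolding \<mu>_def using m by simp
  have Vne: "V \<noteq> {}" using card_V_bounds(3) by auto
  have l1: "1 \<le> l" using l_ge by simp
  have "\<exists>C h. \<forall>I. I \<subseteq> V \<and> (\<forall>E\<in>cliques. \<not> E \<subseteq> I) \<longrightarrow>
      h I \<subseteq> I \<and> I \<subseteq> C (h I) \<and> C (h I) \<subseteq> V \<and> real (card (h I)) \<le> 16 * real l * p * real (card V) \<and>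
      real (card {E \<in> cliques. E \<subseteq> C (h I)}) \<le> real l * \<mu>"
    using cliques_members clique_codegree unfolding \<mu>_def
    by (intro hypergraph_containers V(1) Vne pq(1,2) l1 \<mu>0 [unfolded \<mu>_def]) auto
  then obtain C h where Ch: "\<forall>I. I \<subseteq> V \<and> clique_free I \<longrightarrow>
      h I \<subseteq> I \<and> I \<subseteq> C (h I) \<and> C (h I) \<subseteq> V \<and> real (card (h I)) \<le> 16 * real l * p * real (card V) \<and>
      real (card {E \<in> cliques. E \<subseteq> C (h I)}) \<le> real l * \<mu>"
    unfolding clique_free_def by (elim exE)
  have cont: "h I \<subseteq> I \<and> I \<subseteq> C (h I) \<and> C (h I) \<subseteq> V \<and> real (card (h I)) \<le> 16 * real l * p * N \<and>
      real (card {E \<in> cliques. E \<subseteq> C (h I)}) \<le> real l * \<mu>" if "I \<subseteq> V" "clique_free I" for I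
    using Ch [THEN spec, of I] that unfolding N_def by blast
  have "bexp q V (\<lambda>X. of_bool (\<exists>Is. (\<forall>i<r. Is i \<subseteq> V \<and> clique_free (Is i)) \<and> X = (\<Union>i<r. Is i)))
    \<le> exp (- \<delta> * q * real (card V) / 2) * (1 / lam) ^ (r * \<sigma>)"
  proof (rule covered_by_independent_bound [OF V(1), where g = h and C = C])
    show "0 \<le> q" "q \<le> 1" using pq by auto
    have "1 * 1 \<le> 2 ^ (r + 1) * real R ^ 2" using Rp by (intro mult_mono one_le_power) auto
    then show "0 < lam" "lam \<le> 1" unfolding lam_def by (simp_all add: divide_le_eq_1)
    show "2 ^ r * lam \<le> \<delta> / 2" unfolding lam_def \<delta>_def by simp
  next
    fix I assume "I \<subseteq> V" "clique_free I"
    note c = cont [OF this]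
    have "card (h I) \<le> \<sigma>" using c unfolding \<sigma>_def by (simp add: le_nat_floor)
    then show "h I \<subseteq> I \<and> I \<subseteq> C (h I) \<and> card (h I) \<le> \<sigma>" using c by blast
  next
    fix Is :: "nat \<Rightarrow> nat set set" assume Is: "\<And>i. i < r \<Longrightarrow> Is i \<subseteq> V \<and> clique_free (Is i)"
    define D where "D = (\<lambda>i. C (h (Is i)))"
    have few: "real (card {K \<in> nsets A k. nsets K 2 \<subseteq> D i}) \<le> real l * \<mu>" if "i < r" for i
      using cont [of "Is i"] Is [OF that] card_cliques [of "\<lambda>E. E \<subseteq> C (h (Is i))"] unfolding D_def by simp
    have "2 * (\<Sum>i<r. card {K \<in> nsets A k. nsets K 2 \<subseteq> D i}) * (R choose k) \<le> card A choose k"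
    proof -
      have "(\<Sum>i<r. real (card {K \<in> nsets A k. nsets K 2 \<subseteq> D i})) \<le> (\<Sum>i<r. real l * \<mu>)"
        using few by (intro sum_mono) auto
      then have s: "(\<Sum>i<r. real (card {K \<in> nsets A k. nsets K 2 \<subseteq> D i})) \<le> real r * (real l * \<mu>)" by simp
      have "real (R choose k) \<le> real R ^ k"
        using binomial_le_power [of R k] unfolding of_nat_power [symmetric] of_nat_le_iff .
      then have "2 * (\<Sum>i<r. real (card {K \<in> nsets A k. nsets K 2 \<subseteq> D i})) * real (R choose k)
          \<le> 2 * (real r * (real l * \<mu>)) * real R ^ k"
        using s \<mu>0 by (intro mult_mono mult_nonneg_nonneg sum_nonneg) auto
      also have "\<dots> \<le> (real n / real k) ^ k" unfolding \<mu>_def by (rule cliques_numeric)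
      also have "\<dots> \<le> real (n choose k)" by (rule binomial_ge_n_over_k_pow_k [OF n_ge(2)])
      finally have "real (2 * (\<Sum>i<r. card {K \<in> nsets A k. nsets K 2 \<subseteq> D i}) * (R choose k)) \<le> real (n choose k)"
        by simp
      then show ?thesis unfolding A(2) of_nat_le_iff .
    qed
    then have "card A choose 2 \<le> R\<^sup>2 * card (nsets A 2 - (\<Union>i<r. D i))"
      using k r n_ge(1) A(2) by (intro supersaturation [OF A(1) R_def]) auto
    then have "card V \<le> R\<^sup>2 * card (V - (\<Union>i<r. D i))" unfolding A(2) V(2) [symmetric] V_def [symmetric] .
    then have "real (card V) \<le> real (R\<^sup>2 * card (V - (\<Union>i<r. D i)))" by (simp only: of_nat_le_iff)
    then have "real (card V) \<le> real R ^ 2 * real (card (V - (\<Union>i<r. D i)))" by simp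
    then have "\<delta> * real (card V) \<le> real (card (V - (\<Union>i<r. D i)))"
      using Rp unfolding \<delta>_def by (simp add: field_simps)
    then show "\<delta> * real (card V) \<le> real (card (V - (\<Union>i<r. C (h (Is i)))))" unfolding D_def .
  qed
  \<comment> \<open>The fingerprints use up half of the remaining exponent q N / (2 R^2).\<close>
  also have "\<dots> \<le> exp (- \<delta> * q * N / 2) * exp (q * N / (4 * real R ^ 2))"
  proof (rule mult_mono)
    have s0: "0 \<le> 16 * real l * p * N" using pq unfolding N_def by simp
    then have s: "real \<sigma> \<le> 16 * real l * p * N" unfolding \<sigma>_def by linarith
    have "(1 / lam) ^ (r * \<sigma>) \<le> exp (3 * real R) ^ (r * \<sigma>)"
      unfolding lam_def using colour_base_numeric by (intro power_mono) auto
    also have "\<dots> = exp (3 * real R * (real r * real \<sigma>))"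
      by (simp add: exp_of_nat_mult [symmetric] mult_ac)
    also have "\<dots> \<le> exp (q * N / (4 * real R ^ 2))"
    proof -
      have "3 * real R * (real r * real \<sigma>) \<le> 3 * real R * (real r * (16 * real l * p * N))"
        using s by (intro mult_left_mono) auto
      also have "\<dots> \<le> q * N / (4 * real R ^ 2)" by (rule entropy_numeric) (simp add: N_def)
      finally show ?thesis by simp
    qed
    finally show "(1 / lam) ^ (r * \<sigma>) \<le> exp (q * N / (4 * real R ^ 2))" .
  qed (auto simp: N_def lam_def)
  also have "\<dots> = exp (- (q * N / (4 * real R ^ 2)))"
    unfolding exp_add [symmetric] \<delta>_def using Rp by (simp add: field_simps)
  finally show ?thesis unfolding covered_def N_def .
qed

text \<open>Harris' inequality gives a product of factors \<open>1 - q ^ card F\<close>, each at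
  least \<open>exp (- 2 * q ^ card F)\<close> because \<open>q \<le> 1 / 2\<close>. The factor 32 in
  \<open>short_cycles_numeric\<close> is 2 * 4 * 4: the 2 from this estimate, a 4 from the exponent,
  and a 4 from \<open>n ^ 2 \<le> 4 * card V\<close>.\<close>

lemma short_cycle_free_probability:
  "exp (- (q * real (card V) / (4 * real R ^ 2))) < bexp q V (\<lambda>X. of_bool (no_short_cycle A k g X))"
proof -
  have q1: "0 \<le> q" "q \<le> 1" using pq by auto
  have sc: "finite (short_cycles A k g)"
    by (rule short_cycles_sum(1) [OF A q1 k, of \<Gamma>]) (erule (1) closing_numeric | rule closing_numeric')+
  have le: "(\<Sum>F\<in>short_cycles A k g. q ^ card F) \<le>
      (\<Sum>t<g - 2. real n ^ k * q ^ (k choose 2) * (real k ^ 2 * (real n ^ (k - 2) * q ^ ((k choose 2) - 1))) ^ t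
        * (real k * real (g * k) ^ k * \<Gamma>))"
    by (rule short_cycles_sum(2) [OF A q1 k]) (erule (1) closing_numeric | rule closing_numeric')+
  have Rp: "real R \<ge> 1" using k R by simp
  have SF: "F \<subseteq> V \<and> card F \<ge> 1" if F: "F \<in> short_cycles A k g" for F
  proof -
    obtain K Bs t where KB: "F = edges_of (K # Bs)" "Bs \<in> clique_paths A k t" "K \<in> nsets A k"
      using F unfolding short_cycles_def by blast
    have K: "K \<subseteq> A" "finite K" "card K = k" using KB(3) unfolding nsets_def by auto
    have sub: "F \<subseteq> V"
    proof -
      have "B \<subseteq> A" if "B \<in> set (K # Bs)" for B
        using that K(1) clique_paths_set [OF KB(2)] unfolding nsets_def by auto
      then show ?thesis unfolding KB(1) edges_of_def V_def using nsets_mono by blast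
    qed
    have "nsets K 2 \<subseteq> F" unfolding KB(1) edges_of_Cons by blast
    then have "card (nsets K 2) \<le> card F" using finite_subset [OF sub V(1)] by (intro card_mono)
    then have "l \<le> card F" using K(3) unfolding l_def by simp
    then show ?thesis using sub l_ge by simp
  qed
  define \<Sigma> where "\<Sigma> = (\<Sum>F\<in>short_cycles A k g. q ^ card F)"
  have "\<Sigma> * (32 * real R ^ 2) < q * real n ^ 2"
    using mult_right_mono [OF le, of "32 * real R ^ 2"] short_cycles_numeric unfolding \<Sigma>_def by simp
  also have "\<dots> \<le> q * (4 * real (card V))" using card_V_bounds(2) q1 by (intro mult_left_mono) auto
  finally have "\<Sigma> * 8 * real R ^ 2 < q * real (card V)" by simp
  then have "2 * \<Sigma> < q * real (card V) / (4 * real R ^ 2)" using Rp by (simp add: field_simps)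
  then have "exp (- (q * real (card V) / (4 * real R ^ 2))) < exp (- (2 * \<Sigma>))" by simp
  also have "\<dots> = (\<Prod>F\<in>short_cycles A k g. exp (- 2 * q ^ card F))"
    unfolding \<Sigma>_def by (simp add: exp_sum [OF sc] sum_distrib_left sum_negf [symmetric])
  also have "\<dots> \<le> (\<Prod>F\<in>short_cycles A k g. 1 - q ^ card F)"
  proof (rule prod_mono)
    fix F assume F: "F \<in> short_cycles A k g"
    have "q ^ card F \<le> q ^ 1" using SF [OF F] q1 by (intro power_decreasing) auto
    then have "q ^ card F \<le> 1 / 2" using pq(4) by simp
    then show "0 \<le> exp (- 2 * q ^ card F) \<and> exp (- 2 * q ^ card F) \<le> 1 - q ^ card F"
      using exp_le_one_minus [of "q ^ card F"] q1 by simp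
  qed
  also have "\<dots> \<le> bexp q V (\<lambda>X. of_bool (\<forall>F\<in>short_cycles A k g. \<not> F \<subseteq> X))"
    by (rule harris_avoid [OF V(1) q1 sc]) (rule conjunct1 [OF SF])
  finally show ?thesis unfolding no_short_cycle_iff .
qed

text \<open>The colour classes of a colouring without monochromatic clique would be clique-free sets
  with union \<open>X\<close>.\<close>

lemma not_covered_chromatic:
  assumes X: "X \<subseteq> V" "\<not> covered X"
  shows "chromatic_number (clique_hypergraph A X k) > r"
proof -
  have sg: "simple_graph A X" using X(1) A(1) unfolding simple_graph_def V_def by blast
  have "\<exists>K\<in>nsets A k. clique K X \<and> (\<exists>i. f ` nsets K 2 \<subseteq> {i})" if f: "f \<in> X \<rightarrow> {..<r}" for f
  proof (rule ccontr)
    assume no: "\<not> ?thesis"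
    define Is where "Is = (\<lambda>i. {e \<in> X. f e = i})"
    have free: "clique_free (Is i)" for i
      unfolding clique_free_def cliques_def
    proof (intro ballI notI)
      fix E assume "E \<in> (\<lambda>K. nsets K 2) ` nsets A k" "E \<subseteq> Is i"
      then obtain K where K: "K \<in> nsets A k" "nsets K 2 \<subseteq> Is i" by blast
      then have "clique K X" "f ` nsets K 2 \<subseteq> {i}" unfolding Is_def clique_iff_nsets by blast+
      then show False using no K(1) by blast
    qed
    have sub: "Is i \<subseteq> V" for i using X(1) unfolding Is_def by blast
    have "X = (\<Union>i<r. Is i)" using f unfolding Is_def by auto
    then have "covered X" unfolding covered_def using free sub by (intro exI [of _ Is] conjI allI impI)
    then show False using X(2) by simp
  qed
  then show ?thesis by (intro chromatic_number_clique_hypergraph [OF sg k, THEN iffD2] ballI)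
qed

lemma high_girth_ramsey_graph:
  "\<exists>(V :: nat set) E. simple_graph V E \<and>
    chromatic_number (clique_hypergraph V E k) > r \<and>
    girth_at_least (k choose 2) (clique_hypergraph V E k) g \<and>
    card V \<le> k ^ (40 * g * k ^ 4) * ramsey_number k r ^ (40 * g * k ^ 2)"
proof -
  \<comment> \<open>If every edge set without short cycles were covered, monotonicity of the
    expectation would reverse the strict inequality between the two probabilities.\<close>
  have "\<exists>X. X \<subseteq> V \<and> no_short_cycle A k g X \<and> \<not> covered X"
  proof (rule ccontr)
    assume "\<not> ?thesis"
    then have "bexp q V (\<lambda>X. of_bool (no_short_cycle A k g X)) \<le> bexp q V (\<lambda>X. of_bool (covered X))"
      using pq by (intro bexp_mono) auto
    then show False using covered_probability short_cycle_free_probability by linarith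
  qed
  then obtain X where X: "X \<subseteq> V" "no_short_cycle A k g X" "\<not> covered X" by blast
  show ?thesis
  proof (intro exI conjI)
    show "simple_graph A X" using X(1) A(1) unfolding simple_graph_def V_def by blast
    show "chromatic_number (clique_hypergraph A X k) > r" by (rule not_covered_chromatic [OF X(1,3)])
    show "girth_at_least (k choose 2) (clique_hypergraph A X k) g"
      using no_short_cycle_girth [OF X(2)] k by simp
    show "card A \<le> k ^ (40 * g * k ^ 4) * ramsey_number k r ^ (40 * g * k ^ 2)"
      unfolding A(2) by (rule card_numeric)
  qed
qed

end

theorem theorem1p4:
  fixes k g r :: nat
  assumes "k \<ge> 3" and "g \<ge> 3" and "r \<ge> 2"
  shows "\<exists>(V :: nat set) E. simple_graph V E \<and>
    chromatic_number (clique_hypergraph V E k) > r \<and>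
    girth_at_least (k choose 2) (clique_hypergraph V E k) g \<and>
    card V \<le> k ^ (40 * g * k ^ 4) * ramsey_number k r ^ (40 * g * k ^ 2)"
proof -
  interpret parameters k g r using assms by unfold_locales
  show ?thesis by (rule high_girth_ramsey_graph)
qed

end
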